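(* Let $\alpha\in[0,\infty)$ be a parameter and let $V\in C_c^\infty(\mathbb{R}^3)$ be nonnegative and not identically zero. Suppose that for $\alpha\ge\alpha_1$ the principal eigenvalue $\lambda_1(\alpha)$ of the operator $-\Delta-\alpha V$ is negative. Assume further that $(\alpha_2,0)\in(\alpha_1,\infty)\times\dot H^1(\mathbb{R}^3)$ is a bifurcation point for the equation $$-\Delta\phi-\alpha V\phi+\phi^5=0\qquad(\ast)$$ in the sense that for any $\epsilon>0$ there is a nontrivial radial solution (steady state) $(\alpha,\phi)$ of $(\ast)$ with $$|\alpha-\alpha_2|+\|\phi\|_{\dot H^1(\mathbb{R}^3)}\le\epsilon.\qquad(\ast\ast)$$ Then for $\epsilon$ sufficiently small, any such steady state $(\alpha,\phi)$ satisfying $(\ast\ast)$ is unstable.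
   Context: Steady states are solutions $\phi\in\dot H^1(\mathbb{R}^3)$ of $(\ast)$ in the sense of distributions, i.e. time independent solutions of $\partial_{tt}u-\Delta u-\alpha Vu+u^5=0$. The principal eigenvalue is the lowest eigenvalue. A steady state $(\alpha,\phi)$ is unstable if the linearized operator $-\Delta-\alpha V+5\phi^4$ has at least one negative eigenvalue. *)

theory Defs
  imports "HOL-Analysis.Analysis"
begin

text \<open>Functions are real-valued Borel functions on \<open>\<real>\<^sup>n\<close>, standing for their classes modulo
  equality almost everywhere.\<close>

definition partial_deriv :: "'n::finite \<Rightarrow> (real^'n \<Rightarrow> real) \<Rightarrow> real^'n \<Rightarrow> real" where
  "partial_deriv i f x = frechet_derivative f (at x) (axis i 1)"

definition laplacian :: "(real^'n::finite \<Rightarrow> real) \<Rightarrow> real^'n \<Rightarrow> real" where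
  "laplacian f x = (\<Sum>i\<in>UNIV. partial_deriv i (partial_deriv i f) x)"

primrec C_k :: "nat \<Rightarrow> (real^'n::finite \<Rightarrow> real) \<Rightarrow> bool" where
  "C_k 0 f \<longleftrightarrow> continuous_on UNIV f"
| "C_k (Suc k) f \<longleftrightarrow> (\<forall>x. f differentiable (at x)) \<and> (\<forall>i. C_k k (partial_deriv i f))"

definition Cc_infinity :: "(real^'n::finite \<Rightarrow> real) set" where
  "Cc_infinity = {f. (\<forall>k. C_k k f) \<and> compact (closure {x. f x \<noteq> 0})}"

definition Lp :: "nat \<Rightarrow> (real^'n::finite \<Rightarrow> 'b::euclidean_space) set" where
  "Lp p = {f \<in> borel_measurable lborel. integrable lborel (\<lambda>x. norm (f x) ^ p)}"

definition locally_integrable :: "(real^'n::finite \<Rightarrow> 'b::euclidean_space) \<Rightarrow> bool" where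
  "locally_integrable f \<longleftrightarrow>
     f \<in> borel_measurable lborel \<and> (\<forall>K. compact K \<longrightarrow> set_integrable lborel K f)"

definition has_weak_gradient ::
    "(real^'n::finite \<Rightarrow> real) \<Rightarrow> (real^'n \<Rightarrow> real^'n) \<Rightarrow> bool" where
  "has_weak_gradient u G \<longleftrightarrow> locally_integrable u \<and> locally_integrable G \<and>
     (\<forall>\<eta>\<in>Cc_infinity. \<forall>i.
        (LINT x|lborel. u x * partial_deriv i \<eta> x) = - (LINT x|lborel. G x $ i * \<eta> x))"

text \<open>A weak gradient is unique only almost everywhere, whence the choice of a representative.\<close>

definition weak_gradient :: "(real^'n::finite \<Rightarrow> real) \<Rightarrow> real^'n \<Rightarrow> real^'n" where
  "weak_gradient u = (SOME G. has_weak_gradient u G)"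

text \<open>\<open>\<Delta>u = f\<close> in the sense of distributions.\<close>

definition has_distr_laplacian ::
    "(real^'n::finite \<Rightarrow> real) \<Rightarrow> (real^'n \<Rightarrow> real) \<Rightarrow> bool" where
  "has_distr_laplacian u f \<longleftrightarrow> locally_integrable u \<and> locally_integrable f \<and>
     (\<forall>\<eta>\<in>Cc_infinity. (LINT x|lborel. u x * laplacian \<eta> x) = (LINT x|lborel. f x * \<eta> x))"

definition H1 :: "(real^'n::finite \<Rightarrow> real) set" where
  "H1 = {u \<in> Lp 2. \<exists>G\<in>Lp 2. has_weak_gradient u G}"

text \<open>In dimension 3 the completion of \<open>C\<^sub>c\<^sup>\<infinity>\<close> in the norm \<open>\<parallel>\<nabla>u\<parallel>\<close> of \<open>L\<^sup>2\<close> is realised as a space of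
  functions in \<open>L\<^sup>6\<close>, where \<open>6 = 2n/(n - 2)\<close> is the Sobolev exponent. Membership in \<open>L\<^sup>6\<close> also
  excludes the nonzero constants, on which the norm vanishes.\<close>

definition H1_dot :: "(real^3 \<Rightarrow> real) set" where
  "H1_dot = {u \<in> Lp 6. \<exists>G\<in>Lp 2. has_weak_gradient u G}"

definition H1_dot_norm :: "(real^3 \<Rightarrow> real) \<Rightarrow> real" where
  "H1_dot_norm u = sqrt (LINT x|lborel. (norm (weak_gradient u x))\<^sup>2)"

text \<open>The graph of the operator \<open>-\<Delta> + W\<close> on \<open>L\<^sup>2(\<real>\<^sup>3)\<close>: \<open>\<psi>\<close> lies in its domain and is mapped to
  \<open>g\<close>. For \<open>W\<close> in \<open>L\<^sup>3\<^sup>/\<^sup>2 + L\<^sup>\<infinity>\<close> this is the self-adjoint operator given by the quadratic form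
  \<open>\<integral> |\<nabla>\<psi>|\<^sup>2 + W \<psi>\<^sup>2\<close> on \<open>H\<^sup>1\<close>; for bounded \<open>W\<close> its domain is \<open>H\<^sup>2\<close>. The potentials \<open>-\<alpha>V\<close> and
  \<open>-\<alpha>V + 5\<phi>\<^sup>4\<close> with \<open>\<phi>\<close> in \<open>H1_dot\<close> are of this kind. Since \<open>W\<close> is real, real eigenfunctions
  suffice.\<close>

definition schrodinger_op ::
    "(real^3 \<Rightarrow> real) \<Rightarrow> (real^3 \<Rightarrow> real) \<Rightarrow> (real^3 \<Rightarrow> real) \<Rightarrow> bool" where
  "schrodinger_op W \<psi> g \<longleftrightarrow>
     \<psi> \<in> H1 \<and> g \<in> Lp 2 \<and> has_distr_laplacian \<psi> (\<lambda>x. W x * \<psi> x - g x)"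

definition nontrivial :: "(real^3 \<Rightarrow> real) \<Rightarrow> bool" where
  "nontrivial u \<longleftrightarrow> \<not> (AE x in lborel. u x = 0)"

definition schrodinger_eigenvalue :: "(real^3 \<Rightarrow> real) \<Rightarrow> real \<Rightarrow> bool" where
  "schrodinger_eigenvalue W \<mu> \<longleftrightarrow> (\<exists>\<psi>. nontrivial \<psi> \<and> schrodinger_op W \<psi> (\<lambda>x. \<mu> * \<psi> x))"

definition principal_eigenvalue :: "(real^3 \<Rightarrow> real) \<Rightarrow> real \<Rightarrow> bool" where
  "principal_eigenvalue W \<mu> \<longleftrightarrow>
     schrodinger_eigenvalue W \<mu> \<and> (\<forall>\<nu>. schrodinger_eigenvalue W \<nu> \<longrightarrow> \<mu> \<le> \<nu>)"

definition radial :: "(real^3 \<Rightarrow> real) \<Rightarrow> bool" where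
  "radial u \<longleftrightarrow> (\<exists>f. AE x in lborel. u x = f (norm x))"

text \<open>\<open>-\<Delta>\<phi> - \<alpha>V\<phi> + \<phi>\<^sup>5 = 0\<close> in the sense of distributions.\<close>

definition steady_state :: "(real^3 \<Rightarrow> real) \<Rightarrow> real \<Rightarrow> (real^3 \<Rightarrow> real) \<Rightarrow> bool" where
  "steady_state V \<alpha> \<phi> \<longleftrightarrow>
     \<phi> \<in> H1_dot \<and> has_distr_laplacian \<phi> (\<lambda>x. - \<alpha> * V x * \<phi> x + \<phi> x ^ 5)"

definition unstable :: "(real^3 \<Rightarrow> real) \<Rightarrow> real \<Rightarrow> (real^3 \<Rightarrow> real) \<Rightarrow> bool" where
  "unstable V \<alpha> \<phi> \<longleftrightarrow>
     (\<exists>\<mu><0. schrodinger_eigenvalue (\<lambda>x. - \<alpha> * V x + 5 * \<phi> x ^ 4) \<mu>)"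

end

theory Submission
  imports Defs "HOL-Complex_Analysis.Great_Picard"
begin

text \<open>The eigenfunction at \<open>\<alpha>\<^sub>2\<close> is approximated by a test function on which the form of
  \<open>-\<Delta> - \<alpha>\<^sub>2V\<close> is negative. It remains negative for \<open>-\<Delta> - \<alpha>V + 5\<phi>\<^sup>4\<close> after the test function
  is damped where \<open>\<bar>\<phi>\<bar>\<close> is not small: Hardy's inequality bounds the cost by \<open>\<parallel>\<nabla>\<phi>\<parallel>\<close>, so no
  Sobolev inequality is needed. A negative value of the form yields a negative eigenvalue: a minimising sequence
  normalised by \<open>\<integral> \<alpha>Vu\<^sup>2 = 1\<close> converges strongly, because that term is compact (Rellich)
  and the form is nonnegative once shifted by the infimum.\<close>

subsection \<open>Smooth functions with compact support\<close>

text \<open>The smallness of \<open>\<phi>\<close> is measured by its gradient only, while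
  \<open>\<phi>^4\<close> is locally integrable and possibly unbounded, so its form on a fixed test
  function is not small pointwise. The damping factor \<open>1 / (1 + k \<phi>^2)\<close> caps
  \<open>\<phi>^4\<close> at \<open>1 / k^2\<close>. The price is of order \<open>k\<close> times
  the squared gradient norm, hence \<open>k\<close> is fixed independently of \<open>\<phi>\<close>
  and \<open>\<epsilon>\<close> is chosen last. As \<open>\<phi>\<close> is not smooth, the factor
  is built from smooth approximants of \<open>\<phi>\<close>, and the sign of the form is read off
  in the limit. On the spectral side the obstacle is the unbounded domain: a sequence normalised in
  L2 can lose its mass at infinity, whereas the weight \<open>\<alpha> V\<close> has compact
  support. As the infimum of the Rayleigh quotient is strictly negative, the shifted form also
  controls the L2 norm, which places the limit in \<open>H1\<close>. \<open>V\<close> itself, a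
  nonnegative and nonzero test function, supplies all mollifiers and cutoffs by rescaling.\<close>

definition grad :: "(real^'n::finite \<Rightarrow> real) \<Rightarrow> real^'n \<Rightarrow> real^'n" where
  "grad f x = (\<chi> i. partial_deriv i f x)"

definition smooth :: "(real^'n::finite \<Rightarrow> real) \<Rightarrow> bool" where
  "smooth f \<longleftrightarrow> (\<forall>k. C_k k f)"

lemma grad_nth [simp]: "grad f x $ i = partial_deriv i f x"
  by (simp add: grad_def)

lemma partial_derivI:
  assumes "(f has_derivative f') (at x)"
  shows "partial_deriv i f x = f' (axis i 1)"
  using frechet_derivative_at[OF assms] by (simp add: partial_deriv_def)

text \<open>The product and inverse rules multiply a derivative by an undifferentiated factor, so
  their inductions need that factor at the lower order as well.\<close>

lemma C_k_SucD: "C_k (Suc k) f \<Longrightarrow> C_k k f"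
proof (induction k arbitrary: f)
  case 0
  then show ?case
    by (auto simp: continuous_on_eq_continuous_at intro!: differentiable_imp_continuous_within)
next
  case (Suc k)
  then show ?case by simp
qed

lemma C_k_const [simp]: "C_k k (\<lambda>x. c)"
proof (induction k arbitrary: c)
  case (Suc k)
  have "partial_deriv i (\<lambda>x. c) = (\<lambda>x. 0)" for i :: 'a
    by (rule ext, subst partial_derivI[OF has_derivative_const]) simp
  then show ?case using Suc by simp
qed simp

lemma partial_deriv_add:
  assumes "f differentiable (at x)" "g differentiable (at x)"
  shows "partial_deriv i (\<lambda>x. f x + g x) x = partial_deriv i f x + partial_deriv i g x"
proof -
  have "((\<lambda>x. f x + g x) has_derivative
      (\<lambda>h. frechet_derivative f (at x) h + frechet_derivative g (at x) h)) (at x)"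
    using assms by (intro has_derivative_add) (auto simp: frechet_derivative_works)
  from partial_derivI[OF this] show ?thesis by (simp add: partial_deriv_def)
qed

lemma C_k_add:
  assumes "C_k k f" "C_k k g"
  shows "C_k k (\<lambda>x. f x + g x)"
  using assms
proof (induction k arbitrary: f g)
  case 0
  then show ?case by (simp add: continuous_on_add)
next
  case (Suc k)
  have "partial_deriv i (\<lambda>x. f x + g x) = (\<lambda>x. partial_deriv i f x + partial_deriv i g x)" for i
    using Suc.prems by (intro ext partial_deriv_add) auto
  with Suc show ?case by simp
qed

lemma partial_deriv_mult:
  assumes "f differentiable (at x)" "g differentiable (at x)"
  shows "partial_deriv i (\<lambda>x. f x * g x) x = f x * partial_deriv i g x + partial_deriv i f x * g x"
proof -
  have "((\<lambda>x. f x * g x) has_derivative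
      (\<lambda>h. f x * frechet_derivative g (at x) h + frechet_derivative f (at x) h * g x)) (at x)"
    using assms by (intro has_derivative_mult) (auto simp: frechet_derivative_works)
  from partial_derivI[OF this] show ?thesis by (simp add: partial_deriv_def)
qed

lemma C_k_mult:
  assumes "C_k k f" "C_k k g"
  shows "C_k k (\<lambda>x. f x * g x)"
  using assms
proof (induction k arbitrary: f g)
  case 0
  then show ?case by (simp add: continuous_on_mult)
next
  case (Suc k)
  have "partial_deriv i (\<lambda>x. f x * g x) = (\<lambda>x. f x * partial_deriv i g x + partial_deriv i f x * g x)" for i
    using Suc.prems by (intro ext partial_deriv_mult) auto
  moreover have "C_k k (\<lambda>x. f x * partial_deriv i g x + partial_deriv i f x * g x)" for i
    using Suc.prems C_k_SucD[OF Suc.prems(1)] C_k_SucD[OF Suc.prems(2)]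
    by (intro C_k_add Suc.IH) auto
  ultimately show ?case using Suc.prems by simp
qed

lemma partial_deriv_inverse:
  assumes "f differentiable (at x)" "f x \<noteq> 0"
  shows "partial_deriv i (\<lambda>x. inverse (f x)) x = - (inverse (f x) * partial_deriv i f x * inverse (f x))"
proof -
  have "((\<lambda>x. inverse (f x)) has_derivative
      (\<lambda>h. - (inverse (f x) * frechet_derivative f (at x) h * inverse (f x)))) (at x)"
    using assms by (intro Deriv.has_derivative_inverse) (auto simp: frechet_derivative_works)
  from partial_derivI[OF this] show ?thesis by (simp add: partial_deriv_def)
qed

lemma C_k_inverse:
  assumes "C_k k f" "\<And>x. f x \<noteq> 0"
  shows "C_k k (\<lambda>x. inverse (f x))"
  using assms
proof (induction k arbitrary: f)
  case 0
  then show ?case by (auto intro: continuous_on_inverse)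
next
  case (Suc k)
  have "partial_deriv i (\<lambda>x. inverse (f x)) =
      (\<lambda>x. (-1) * (inverse (f x) * partial_deriv i f x * inverse (f x)))" for i
    using Suc.prems by (intro ext) (auto simp: partial_deriv_inverse)
  moreover have "C_k k (\<lambda>x. (-1) * (inverse (f x) * partial_deriv i f x * inverse (f x)))" for i
    using Suc.prems C_k_SucD[OF Suc.prems(1)] by (intro C_k_mult Suc.IH C_k_const) auto
  ultimately show ?case using Suc.prems by auto
qed

lemma has_derivative_affine_comp:
  assumes "f differentiable (at (c + s *\<^sub>R x))"
  shows "((\<lambda>x. f (c + s *\<^sub>R x)) has_derivative (\<lambda>h. frechet_derivative f (at (c + s *\<^sub>R x)) (s *\<^sub>R h))) (at x)"
proof -
  have 1: "((\<lambda>x. c + s *\<^sub>R x) has_derivative (\<lambda>h. s *\<^sub>R h)) (at x)"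
    by (auto intro!: derivative_eq_intros)
  have 2: "(f has_derivative frechet_derivative f (at (c + s *\<^sub>R x))) (at (c + s *\<^sub>R x))"
    using assms by (simp add: frechet_derivative_works)
  show ?thesis using has_derivative_compose[OF 1 2] .
qed

lemma partial_deriv_affine:
  assumes "f differentiable (at (c + s *\<^sub>R x))"
  shows "partial_deriv i (\<lambda>x. f (c + s *\<^sub>R x)) x = s * partial_deriv i f (c + s *\<^sub>R x)"
  using partial_derivI[OF has_derivative_affine_comp[OF assms]] linear_frechet_derivative[OF assms]
  by (simp add: partial_deriv_def linear_cmul)

lemma C_k_affine: "C_k k f \<Longrightarrow> C_k k (\<lambda>x. f (c + s *\<^sub>R x))"
proof (induction k arbitrary: f)
  case 0
  then show ?case
    by (auto intro!: continuous_intros continuous_on_compose2[where f = "\<lambda>x. c + s *\<^sub>R x" and g = f])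
next
  case (Suc k)
  have "partial_deriv i (\<lambda>x. f (c + s *\<^sub>R x)) = (\<lambda>x. s * partial_deriv i f (c + s *\<^sub>R x))" for i
    using Suc.prems by (intro ext partial_deriv_affine) auto
  moreover have "(\<lambda>x. f (c + s *\<^sub>R x)) differentiable (at x)" for x
    using has_derivative_affine_comp[of f c s x] Suc.prems unfolding differentiable_def C_k.simps by blast
  ultimately show ?case using Suc by (auto intro!: C_k_mult)
qed

lemma partial_deriv_nth: "partial_deriv i (\<lambda>x. x $ j) x = axis i 1 $ j"
  by (rule partial_derivI) (auto intro!: bounded_linear.has_derivative[OF bounded_linear_vec_nth] derivative_eq_intros)

lemma C_k_nth: "C_k k (\<lambda>x. x $ j)"
proof (cases k)
  case 0
  then show ?thesis by (simp add: continuous_on_component)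
next
  case (Suc k)
  have "(\<lambda>x::real^'a. x $ j) differentiable (at x)" for x
    unfolding differentiable_def
    by (auto intro!: bounded_linear.has_derivative[OF bounded_linear_vec_nth] has_derivative_ident)
  moreover have "partial_deriv i (\<lambda>x. x $ j) = (\<lambda>x. axis i 1 $ j)" for i :: 'a
    by (rule ext) (rule partial_deriv_nth)
  ultimately show ?thesis by (simp add: Suc)
qed

lemma smooth_const [simp, intro]: "smooth (\<lambda>x. c)"
  by (simp add: smooth_def)

lemma smooth_nth [simp, intro]: "smooth (\<lambda>x. x $ j)"
  by (simp add: smooth_def C_k_nth)

lemma smooth_add [intro]: "smooth f \<Longrightarrow> smooth g \<Longrightarrow> smooth (\<lambda>x. f x + g x)"
  by (simp add: smooth_def C_k_add)

lemma smooth_mult [intro]: "smooth f \<Longrightarrow> smooth g \<Longrightarrow> smooth (\<lambda>x. f x * g x)"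
  by (simp add: smooth_def C_k_mult)

lemma smooth_inverse [intro]: "smooth f \<Longrightarrow> (\<And>x. f x \<noteq> 0) \<Longrightarrow> smooth (\<lambda>x. inverse (f x))"
  by (simp add: smooth_def C_k_inverse)

lemma smooth_sum: "(\<And>i. i \<in> I \<Longrightarrow> smooth (f i)) \<Longrightarrow> smooth (\<lambda>x. \<Sum>i\<in>I. f i x)"
  by (induction I rule: infinite_finite_induct) auto

lemma smooth_affine [intro]: "smooth f \<Longrightarrow> smooth (\<lambda>x. f (c + s *\<^sub>R x))"
  by (simp add: smooth_def C_k_affine)

lemma smooth_partial_deriv [intro]: "smooth f \<Longrightarrow> smooth (partial_deriv i f)"
  by (metis C_k.simps(2) smooth_def)

lemma smooth_differentiable: "smooth f \<Longrightarrow> f differentiable (at x)"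
  by (metis C_k.simps(2) smooth_def)

lemma smooth_continuous: "smooth f \<Longrightarrow> continuous_on UNIV f"
  by (metis C_k.simps(1) smooth_def)

lemma smooth_borel [measurable_dest]: "smooth f \<Longrightarrow> f \<in> borel_measurable borel"
  by (simp add: borel_measurable_continuous_onI smooth_continuous)

lemma smooth_has_derivative:
  assumes "smooth f"
  shows "(f has_derivative (\<lambda>h. grad f x \<bullet> h)) (at x)"
proof -
  let ?D = "frechet_derivative f (at x)"
  have lin: "linear ?D" by (rule linear_frechet_derivative[OF smooth_differentiable[OF assms]])
  have "?D h = grad f x \<bullet> h" for h
  proof -
    have "?D h = ?D (\<Sum>i\<in>UNIV. (h $ i) *\<^sub>R axis i 1)"
      using basis_expansion[of h] by (simp add: scalar_mult_eq_scaleR)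
    also have "\<dots> = (\<Sum>i\<in>UNIV. h $ i * ?D (axis i 1))"
      using lin by (simp add: linear_sum linear_cmul)
    also have "\<dots> = grad f x \<bullet> h"
      by (simp add: inner_vec_def partial_deriv_def mult.commute)
    finally show ?thesis .
  qed
  then have "?D = (\<lambda>h. grad f x \<bullet> h)" by auto
  then show ?thesis
    using smooth_differentiable[OF assms, of x] by (simp add: frechet_derivative_works)
qed

lemma continuous_on_grad: "smooth f \<Longrightarrow> continuous_on UNIV (grad f)"
  unfolding grad_def
  by (intro continuous_on_vec_lambda smooth_continuous smooth_partial_deriv)

lemma grad_mult: "smooth f \<Longrightarrow> smooth g \<Longrightarrow> grad (\<lambda>x. f x * g x) x = f x *\<^sub>R grad g x + g x *\<^sub>R grad f x"
  by (simp add: vec_eq_iff partial_deriv_mult smooth_differentiable)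

lemma grad_inverse:
  "smooth f \<Longrightarrow> f x \<noteq> 0 \<Longrightarrow> grad (\<lambda>x. inverse (f x)) x = - (inverse (f x))\<^sup>2 *\<^sub>R grad f x"
  by (simp add: vec_eq_iff partial_deriv_inverse smooth_differentiable power2_eq_square)

lemma grad_add: "smooth f \<Longrightarrow> smooth g \<Longrightarrow> grad (\<lambda>x. f x + g x) x = grad f x + grad g x"
  by (simp add: vec_eq_iff partial_deriv_add smooth_differentiable)

lemma grad_const [simp]: "grad (\<lambda>x. c) x = 0"
  by (simp add: vec_eq_iff) (subst partial_derivI[OF has_derivative_const], simp)

lemma grad_cmul: "smooth f \<Longrightarrow> grad (\<lambda>x. c * f x) x = c *\<^sub>R grad f x"
  by (subst grad_mult) auto

lemma grad_affine: "smooth f \<Longrightarrow> grad (\<lambda>x. f (c + s *\<^sub>R x)) x = s *\<^sub>R grad f (c + s *\<^sub>R x)"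
  by (simp add: vec_eq_iff partial_deriv_affine smooth_differentiable)

section \<open>Test functions: closure properties, supports and bounds\<close>

lemma Cc_infinity_iff: "f \<in> Cc_infinity \<longleftrightarrow> smooth f \<and> bounded {x. f x \<noteq> 0}"
  unfolding Cc_infinity_def smooth_def
  by (auto simp: compact_eq_bounded_closed bounded_closure intro: bounded_subset[OF _ closure_subset])

lemma Cc_smooth [dest]: "f \<in> Cc_infinity \<Longrightarrow> smooth f"
  by (simp add: Cc_infinity_iff)

lemma Cc_add [intro]: "f \<in> Cc_infinity \<Longrightarrow> g \<in> Cc_infinity \<Longrightarrow> (\<lambda>x. f x + g x) \<in> Cc_infinity"
  by (auto simp: Cc_infinity_iff intro: bounded_subset[of "{x. f x \<noteq> 0} \<union> {x. g x \<noteq> 0}"])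

lemma Cc_mult_smooth [intro]: "smooth f \<Longrightarrow> g \<in> Cc_infinity \<Longrightarrow> (\<lambda>x. f x * g x) \<in> Cc_infinity"
  by (auto simp: Cc_infinity_iff intro: bounded_subset[of "{x. g x \<noteq> 0}"])

lemma Cc_cmul: "g \<in> Cc_infinity \<Longrightarrow> (\<lambda>x. c * g x) \<in> Cc_infinity"
  by (rule Cc_mult_smooth) auto

lemma Cc_diff: "f \<in> Cc_infinity \<Longrightarrow> g \<in> Cc_infinity \<Longrightarrow> (\<lambda>x. f x - g x) \<in> Cc_infinity"
  using Cc_add[of f "\<lambda>x. (-1) * g x"] Cc_cmul[of g "-1"] by simp

text \<open>Off the closed support \<open>f\<close> vanishes on a whole neighbourhood;
  \<open>f x = 0\<close> by itself would say nothing about the derivative at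
  \<open>x\<close>.\<close>

lemma partial_deriv_eq_0:
  assumes "x \<notin> closure {x. f x \<noteq> 0}"
  shows "partial_deriv i f x = 0"
proof -
  have "eventually (\<lambda>y. y \<in> - closure {x. f x \<noteq> 0}) (nhds x)"
    using assms by (intro eventually_nhds_in_open) auto
  then have "eventually (\<lambda>y. 0 = f y) (nhds x)"
    by eventually_elim (use closure_subset[of "{x. f x \<noteq> 0}"] in auto)
  then have "(f has_derivative (\<lambda>h. 0)) (at x)"
    using has_derivative_const[of 0 "at x"] has_derivative_transform_eventually[of "\<lambda>x. 0" "\<lambda>h. 0" x UNIV f]
    by (metis (mono_tags, lifting) UNIV_I eventually_nhds_conv_at)
  from partial_derivI[OF this] show ?thesis by simp
qed

lemma Cc_partial_deriv [intro]: "f \<in> Cc_infinity \<Longrightarrow> partial_deriv i f \<in> Cc_infinity"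
  using partial_deriv_eq_0[of _ f i]
  by (auto simp: Cc_infinity_iff intro!: bounded_subset[OF bounded_closure, of "{x. f x \<noteq> 0}"])

lemma Cc_affine:
  assumes "f \<in> Cc_infinity" "s \<noteq> 0"
  shows "(\<lambda>x. f (c + s *\<^sub>R x)) \<in> Cc_infinity"
proof -
  have "{x. f (c + s *\<^sub>R x) \<noteq> 0} \<subseteq> (\<lambda>y. (1 / s) *\<^sub>R y) ` ((\<lambda>y. - c + y) ` {x. f x \<noteq> 0})"
    using assms(2) by (auto simp: image_iff intro!: exI[of _ "c + s *\<^sub>R _"])
  moreover have "bounded ((\<lambda>y. (1 / s) *\<^sub>R y) ` ((\<lambda>y. - c + y) ` {x. f x \<noteq> 0}))"
    using assms by (intro bounded_scaling bounded_translation) (simp add: Cc_infinity_iff)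
  ultimately show ?thesis
    using assms by (auto simp: Cc_infinity_iff dest: bounded_subset)
qed

lemma Cc_support: 
  assumes "f \<in> Cc_infinity"
  obtains r where "r > 0" "\<And>x. norm x \<ge> r \<Longrightarrow> f x = 0"
proof -
  from assms obtain r where "r > 0" "\<forall>x\<in>{x. f x \<noteq> 0}. norm x \<le> r"
    by (auto simp: Cc_infinity_iff bounded_pos)
  \<comment> \<open>The \<open>+ 1\<close> turns the closed bound \<open>norm x \<le> r\<close> on
    the support into vanishing for all \<open>norm x\<close> at least the new radius.\<close>
  then show ?thesis by (intro that[of "r + 1"]) force+
qed

lemma continuous_bounded_support:
  fixes f :: "'a::euclidean_space \<Rightarrow> 'b::euclidean_space"
  assumes "continuous_on UNIV f" "\<And>x. norm x \<ge> r \<Longrightarrow> f x = 0"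
  shows "\<exists>M>0. \<forall>x. norm (f x) \<le> M"
    and "integrable lborel f"
    and "uniformly_continuous_on UNIV f"
proof -
  have "compact (f ` cball 0 r)"
    by (intro compact_continuous_image continuous_on_subset[OF assms(1)]) auto
  from compact_imp_bounded[OF this] obtain M where M: "M > 0" "\<forall>x\<in>cball 0 r. norm (f x) \<le> M"
    by (auto simp: bounded_pos)
  have "norm (f x) \<le> M" for x
    using M assms(2)[of x] by (cases "norm x \<le> r") auto
  with M show "\<exists>M>0. \<forall>x. norm (f x) \<le> M" by auto
  have "set_integrable lborel (cball 0 r) f"
    unfolding set_integrable_def
    by (rule borel_integrable_compact) (auto intro: continuous_on_subset[OF assms(1)])
  moreover have "(\<lambda>x. indicator (cball 0 r) x *\<^sub>R f x) = f"
    using assms(2) by (auto simp: indicator_def)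
  ultimately show "integrable lborel f" by (simp add: set_integrable_def)
  \<comment> \<open>The margin 1 works together with \<open>min d 1\<close> below: of two points at
    distance less than 1, either both lie in the enlarged ball or both lie beyond radius
    \<open>r\<close>, where \<open>f\<close> vanishes.\<close>
  have uc: "uniformly_continuous_on (cball 0 (r + 1)) f"
    by (intro compact_uniformly_continuous continuous_on_subset[OF assms(1)]) auto
  show "uniformly_continuous_on UNIV f"
    unfolding uniformly_continuous_on_def
  proof (intro allI impI)
    fix e :: real assume "e > 0"
    then obtain d where d: "d > 0" "\<And>x y. x \<in> cball 0 (r+1) \<Longrightarrow> y \<in> cball 0 (r+1) \<Longrightarrow> dist y x < d \<Longrightarrow> dist (f y) (f x) < e"
      using uc unfolding uniformly_continuous_on_def by metis
    have "dist (f y) (f x) < e" if "dist y x < min d 1" for x y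
    proof (cases "norm x \<le> r + 1 \<and> norm y \<le> r + 1")
      case True
      then show ?thesis using d that by auto
    next
      case False
      have "norm x \<le> norm y + dist y x" "norm y \<le> norm x + dist y x"
        by (metis dist_norm norm_minus_commute norm_triangle_sub)+
      with False that have "norm x \<ge> r" "norm y \<ge> r" by auto
      then show ?thesis using assms(2) \<open>e > 0\<close> by simp
    qed
    then show "\<exists>d>0. \<forall>x\<in>UNIV. \<forall>x'\<in>UNIV. dist x' x < d \<longrightarrow> dist (f x') (f x) < e"
      using d(1) by (intro exI[of _ "min d 1"]) auto
  qed
qed

lemma Cc_bounded: 
  assumes "f \<in> Cc_infinity" shows "\<exists>M>0. \<forall>x. \<bar>f x\<bar> \<le> M"
  using Cc_support[OF assms] continuous_bounded_support(1)[of f] smooth_continuous[OF Cc_smooth[OF assms]]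
  by (metis real_norm_def)

lemma Cc_integrable: 
  assumes "f \<in> Cc_infinity" shows "integrable lborel f"
  using Cc_support[OF assms] continuous_bounded_support(2)[of f] smooth_continuous[OF Cc_smooth[OF assms]]
  by metis

text \<open>The inequality for \<open>x\<close> is strict because only off the closed ball is
  \<open>f\<close> known to vanish on a neighbourhood of \<open>x\<close>.\<close>

lemma grad_support:
  assumes "\<And>x. norm x \<ge> r \<Longrightarrow> f x = 0" "norm x > r"
  shows "grad f x = 0"
proof -
  have "closure {x. f x \<noteq> 0} \<subseteq> cball 0 r"
    by (rule closure_minimal) (use assms(1) linear in \<open>auto simp: subset_iff\<close>)
  then have "x \<notin> closure {x. f x \<noteq> 0}" using assms(2) by auto
  then show ?thesis by (simp add: vec_eq_iff partial_deriv_eq_0)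
qed

lemma Cc_grad_bounded:
  assumes "f \<in> Cc_infinity" shows "\<exists>M>0. \<forall>x. norm (grad f x) \<le> M"
proof -
  obtain r where "r > 0" "\<And>x. norm x \<ge> r \<Longrightarrow> f x = 0" using Cc_support[OF assms] by blast
  then have "\<And>x. norm x \<ge> r + 1 \<Longrightarrow> grad f x = 0" using grad_support[of r f] by force
  from continuous_bounded_support(1)[OF continuous_on_grad this] show ?thesis
    using assms by auto
qed

lemma smooth_diff_bound:
  assumes "smooth f" "\<And>x. norm (grad f x) \<le> M"
  shows "\<bar>f y - f x\<bar> \<le> M * norm (y - x)"
proof -
  have "norm (f y - f x) \<le> M * norm (y - x)"
  proof (rule differentiable_bound[of UNIV f "\<lambda>x h. grad f x \<bullet> h"])
    show "onorm (\<lambda>h. grad f x \<bullet> h) \<le> M" for x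
    proof (rule onorm_bound)
      show "norm (grad f x \<bullet> h) \<le> M * norm h" for h
        using Cauchy_Schwarz_ineq2[of "grad f x" h] assms(2)[of x]
        by (metis mult_right_mono norm_ge_zero order_trans real_norm_def)
      show "0 \<le> M" using assms(2) norm_ge_zero order_trans by blast
    qed
  qed (use smooth_has_derivative[OF assms(1)] in auto)
  then show ?thesis by simp
qed

subsection \<open>Square-integrable functions\<close>

definition ip :: "(real^'n::finite \<Rightarrow> 'b::euclidean_space) \<Rightarrow> (real^'n \<Rightarrow> 'b) \<Rightarrow> real" where
  "ip f g = (LINT x|lborel. f x \<bullet> g x)"

text \<open>The squared norm, which keeps all estimates polynomial. The integral of a nonintegrable
  function is 0 by convention, so the value is meaningful on \<open>Lp 2\<close> only; this is why
  \<open>L2lim\<close> includes membership and most estimates assume it.\<close>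

definition nsq :: "(real^'n::finite \<Rightarrow> 'b::euclidean_space) \<Rightarrow> real" where
  "nsq f = (LINT x|lborel. (norm (f x))\<^sup>2)"

definition L2lim :: "(nat \<Rightarrow> real^'n::finite \<Rightarrow> 'b::euclidean_space) \<Rightarrow> (real^'n \<Rightarrow> 'b) \<Rightarrow> bool" where
  "L2lim F f \<longleftrightarrow> (\<forall>n. F n \<in> Lp 2) \<and> f \<in> Lp 2 \<and> (\<lambda>n. nsq (\<lambda>x. F n x - f x)) \<longlonglongrightarrow> 0"

lemma nsq_nonneg [simp]: "0 \<le> nsq f"
  by (simp add: nsq_def)

lemma nsq_ip: "nsq f = ip f f"
  by (simp add: nsq_def ip_def power2_norm_eq_inner)

lemma Lp2_measurable: "f \<in> Lp 2 \<Longrightarrow> f \<in> borel_measurable borel"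
  by (simp add: Lp_def)

lemma Lp2_integrable: "f \<in> Lp 2 \<Longrightarrow> integrable lborel (\<lambda>x. (norm (f x))\<^sup>2)"
  by (simp add: Lp_def)

lemma Lp2_inner_integrable:
  assumes "f \<in> Lp 2" "g \<in> Lp 2"
  shows "integrable lborel (\<lambda>x. f x \<bullet> g x)"
proof (rule Bochner_Integration.integrable_bound)
  show "integrable lborel (\<lambda>x. (norm (f x))\<^sup>2 + (norm (g x))\<^sup>2)"
    using assms by (intro Bochner_Integration.integrable_add Lp2_integrable)
  show "(\<lambda>x. f x \<bullet> g x) \<in> borel_measurable lborel"
    using assms[THEN Lp2_measurable] by simp
  have "\<bar>f x \<bullet> g x\<bar> \<le> (norm (f x))\<^sup>2 + (norm (g x))\<^sup>2" for x
  proof -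
    have "\<bar>f x \<bullet> g x\<bar> \<le> norm (f x) * norm (g x)" by (rule Cauchy_Schwarz_ineq2)
    also have "\<dots> \<le> (norm (f x))\<^sup>2 + (norm (g x))\<^sup>2"
      using sum_squares_bound[of "norm (f x)" "norm (g x)"] mult_nonneg_nonneg[OF norm_ge_zero norm_ge_zero, of "f x" "g x"]
      by linarith
    finally show ?thesis .
  qed
  then show "AE x in lborel. norm (f x \<bullet> g x) \<le> norm ((norm (f x))\<^sup>2 + (norm (g x))\<^sup>2)"
    by (auto intro!: AE_I2)
qed

lemma Lp2_scaleR: "f \<in> Lp 2 \<Longrightarrow> (\<lambda>x. c *\<^sub>R f x) \<in> Lp 2"
  by (auto simp: Lp_def power_mult_distrib)

lemma Lp2_cmul: "f \<in> Lp 2 \<Longrightarrow> (\<lambda>x. c * f x) \<in> Lp 2" for f :: "real^'n::finite \<Rightarrow> real"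
  using Lp2_scaleR[of f c] by simp

lemma norm_add_sq_le: "(norm (a + b))\<^sup>2 \<le> 2 * (norm a)\<^sup>2 + 2 * (norm b)\<^sup>2" for a b :: "'a::real_inner"
proof -
  have "0 \<le> (norm (a - b))\<^sup>2" by simp
  then show ?thesis by (simp add: power2_norm_eq_inner inner_add inner_diff inner_commute)
qed

lemma Lp2_add:
  assumes "f \<in> Lp 2" "g \<in> Lp 2"
  shows "(\<lambda>x. f x + g x) \<in> Lp 2"
proof -
  have "integrable lborel (\<lambda>x. (norm (f x + g x))\<^sup>2)"
  proof (rule Bochner_Integration.integrable_bound)
    show "integrable lborel (\<lambda>x. 2 * (norm (f x))\<^sup>2 + 2 * (norm (g x))\<^sup>2)"
      using assms by (intro Bochner_Integration.integrable_add integrable_mult_right Lp2_integrable)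
    show "AE x in lborel. norm ((norm (f x + g x))\<^sup>2) \<le> norm (2 * (norm (f x))\<^sup>2 + 2 * (norm (g x))\<^sup>2)"
      using norm_add_sq_le by (intro AE_I2) auto
  qed (use assms[THEN Lp2_measurable] in simp)
  then show ?thesis using assms[THEN Lp2_measurable] by (simp add: Lp_def)
qed

lemma Lp2_diff: "f \<in> Lp 2 \<Longrightarrow> g \<in> Lp 2 \<Longrightarrow> (\<lambda>x. f x - g x) \<in> Lp 2"
  using Lp2_add[of f "\<lambda>x. (-1) *\<^sub>R g x"] Lp2_scaleR[of g "-1"] by simp

lemma nsq_add_le:
  assumes "f \<in> Lp 2" "g \<in> Lp 2"
  shows "nsq (\<lambda>x. f x + g x) \<le> 2 * nsq f + 2 * nsq g"
proof -
  have "nsq (\<lambda>x. f x + g x) \<le> (LINT x|lborel. 2 * (norm (f x))\<^sup>2 + 2 * (norm (g x))\<^sup>2)"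
    unfolding nsq_def using assms norm_add_sq_le
    by (intro integral_mono Lp2_integrable Lp2_add Bochner_Integration.integrable_add integrable_mult_right)
  also have "\<dots> = 2 * nsq f + 2 * nsq g"
    using assms by (simp add: nsq_def Lp2_integrable)
  finally show ?thesis .
qed

lemma nsq_minus_commute: "nsq (\<lambda>x. f x - g x) = nsq (\<lambda>x. g x - f x)"
  by (simp add: nsq_def norm_minus_commute)

lemma nsq_diff_le:
  assumes "f \<in> Lp 2" "g \<in> Lp 2" "h \<in> Lp 2"
  shows "nsq (\<lambda>x. f x - g x) \<le> 2 * nsq (\<lambda>x. f x - h x) + 2 * nsq (\<lambda>x. h x - g x)"
  using nsq_add_le[OF Lp2_diff[OF assms(1,3)] Lp2_diff[OF assms(3,2)]] by simp

lemma quadratic_nonneg_discrim: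
  fixes A B C :: real
  assumes "\<And>t. 0 \<le> A + 2 * t * B + t\<^sup>2 * C"
  shows "B\<^sup>2 \<le> A * C"
proof (cases "C = 0")
  case True
  have "B = 0"
  proof (rule ccontr)
    assume "B \<noteq> 0"
    \<comment> \<open>For \<open>C = 0\<close> the polynomial is affine in \<open>t\<close>, and at
      this \<open>t\<close> it equals -1.\<close>
    then have "2 * ((- A - 1) / (2 * B)) * B = - A - 1" by simp
    then show False using assms[of "(- A - 1) / (2 * B)"] True by simp
  qed
  then show ?thesis using True by simp
next
  case False
  have "C > 0"
  proof (rule ccontr)
    assume "\<not> 0 < C"
    with False have C: "C < 0" by simp
    \<comment> \<open>Large enough that \<open>t^2 C\<close> outweighs \<open>A + 2 t B\<close>. The
      \<open>+ 1\<close> gives \<open>t \<ge> 1\<close>, so that \<open>\<bar>A\<bar>\<close> is at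
      most \<open>t \<bar>A\<bar>\<close>.\<close>
    define t where "t = (\<bar>A\<bar> + 2 * \<bar>B\<bar>) / - C + 1"
    have t: "t \<ge> 1" using C by (simp add: t_def divide_nonneg_neg)
    have "t * (- C) = \<bar>A\<bar> + 2 * \<bar>B\<bar> - C" using C by (simp add: t_def field_simps)
    then have "t * (t * (- C)) = t * (\<bar>A\<bar> + 2 * \<bar>B\<bar> - C)" by simp
    then have eq: "t\<^sup>2 * C = - t * \<bar>A\<bar> - 2 * t * \<bar>B\<bar> + t * C" by (simp add: power2_eq_square algebra_simps)
    have "\<bar>A\<bar> \<le> t * \<bar>A\<bar>" using t mult_right_mono[of 1 t "\<bar>A\<bar>"] by simp
    moreover have "t * B \<le> t * \<bar>B\<bar>" using t by (intro mult_left_mono) auto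
    moreover have "t * C < 0" using t C by (simp add: mult_pos_neg)
    ultimately show False using assms[of t] eq by auto
  qed
  have "0 \<le> A + 2 * (- B / C) * B + (- B / C)\<^sup>2 * C" by (rule assms)
  also have "\<dots> = A - B\<^sup>2 / C" using False by (simp add: field_simps power2_eq_square)
  finally show ?thesis using \<open>C > 0\<close> by (simp add: field_simps)
qed

lemma nsq_add_scaleR:
  assumes "f \<in> Lp 2" "g \<in> Lp 2"
  shows "nsq (\<lambda>x. f x + t *\<^sub>R g x) = nsq f + 2 * t * ip f g + t\<^sup>2 * nsq g"
proof -
  have "nsq (\<lambda>x. f x + t *\<^sub>R g x) =
      (LINT x|lborel. (norm (f x))\<^sup>2 + 2 * t * (f x \<bullet> g x) + t\<^sup>2 * (norm (g x))\<^sup>2)"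
    unfolding nsq_def
    by (intro Bochner_Integration.integral_cong refl)
      (simp only: power2_norm_eq_inner, simp add: inner_add inner_commute algebra_simps power2_eq_square)
  also have "\<dots> = nsq f + 2 * t * ip f g + t\<^sup>2 * nsq g"
    using assms by (simp add: nsq_def ip_def Lp2_integrable Lp2_inner_integrable)
  finally show ?thesis .
qed

lemma ip_Cauchy_Schwarz:
  assumes "f \<in> Lp 2" "g \<in> Lp 2"
  shows "(ip f g)\<^sup>2 \<le> nsq f * nsq g"
  by (rule quadratic_nonneg_discrim) (metis nsq_add_scaleR[OF assms] nsq_nonneg)

lemma ip_diff_left: "f \<in> Lp 2 \<Longrightarrow> g \<in> Lp 2 \<Longrightarrow> h \<in> Lp 2 \<Longrightarrow> ip (\<lambda>x. f x - g x) h = ip f h - ip g h"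
  by (simp add: ip_def inner_diff_left Lp2_inner_integrable)

lemma ip_commute: "ip f g = ip g f"
  by (simp add: ip_def inner_commute)

lemma L2lim_Lp: "L2lim F f \<Longrightarrow> F n \<in> Lp 2" "L2lim F f \<Longrightarrow> f \<in> Lp 2"
  by (auto simp: L2lim_def)

lemma L2lim_ip:
  assumes "L2lim F f" "g \<in> Lp 2"
  shows "(\<lambda>n. ip (F n) g) \<longlonglongrightarrow> ip f g"
proof -
  note Lp = L2lim_Lp[OF assms(1)]
  have le: "(ip (F n) g - ip f g)\<^sup>2 \<le> nsq (\<lambda>x. F n x - f x) * nsq g" for n
    using ip_Cauchy_Schwarz[OF Lp2_diff[OF Lp(1) Lp(2)] assms(2), of n] ip_diff_left[OF Lp(1) Lp(2) assms(2), of n]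
    by simp
  have "(\<lambda>n. nsq (\<lambda>x. F n x - f x) * nsq g) \<longlonglongrightarrow> 0 * nsq g"
    using assms(1) by (intro tendsto_mult tendsto_const) (simp add: L2lim_def)
  then have "(\<lambda>n. nsq (\<lambda>x. F n x - f x) * nsq g) \<longlonglongrightarrow> 0" by simp
  then have "(\<lambda>n. (ip (F n) g - ip f g)\<^sup>2) \<longlonglongrightarrow> 0"
    by (rule tendsto_sandwich[rotated 3]) (use le in auto)
  then have "(\<lambda>n. sqrt ((ip (F n) g - ip f g)\<^sup>2)) \<longlonglongrightarrow> sqrt 0" by (intro tendsto_intros)
  then have "(\<lambda>n. ip (F n) g - ip f g) \<longlonglongrightarrow> 0" by (simp add: tendsto_rabs_zero_iff)
  then show ?thesis by (simp add: LIM_zero_iff)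
qed

lemma L2lim_nsq:
  assumes "L2lim F f"
  shows "(\<lambda>n. nsq (F n)) \<longlonglongrightarrow> nsq f"
proof -
  note Lp = L2lim_Lp[OF assms]
  \<comment> \<open>Expanding the square of \<open>F n - f\<close> reduces convergence of the norms
    to that of the inner products with \<open>f\<close>.\<close>
  have "nsq (F n) = nsq (\<lambda>x. F n x - f x) + 2 * ip (F n) f - nsq f" for n
    using nsq_add_scaleR[OF Lp(1) Lp(2), of n "-1"] by (simp add: nsq_ip ip_commute)
  moreover have "(\<lambda>n. nsq (\<lambda>x. F n x - f x) + 2 * ip (F n) f - nsq f) \<longlonglongrightarrow> 0 + 2 * nsq f - nsq f"
    using assms L2lim_ip[OF assms Lp(2)] unfolding nsq_ip[of f]
    by (intro tendsto_intros) (auto simp: L2lim_def)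
  ultimately show ?thesis by simp
qed

section \<open>Fatou's lemma and completeness of L2\<close>

lemma Lp2_nn_integral_le:
  assumes "f \<in> borel_measurable borel" "(\<integral>\<^sup>+x. ennreal ((norm (f x))\<^sup>2) \<partial>lborel) \<le> ennreal C" "0 \<le> C"
  shows "f \<in> Lp 2" "nsq f \<le> C"
proof -
  have int: "integrable lborel (\<lambda>x. (norm (f x))\<^sup>2)"
    using assms by (intro integrableI_nonneg) (auto simp: top.not_eq_extremum intro: le_less_trans)
  then show "f \<in> Lp 2" using assms by (simp add: Lp_def)
  have "ennreal (nsq f) \<le> ennreal C"
    using assms(2) nn_integral_eq_integral[OF int] by (simp add: nsq_def)
  then show "nsq f \<le> C" using assms(3) by simp
qed

lemma nn_integral_nsq: "f \<in> Lp 2 \<Longrightarrow> (\<integral>\<^sup>+x. ennreal ((norm (f x))\<^sup>2) \<partial>lborel) = ennreal (nsq f)"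
  using nn_integral_eq_integral[OF Lp2_integrable, of f] by (simp add: nsq_def)

text \<open>Uniformly bounded norms take the place of a dominating function: Fatou's lemma passes
  the bound to the pointwise limit, and finiteness of the nonnegative integral then yields
  membership.\<close>

lemma Lp2_Fatou:
  assumes F: "\<And>n. F n \<in> Lp 2" and "\<And>n. nsq (F n) \<le> C" and f: "f \<in> borel_measurable borel"
    and lim: "AE x in lborel. (\<lambda>n. F n x) \<longlonglongrightarrow> f x"
  shows "f \<in> Lp 2" "nsq f \<le> C"
proof -
  have C: "0 \<le> C" using assms(2)[of 0] nsq_nonneg[of "F 0"] by linarith
  have m: "F n \<in> borel_measurable borel" for n using F by (rule Lp2_measurable)
  have "(\<integral>\<^sup>+x. ennreal ((norm (f x))\<^sup>2) \<partial>lborel) = (\<integral>\<^sup>+x. liminf (\<lambda>n. ennreal ((norm (F n x))\<^sup>2)) \<partial>lborel)"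
  proof (rule nn_integral_cong_AE)
    show "AE x in lborel. ennreal ((norm (f x))\<^sup>2) = liminf (\<lambda>n. ennreal ((norm (F n x))\<^sup>2))"
      using lim
    proof eventually_elim
      case (elim x)
      have "(\<lambda>n. ennreal ((norm (F n x))\<^sup>2)) \<longlonglongrightarrow> ennreal ((norm (f x))\<^sup>2)"
        using elim by (intro tendsto_ennrealI tendsto_intros)
      from lim_imp_Liminf[OF sequentially_bot this] show ?case by (rule sym)
    qed
  qed
  also have "\<dots> \<le> liminf (\<lambda>n. \<integral>\<^sup>+x. ennreal ((norm (F n x))\<^sup>2) \<partial>lborel)"
    using m by (intro nn_integral_liminf) simp
  also have "\<dots> \<le> ennreal C"
  proof -
    have "(\<integral>\<^sup>+x. ennreal ((norm (F n x))\<^sup>2) \<partial>lborel) \<le> ennreal C" for n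
      using assms(2)[of n] by (simp add: nn_integral_nsq[OF F] C ennreal_leI)
    then have "liminf (\<lambda>n. \<integral>\<^sup>+x. ennreal ((norm (F n x))\<^sup>2) \<partial>lborel) \<le> liminf (\<lambda>n::nat. ennreal C)"
      by (intro Liminf_mono always_eventually) auto
    then show ?thesis by (simp add: Liminf_const)
  qed
  finally have "(\<integral>\<^sup>+x. ennreal ((norm (f x))\<^sup>2) \<partial>lborel) \<le> ennreal C" .
  from Lp2_nn_integral_le[OF f this C] show "f \<in> Lp 2" "nsq f \<le> C" .
qed

lemma L2lim_AE_subseq:
  assumes "L2lim F f"
  obtains r where "strict_mono (r::nat\<Rightarrow>nat)" "AE x in lborel. (\<lambda>n. F (r n) x) \<longlonglongrightarrow> f x"
proof -
  note Lp = L2lim_Lp[OF assms]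
  have "(\<lambda>n. LINT x|lborel. norm ((norm (F n x - f x))\<^sup>2)) \<longlonglongrightarrow> 0"
    using assms by (simp add: L2lim_def nsq_def)
  from tendsto_L1_AE_subseq[OF Lp2_integrable[OF Lp2_diff[OF Lp(1) Lp(2)]] this]
  obtain r where r: "strict_mono r" "AE x in lborel. (\<lambda>n. (norm (F (r n) x - f x))\<^sup>2) \<longlonglongrightarrow> 0" by blast
  from r(2) have "AE x in lborel. (\<lambda>n. F (r n) x) \<longlonglongrightarrow> f x"
  proof eventually_elim
    case (elim x)
    then have "(\<lambda>n. sqrt ((norm (F (r n) x - f x))\<^sup>2)) \<longlonglongrightarrow> sqrt 0" by (rule tendsto_real_sqrt)
    then show ?case by (simp add: tendsto_norm_zero_iff LIM_zero_iff)
  qed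
  with r(1) show ?thesis by (rule that)
qed

lemma L2lim_subseq:
  assumes "L2lim F f" "strict_mono r"
  shows "L2lim (\<lambda>n. F (r n)) f"
  using assms LIMSEQ_subseq_LIMSEQ[of "\<lambda>n. nsq (\<lambda>x. F n x - f x)" 0 r] by (auto simp: L2lim_def o_def)

text \<open>The weight makes the increments \<open>O(2^(-k/2))\<close>, hence absolutely
  summable.\<close>

lemma convergent_if_weighted_summable:
  fixes X :: "nat \<Rightarrow> 'b::banach"
  assumes "\<And>k. 2 ^ k * (norm (X (Suc k) - X k))\<^sup>2 \<le> M"
  shows "convergent X"
proof -
  have "norm (X (Suc k) - X k) \<le> sqrt M * (1 / sqrt 2) ^ k" for k
  proof -
    have "(norm (X (Suc k) - X k))\<^sup>2 \<le> M * (1 / 2) ^ k"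
      using assms[of k] by (simp add: field_simps power_one_over)
    then have "sqrt ((norm (X (Suc k) - X k))\<^sup>2) \<le> sqrt (M * (1 / 2) ^ k)" by (rule real_sqrt_le_mono)
    then show ?thesis by (simp add: real_sqrt_mult real_sqrt_power real_sqrt_divide)
  qed
  then have "summable (\<lambda>k. X (Suc k) - X k)"
    by (rule summable_comparison_test'[where N = 0, rotated]) (intro summable_mult summable_geometric, simp)
  then have "convergent (\<lambda>n. X n - X 0)"
    by (simp add: summable_iff_convergent sum_lessThan_telescope)
  then have "convergent (\<lambda>n. (X n - X 0) + X 0)" by (intro convergent_add convergent_const)
  then show ?thesis by simp
qed

theorem L2_complete:
  fixes F :: "nat \<Rightarrow> real^'n::finite \<Rightarrow> 'b::euclidean_space"
  assumes F: "\<And>n. F n \<in> Lp 2"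
    and Cauchy: "\<And>e. e > 0 \<Longrightarrow> \<exists>N. \<forall>m\<ge>N. \<forall>n\<ge>N. nsq (\<lambda>x. F m x - F n x) < e"
  obtains f where "L2lim F f"
proof -
  \<comment> \<open>The rate \<open>(1/4)^k\<close> against the weight \<open>2^k\<close> leaves the
    summable \<open>(1/2)^k\<close>. The weighted squares then have a finite sum at almost every
    point, which forces pointwise convergence.\<close>
  have "\<exists>N. \<forall>k. \<forall>m\<ge>N k. \<forall>n\<ge>N k. nsq (\<lambda>x. F m x - F n x) < (1/4) ^ k"
    by (intro choice allI Cauchy) simp
  then obtain N where N: "\<And>k m n. m \<ge> N k \<Longrightarrow> n \<ge> N k \<Longrightarrow> nsq (\<lambda>x. F m x - F n x) < (1/4::real) ^ k" by blast
  \<comment> \<open>Summing all thresholds up to \<open>k\<close> makes the indices monotone and at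
    least \<open>N k\<close>; the summand \<open>k\<close> makes them strictly increasing.\<close>
  define r where "r k = (\<Sum>i\<le>k. N i) + k" for k
  have r: "strict_mono r" by (rule strict_monoI_Suc) (simp add: r_def)
  have rN: "r k \<ge> N k" for k unfolding r_def
    by (rule order_trans[OF member_le_sum[of k "{..k}" N]]) auto
  have rN': "r (Suc k) \<ge> N k" for k using rN[of k] strict_monoD[OF r, of k "Suc k"] by simp
  note m [measurable] = Lp2_measurable[OF F]
  define D where "D k x = 2 ^ k * (norm (F (r (Suc k)) x - F (r k) x))\<^sup>2" for k x
  have Dm [measurable]: "D k \<in> borel_measurable borel" for k unfolding D_def by measurable
  have "(\<integral>\<^sup>+x. (\<Sum>k. ennreal (D k x)) \<partial>lborel) = (\<Sum>k. \<integral>\<^sup>+x. ennreal (D k x) \<partial>lborel)"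
    by (rule nn_integral_suminf) simp
  also have "\<dots> \<le> (\<Sum>k. ennreal ((1/2) ^ k))"
  proof (rule suminf_le)
    show "(\<integral>\<^sup>+x. ennreal (D k x) \<partial>lborel) \<le> ennreal ((1/2) ^ k)" for k
    proof -
      have "(\<integral>\<^sup>+x. ennreal (D k x) \<partial>lborel) = ennreal (2 ^ k) * (\<integral>\<^sup>+x. ennreal ((norm (F (r (Suc k)) x - F (r k) x))\<^sup>2) \<partial>lborel)"
        unfolding D_def by (subst nn_integral_cmult[symmetric]) (auto simp: ennreal_mult)
      also have "\<dots> = ennreal (2 ^ k * nsq (\<lambda>x. F (r (Suc k)) x - F (r k) x))"
        by (subst nn_integral_nsq) (auto simp: ennreal_mult intro: Lp2_diff F)
      also have "\<dots> \<le> ennreal (2 ^ k * (1/4) ^ k)"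
        using N[OF rN' rN] by (intro ennreal_leI mult_left_mono) (auto simp: less_imp_le)
      also have "2 ^ k * (1/4::real) ^ k = (1/2) ^ k" by (simp flip: power_mult_distrib)
      finally show ?thesis .
    qed
  qed auto
  also have "\<dots> < top"
    by (subst suminf_ennreal2) (auto intro!: summable_geometric)
  finally have "AE x in lborel. (\<Sum>k. ennreal (D k x)) \<noteq> \<infinity>"
    by (intro nn_integral_noteq_infinite) (auto simp: less_top[symmetric])
  then have ae: "AE x in lborel. convergent (\<lambda>k. F (r k) x)"
  proof eventually_elim
    case (elim x)
    have "D k x \<le> enn2real (\<Sum>k. ennreal (D k x))" for k
    proof -
      have "ennreal (D k x) \<le> (\<Sum>k. ennreal (D k x))"
        using sum_le_suminf[OF summableI, of "{k}" "\<lambda>k. ennreal (D k x)"] by simp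
      then show ?thesis using elim
        using enn2real_mono[of "ennreal (D k x)" "\<Sum>k. ennreal (D k x)"] 
        by (simp add: D_def less_top[symmetric])
    qed
    then show ?case unfolding D_def by (rule convergent_if_weighted_summable)
  qed
  define f where "f x = lim (\<lambda>k. F (r k) x)" for x
  have fm [measurable]: "f \<in> borel_measurable borel" unfolding f_def by measurable
  from ae have lim: "AE x in lborel. (\<lambda>k. F (r k) x) \<longlonglongrightarrow> f x"
    by eventually_elim (simp add: f_def convergent_LIMSEQ_iff)
  \<comment> \<open>With \<open>m\<close> fixed, the Cauchy bound against the subsequence survives
    its a.e. limit by Fatou's lemma. Thus the whole sequence, not just the subsequence, converges to
    \<open>f\<close>.\<close>
  have key: "(\<lambda>x. F m x - f x) \<in> Lp 2 \<and> nsq (\<lambda>x. F m x - f x) \<le> e"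
    if M: "\<forall>m\<ge>M. \<forall>n\<ge>M. nsq (\<lambda>x. F m x - F n x) < e" and "m \<ge> M" for e M m
  proof -
    have "nsq (\<lambda>x. F m x - F (r (k + M)) x) \<le> e" for k
      using M that(2) seq_suble[OF r, of "k + M"] by (intro less_imp_le) auto
    moreover have "AE x in lborel. (\<lambda>k. F m x - F (r (k + M)) x) \<longlonglongrightarrow> F m x - f x"
      using lim by eventually_elim (intro tendsto_intros LIMSEQ_ignore_initial_segment)
    ultimately show ?thesis
      using Lp2_Fatou[of "\<lambda>k x. F m x - F (r (k + M)) x" e "\<lambda>x. F m x - f x"] Lp2_diff[OF F F] by auto
  qed
  obtain M where M: "\<forall>m\<ge>M. \<forall>n\<ge>M. nsq (\<lambda>x. F m x - F n x) < 1" using Cauchy[of 1] by auto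
  \<comment> \<open>\<open>f\<close> is the difference of \<open>F M\<close> and
    \<open>F M - f\<close>, both in \<open>Lp 2\<close>.\<close>
  have fL: "f \<in> Lp 2"
    using Lp2_diff[OF F[of M] conjunct1[OF key[OF M order_refl]]] by simp
  have "(\<lambda>n. nsq (\<lambda>x. F n x - f x)) \<longlonglongrightarrow> 0"
  proof (rule LIMSEQ_I)
    fix e :: real assume "e > 0"
    then obtain M where "\<forall>m\<ge>M. \<forall>n\<ge>M. nsq (\<lambda>x. F m x - F n x) < e / 2" using Cauchy[of "e/2"] by auto
    from key[OF this] show "\<exists>no. \<forall>n\<ge>no. norm (nsq (\<lambda>x. F n x - f x) - 0) < e"
      using \<open>e > 0\<close> by (intro exI[of _ M]) fastforce
  qed
  with F fL have "L2lim F f" by (simp add: L2lim_def)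
  then show ?thesis by (rule that)
qed

section \<open>Translations, difference quotients and integration by parts\<close>

lemma lborel_distr_affine_sign:
  assumes "s = 1 \<or> s = - 1"
  shows "distr lborel borel (\<lambda>x. c + s *\<^sub>R x) = (lborel :: 'a::euclidean_space measure)"
proof -
  have "\<bar>s\<bar> = 1" "s \<noteq> 0" using assms by auto
  with lborel_affine[of s c] show ?thesis by (simp add: density_1)
qed

text \<open>The sign treats translations (\<open>s = 1\<close>) and reflections
  (\<open>s = - 1\<close>) at once; a convolution kernel \<open>k (x - y)\<close>, seen as a
  function of \<open>y\<close>, needs both.\<close>

lemma integral_translate_sign:
  fixes f :: "'a::euclidean_space \<Rightarrow> 'b::{banach, second_countable_topology}"
  assumes "f \<in> borel_measurable borel" "s = 1 \<or> s = - 1"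
  shows "(LINT x|lborel. f (c + s *\<^sub>R x)) = (LINT x|lborel. f x)"
    "integrable lborel (\<lambda>x. f (c + s *\<^sub>R x)) \<longleftrightarrow> integrable lborel f"
  using assms
  by (subst (2) lborel_distr_affine_sign[OF assms(2), of c, symmetric];
      simp add: integral_distr integrable_distr_eq)+

lemma Lp2_translate_sign:
  assumes "f \<in> Lp 2" "s = 1 \<or> s = - 1"
  shows "(\<lambda>x. f (c + s *\<^sub>R x)) \<in> Lp 2" "nsq (\<lambda>x. f (c + s *\<^sub>R x)) = nsq f"
proof -
  have [measurable]: "f \<in> borel_measurable borel" using assms(1) by (rule Lp2_measurable)
  have m: "(\<lambda>x. (norm (f x))\<^sup>2) \<in> borel_measurable borel" by simp
  show "(\<lambda>x. f (c + s *\<^sub>R x)) \<in> Lp 2"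
    using assms(1) integral_translate_sign(2)[OF m assms(2)] by (simp add: Lp_def)
  show "nsq (\<lambda>x. f (c + s *\<^sub>R x)) = nsq f"
    using integral_translate_sign(1)[OF m assms(2)] by (simp add: nsq_def)
qed

lemma continuous_Lp2:
  fixes f :: "real^'n::finite \<Rightarrow> 'b::euclidean_space"
  assumes "continuous_on UNIV f" "\<And>x. norm x \<ge> r \<Longrightarrow> f x = 0"
  shows "f \<in> Lp 2"
proof -
  have "integrable lborel (\<lambda>x. (norm (f x))\<^sup>2)"
    using assms by (intro continuous_bounded_support(2)[where r = r] continuous_intros) auto
  then show ?thesis using assms by (simp add: Lp_def borel_measurable_continuous_onI)
qed

lemma Cc_Lp2: "f \<in> Cc_infinity \<Longrightarrow> f \<in> Lp 2"
  by (metis Cc_support Cc_smooth smooth_continuous continuous_Lp2)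

lemma Cc_grad_support: 
  assumes "f \<in> Cc_infinity"
  obtains r where "r > 0" "\<And>x. norm x \<ge> r \<Longrightarrow> f x = 0" "\<And>x. norm x \<ge> r \<Longrightarrow> grad f x = 0"
proof -
  obtain r where r: "r > 0" "\<And>x. norm x \<ge> r \<Longrightarrow> f x = 0" using Cc_support[OF assms] by blast
  show ?thesis using grad_support[of r f] r by (intro that[of "r + 1"]) force+
qed

lemma Cc_grad_Lp2: "f \<in> Cc_infinity \<Longrightarrow> grad f \<in> Lp 2"
  by (metis Cc_grad_support Cc_smooth continuous_on_grad continuous_Lp2)

lemma LIMSEQ_diff_quotient:
  assumes "smooth u"
  shows "(\<lambda>n. real (Suc n) * (u (x + (1 / real (Suc n)) *\<^sub>R z) - u x)) \<longlonglongrightarrow> grad u x \<bullet> z"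
proof -
  have 1: "((\<lambda>t. x + t *\<^sub>R z) has_derivative (\<lambda>t. t *\<^sub>R z)) (at 0)"
    by (auto intro!: derivative_eq_intros)
  have 2: "(u has_derivative (\<lambda>h. grad u x \<bullet> h)) (at (x + 0 *\<^sub>R z))"
    using smooth_has_derivative[OF assms] by simp
  have "((\<lambda>t. u (x + t *\<^sub>R z)) has_derivative (\<lambda>t. grad u x \<bullet> (t *\<^sub>R z))) (at 0)"
    by (rule has_derivative_compose[OF 1 2])
  then have "DERIV (\<lambda>t. u (x + t *\<^sub>R z)) 0 :> grad u x \<bullet> z"
    by (simp add: has_field_derivative_def mult_commute_abs)
  then have "(\<lambda>h. (u (x + h *\<^sub>R z) - u x) / h) \<midarrow>0\<rightarrow> grad u x \<bullet> z"
    by (simp add: DERIV_def)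
  then have "(\<lambda>n. (u (x + inverse (real (Suc n)) *\<^sub>R z) - u x) / inverse (real (Suc n))) \<longlonglongrightarrow> grad u x \<bullet> z"
    using LIMSEQ_inverse_real_of_nat by (auto simp: LIMSEQ_SEQ_conv[symmetric] simp del: of_nat_Suc)
  then show ?thesis
    by (simp add: divide_inverse mult.commute del: of_nat_Suc)
qed

text \<open>A dominating function for all difference quotients in a direction: the mean value
  inequality bounds them uniformly, and since the displacement never exceeds \<open>norm z\<close>,
  one ball contains all their supports.\<close>

lemma diff_quotient_bound:
  assumes "u \<in> Cc_infinity"
  obtains M r where "M > 0" "r > 0"
    "\<And>n x. \<bar>real (Suc n) * (u (x + (1 / real (Suc n)) *\<^sub>R z) - u x)\<bar> \<le> indicator (cball 0 r) x * M"
proof -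
  obtain M where M: "M > 0" "\<And>x. norm (grad u x) \<le> M" using Cc_grad_bounded[OF assms] by auto
  obtain r where r: "r > 0" "\<And>x. norm x \<ge> r \<Longrightarrow> u x = 0" using Cc_support[OF assms] by blast
  have "\<bar>real (Suc n) * (u (x + (1 / real (Suc n)) *\<^sub>R z) - u x)\<bar> \<le> indicator (cball 0 (r + norm z)) x * (M * (norm z + 1))" for n x
  proof (cases "norm x \<le> r + norm z")
    case True
    have "\<bar>u (x + (1 / real (Suc n)) *\<^sub>R z) - u x\<bar> \<le> M * norm ((x + (1 / real (Suc n)) *\<^sub>R z) - x)"
      by (rule smooth_diff_bound) (use assms M in auto)
    also have "\<dots> = M * norm z / real (Suc n)" by simp
    finally have "real (Suc n) * \<bar>u (x + (1 / real (Suc n)) *\<^sub>R z) - u x\<bar> \<le> M * norm z"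
      by (simp add: field_simps del: of_nat_Suc)
    also have "\<dots> \<le> M * (norm z + 1)" using M(1) by simp
    finally show ?thesis using True by (simp add: abs_mult del: of_nat_Suc)
  next
    case False
    have "norm ((1 / real (Suc n)) *\<^sub>R z) \<le> norm z"
      by (simp add: field_simps mult_left_le del: of_nat_Suc) (simp add: algebra_simps)
    moreover have "norm x \<le> norm (x + (1 / real (Suc n)) *\<^sub>R z) + norm ((1 / real (Suc n)) *\<^sub>R z)"
      using norm_triangle_ineq4[of "x + (1 / real (Suc n)) *\<^sub>R z" "(1 / real (Suc n)) *\<^sub>R z"] by simp
    ultimately have "norm (x + (1 / real (Suc n)) *\<^sub>R z) \<ge> r" "norm x \<ge> r" using False norm_ge_zero[of z] by linarith+
    then show ?thesis using r(2) False by simp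
  qed
  \<comment> \<open>The factor \<open>norm z + 1\<close> keeps the constant positive even for
    \<open>z = 0\<close>.\<close>
  then show ?thesis using M(1) r(1)
    by (intro that[of "M * (norm z + 1)" "r + norm z"] mult_pos_pos add_pos_nonneg add_nonneg_pos) simp_all
qed

lemma integrable_indicator_cball: "integrable lborel (\<lambda>x::'a::euclidean_space. indicator (cball 0 r) x * (M::real))"
  by (intro integrable_mult_left integrable_real_indicator emeasure_bounded_finite bounded_cball) simp

text \<open>By translation invariance every difference quotient has integral 0, and dominated
  convergence passes this to the derivative.\<close>

lemma Cc_integral_partial_deriv:
  fixes u :: "real^'n::finite \<Rightarrow> real"
  assumes "u \<in> Cc_infinity"
  shows "(LINT x|lborel. partial_deriv i u x) = 0"
proof -
  have [measurable]: "u \<in> borel_measurable borel" using assms by (auto intro: smooth_borel)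
  let ?z = "axis i 1 :: real^'n"
  obtain M r where M: "M > 0"
    "\<And>n x. \<bar>real (Suc n) * (u (x + (1 / real (Suc n)) *\<^sub>R ?z) - u x)\<bar> \<le> indicator (cball 0 r) x * M"
    using diff_quotient_bound[OF assms, of ?z] by metis
  have "(\<lambda>n. LINT x|lborel. real (Suc n) * (u (x + (1 / real (Suc n)) *\<^sub>R ?z) - u x))
      \<longlonglongrightarrow> (LINT x|lborel. grad u x \<bullet> ?z)"
  proof (rule integral_dominated_convergence[where w = "\<lambda>x. indicator (cball 0 r) x * M"])
    show "(\<lambda>x. grad u x \<bullet> ?z) \<in> borel_measurable lborel"
      using borel_measurable_continuous_onI[OF continuous_on_grad[OF Cc_smooth[OF assms]]] by simp
    show "integrable lborel (\<lambda>x. indicator (cball 0 r) x * M)" by (rule integrable_indicator_cball)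
  qed (use assms M in \<open>auto intro!: LIMSEQ_diff_quotient simp del: of_nat_Suc\<close>)
  moreover have "(LINT x|lborel. real (Suc n) * (u (x + (1 / real (Suc n)) *\<^sub>R ?z) - u x)) = 0" for n
  proof -
    have "integrable lborel (\<lambda>x. u ((1 / real (Suc n)) *\<^sub>R ?z + 1 *\<^sub>R x))"
      by (subst integral_translate_sign) (use assms in \<open>auto intro: Cc_integrable\<close>)
    moreover have "(LINT x|lborel. u ((1 / real (Suc n)) *\<^sub>R ?z + 1 *\<^sub>R x)) = (LINT x|lborel. u x)"
      by (rule integral_translate_sign) auto
    ultimately show ?thesis using Cc_integrable[OF assms] by (simp add: add.commute del: of_nat_Suc)
  qed
  ultimately have "(LINT x|lborel. grad u x \<bullet> ?z) = 0" by (simp add: LIMSEQ_const_iff del: of_nat_Suc)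
  then show ?thesis by (simp add: inner_axis)
qed

lemma integration_by_parts:
  assumes "smooth f" "g \<in> Cc_infinity"
  shows "(LINT x|lborel. f x * partial_deriv i g x) = - (LINT x|lborel. partial_deriv i f x * g x)"
proof -
  have eq: "partial_deriv i (\<lambda>x. f x * g x) x = f x * partial_deriv i g x + partial_deriv i f x * g x" for x
    using assms by (intro partial_deriv_mult smooth_differentiable) auto
  have "integrable lborel (\<lambda>x. f x * partial_deriv i g x)" "integrable lborel (\<lambda>x. partial_deriv i f x * g x)"
    using assms by (auto intro!: Cc_integrable)
  then show ?thesis
    using Cc_integral_partial_deriv[OF Cc_mult_smooth[OF assms], of i] by (simp add: eq)
qed

text \<open>Telescoping along \<open>Suc n\<close> equal steps bounds a translate by \<open>Suc n\<close> times the smallest step;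
  as \<open>n\<close> grows the difference quotients converge to the directional derivative.\<close>

lemma nsq_translate_le:
  assumes "u \<in> Cc_infinity"
  shows "nsq (\<lambda>x. u (x + z) - u x) \<le> (norm z)\<^sup>2 * nsq (grad u)"
proof -
  have [measurable]: "u \<in> borel_measurable borel" using assms by (auto intro: smooth_borel)
  define d where "d n x = real (Suc n) * (u (x + (1 / real (Suc n)) *\<^sub>R z) - u x)" for n x
  obtain M r where M: "M > 0" "\<And>n x. \<bar>d n x\<bar> \<le> indicator (cball 0 r) x * M"
    using diff_quotient_bound[OF assms, of z] unfolding d_def by metis
  have dm [measurable]: "d n \<in> borel_measurable borel" for n unfolding d_def by measurable
  have gm [measurable]: "grad u \<in> borel_measurable borel"
    using continuous_on_grad[of u] assms by (auto intro!: borel_measurable_continuous_onI)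
  have dsq: "(d n x)\<^sup>2 \<le> indicator (cball 0 r) x * M\<^sup>2" for n x
    using M(2)[of n x] M(1) abs_le_square_iff[of "d n x" M] by (cases "x \<in> cball 0 r") auto
  have dL: "d n \<in> Lp 2" for n
    unfolding Lp_def using dsq
    by (auto intro!: Bochner_Integration.integrable_bound[OF integrable_indicator_cball[of r "M\<^sup>2"]] order_trans[OF _ abs_ge_self])
  have "(\<lambda>n. LINT x|lborel. (d n x)\<^sup>2) \<longlonglongrightarrow> (LINT x|lborel. (grad u x \<bullet> z)\<^sup>2)"
  proof (rule integral_dominated_convergence[where w = "\<lambda>x. indicator (cball 0 r) x * M\<^sup>2"])
    show "AE x in lborel. (\<lambda>n. (d n x)\<^sup>2) \<longlonglongrightarrow> (grad u x \<bullet> z)\<^sup>2"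
      unfolding d_def using assms by (intro AE_I2 tendsto_intros LIMSEQ_diff_quotient) auto
    show "integrable lborel (\<lambda>x. indicator (cball 0 r) x * M\<^sup>2)" by (rule integrable_indicator_cball)
  qed (use dsq in auto)
  then have lim: "(\<lambda>n. nsq (d n)) \<longlonglongrightarrow> nsq (\<lambda>x. grad u x \<bullet> z)" by (simp add: nsq_def)
  have "nsq (\<lambda>x. u (x + z) - u x) \<le> nsq (d n)" for n
  proof -
    let ?h = "(1 / real (Suc n)) *\<^sub>R z"
    have tele: "u (x + z) - u x = (1 / real (Suc n)) * (\<Sum>k<Suc n. d n (real k *\<^sub>R ?h + 1 *\<^sub>R x))" for x
    proof -
      have "(\<Sum>k<Suc n. u (x + real (Suc k) *\<^sub>R ?h) - u (x + real k *\<^sub>R ?h)) = u (x + real (Suc n) *\<^sub>R ?h) - u (x + real 0 *\<^sub>R ?h)"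
        by (rule sum_lessThan_telescope)
      also have "\<dots> = u (x + z) - u x" by (simp del: of_nat_Suc)
      finally have sum: "(\<Sum>k<Suc n. u (x + real (Suc k) *\<^sub>R ?h) - u (x + real k *\<^sub>R ?h)) = u (x + z) - u x" .
      have "d n (real k *\<^sub>R ?h + 1 *\<^sub>R x) = real (Suc n) * (u (x + real (Suc k) *\<^sub>R ?h) - u (x + real k *\<^sub>R ?h))" for k
      proof -
        have "real k *\<^sub>R ?h + 1 *\<^sub>R x + ?h = x + real (Suc k) *\<^sub>R ?h" "real k *\<^sub>R ?h + 1 *\<^sub>R x = x + real k *\<^sub>R ?h"
          by (simp_all add: scaleR_left_distrib del: scaleR_scaleR)
        then show ?thesis unfolding d_def by (simp only:)
      qed
      then have "(\<Sum>k<Suc n. d n (real k *\<^sub>R ?h + 1 *\<^sub>R x)) = real (Suc n) * (u (x + z) - u x)"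
        unfolding sum[symmetric] by (simp only: sum_distrib_left)
      then show ?thesis by (simp del: of_nat_Suc sum.lessThan_Suc)
    qed
    \<comment> \<open>The square of a mean is at most the mean of the squares, and each square is a
      translate of \<open>(d n)^2\<close>. After integration the sum thus collapses to the single
      number \<open>nsq (d n)\<close>.\<close>
    have sq: "(u (x + z) - u x)\<^sup>2 \<le> (1 / real (Suc n)) * (\<Sum>k<Suc n. (d n (real k *\<^sub>R ?h + 1 *\<^sub>R x))\<^sup>2)" for x
    proof -
      have "(\<Sum>k<Suc n. d n (real k *\<^sub>R ?h + 1 *\<^sub>R x))\<^sup>2 \<le> real (Suc n) * (\<Sum>k<Suc n. (d n (real k *\<^sub>R ?h + 1 *\<^sub>R x))\<^sup>2)"
        using Cauchy_Schwarz_ineq_sum[of "\<lambda>k. 1" "\<lambda>k. d n (real k *\<^sub>R ?h + 1 *\<^sub>R x)" "{..<Suc n}"] by (simp del: of_nat_Suc sum.lessThan_Suc)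
      then have "(1 / real (Suc n))\<^sup>2 * (\<Sum>k<Suc n. d n (real k *\<^sub>R ?h + 1 *\<^sub>R x))\<^sup>2
          \<le> (1 / real (Suc n))\<^sup>2 * (real (Suc n) * (\<Sum>k<Suc n. (d n (real k *\<^sub>R ?h + 1 *\<^sub>R x))\<^sup>2))"
        by (intro mult_left_mono) auto
      then show ?thesis unfolding tele
        by (simp add: power_mult_distrib power2_eq_square del: of_nat_Suc sum.lessThan_Suc)
    qed
    have int: "integrable lborel (\<lambda>x. (d n (real k *\<^sub>R ?h + 1 *\<^sub>R x))\<^sup>2)"
      and eq: "(LINT x|lborel. (d n (real k *\<^sub>R ?h + 1 *\<^sub>R x))\<^sup>2) = nsq (d n)" for k
      using Lp2_integrable[OF Lp2_translate_sign(1)[OF dL[of n], of 1 "real k *\<^sub>R ?h"]] Lp2_translate_sign(2)[OF dL[of n], of 1 "real k *\<^sub>R ?h"]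
      by (simp_all add: nsq_def del: of_nat_Suc)
    have uL: "(\<lambda>x. u (x + z) - u x) \<in> Lp 2"
      using Lp2_diff[OF Lp2_translate_sign(1)[OF Cc_Lp2[OF assms], of 1 z] Cc_Lp2[OF assms]] by (simp add: add.commute)
    have "nsq (\<lambda>x. u (x + z) - u x) \<le> (LINT x|lborel. (1 / real (Suc n)) * (\<Sum>k<Suc n. (d n (real k *\<^sub>R ?h + 1 *\<^sub>R x))\<^sup>2))"
      unfolding nsq_def real_norm_def power2_abs using sq Lp2_integrable[OF uL] int
      by (intro integral_mono integrable_mult_right Bochner_Integration.integrable_sum) auto
    also have "\<dots> = (1 / real (Suc n)) * (\<Sum>k<Suc n. nsq (d n))"
      by (subst integral_mult_right_zero, subst Bochner_Integration.integral_sum[OF int], simp only: eq)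
    also have "\<dots> = nsq (d n)" by (simp del: of_nat_Suc sum.lessThan_Suc)
    finally show ?thesis .
  qed
  then have "nsq (\<lambda>x. u (x + z) - u x) \<le> nsq (\<lambda>x. grad u x \<bullet> z)"
    by (intro LIMSEQ_le_const[OF lim]) auto
  also have "\<dots> \<le> (LINT x|lborel. (norm z)\<^sup>2 * (norm (grad u x))\<^sup>2)"
    unfolding nsq_def
  proof (rule integral_mono_AE')
    have "(norm (grad u x \<bullet> z))\<^sup>2 \<le> (norm z)\<^sup>2 * (norm (grad u x))\<^sup>2" for x
      using Cauchy_Schwarz_ineq[of "grad u x" z] by (simp add: power2_norm_eq_inner mult.commute)
    then show "AE x in lborel. (norm (grad u x \<bullet> z))\<^sup>2 \<le> (norm z)\<^sup>2 * (norm (grad u x))\<^sup>2" by simp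
  qed (use Lp2_integrable[OF Cc_grad_Lp2[OF assms]] in auto)
  also have "\<dots> = (norm z)\<^sup>2 * nsq (grad u)" by (simp add: nsq_def)
  finally show ?thesis .
qed

subsection \<open>Mollification\<close>

definition convol :: "(real^'n::finite \<Rightarrow> real) \<Rightarrow> (real^'n \<Rightarrow> real) \<Rightarrow> real^'n \<Rightarrow> real" where
  "convol k f x = (LINT y|lborel. k (x - y) * f y)"

definition mollifier :: "real \<Rightarrow> (real^'n::finite \<Rightarrow> real) \<Rightarrow> bool" where
  "mollifier e k \<longleftrightarrow> k \<in> Cc_infinity \<and> (\<forall>x. 0 \<le> k x) \<and> (LINT x|lborel. k x) = 1 \<and>
     (\<forall>x. norm x \<ge> e \<longrightarrow> k x = 0)"

lemma uniformly_continuous_onE_UNIV: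
  assumes "uniformly_continuous_on UNIV f" "e > 0"
  obtains d where "d > 0" "\<And>x y. dist y x < d \<Longrightarrow> dist (f y) (f x) < e"
proof -
  from assms obtain d where d: "d > 0" "\<forall>x\<in>UNIV. \<forall>y\<in>UNIV. dist y x < d \<longrightarrow> dist (f y) (f x) < e"
    unfolding uniformly_continuous_on_def by auto
  show ?thesis by (rule that[OF d(1)]) (simp add: d(2)[rule_format])
qed

lemma locally_integrable_measurable: "locally_integrable f \<Longrightarrow> f \<in> borel_measurable borel"
  by (simp add: locally_integrable_def)

lemma locally_integrable_cball: "locally_integrable f \<Longrightarrow> integrable lborel (\<lambda>x. indicator (cball 0 r) x *\<^sub>R f x)"
  by (simp add: locally_integrable_def set_integrable_def)

lemma locally_integrableI:
  assumes "f \<in> borel_measurable borel" "\<And>r. integrable lborel (\<lambda>x. indicator (cball 0 r) x *\<^sub>R f x)"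
  shows "locally_integrable f"
  unfolding locally_integrable_def
proof safe
  fix K :: "(real^'a) set" assume K: "compact K"
  obtain r where "K \<subseteq> cball 0 r"
    using compact_imp_bounded[OF K] by (auto simp: bounded_pos subset_iff)
  then show "set_integrable lborel K f"
    using K by (intro set_integrable_subset[OF assms(2)[of r, folded set_integrable_def]])
      (auto simp: compact_imp_closed borel_closed)
qed (use assms(1) in simp)

lemma locally_integrable_bounded_mult:
  fixes f :: "real^'n::finite \<Rightarrow> real"
  assumes f: "locally_integrable f" and g: "g \<in> borel_measurable borel"
    and M: "\<And>x. \<bar>g x\<bar> \<le> M" "\<And>x. norm x \<ge> r \<Longrightarrow> g x = 0"
  shows "integrable lborel (\<lambda>x. g x * f x)"
    "\<bar>LINT x|lborel. g x * f x\<bar> \<le> M * (LINT x|lborel. indicator (cball 0 r) x * \<bar>f x\<bar>)"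
proof -
  have "integrable lborel (\<lambda>x. \<bar>indicator (cball 0 r) x *\<^sub>R f x\<bar>)"
    using locally_integrable_cball[OF f] by (rule integrable_abs)
  then have i: "integrable lborel (\<lambda>x. M * (indicator (cball 0 r) x * \<bar>f x\<bar>))"
    by (simp add: abs_mult)
  have le: "\<bar>g x * f x\<bar> \<le> M * (indicator (cball 0 r) x * \<bar>f x\<bar>)" for x
    using M(1)[of x] M(2)[of x] by (cases "norm x \<ge> r") (auto simp: abs_mult mult_right_mono)
  show *: "integrable lborel (\<lambda>x. g x * f x)"
  proof (rule Bochner_Integration.integrable_bound[OF i])
    show "(\<lambda>x. g x * f x) \<in> borel_measurable lborel"
      using locally_integrable_measurable[OF f] g by simp
    show "AE x in lborel. norm (g x * f x) \<le> norm (M * (indicator (cball 0 r) x * \<bar>f x\<bar>))"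
      unfolding real_norm_def by (rule AE_I2) (rule order_trans[OF le abs_ge_self])
  qed
  have "\<bar>LINT x|lborel. g x * f x\<bar> \<le> (LINT x|lborel. \<bar>g x * f x\<bar>)" by (rule integral_abs_bound)
  also have "\<dots> \<le> (LINT x|lborel. M * (indicator (cball 0 r) x * \<bar>f x\<bar>))"
    using * i le by (intro integral_mono integrable_abs) auto
  finally show "\<bar>LINT x|lborel. g x * f x\<bar> \<le> M * (LINT x|lborel. indicator (cball 0 r) x * \<bar>f x\<bar>)" by simp
qed

lemma Cc_mult_integrable:
  assumes "locally_integrable f" "g \<in> Cc_infinity"
  shows "integrable lborel (\<lambda>x. g x * f x)"
proof -
  obtain M where "\<And>x. \<bar>g x\<bar> \<le> M" using Cc_bounded[OF assms(2)] by auto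
  moreover obtain r where "\<And>x. norm x \<ge> r \<Longrightarrow> g x = 0" using Cc_support[OF assms(2)] by blast
  ultimately show ?thesis
    using assms by (intro locally_integrable_bounded_mult(1)) (auto intro: smooth_borel)
qed

lemma Cc_reflect: "k \<in> Cc_infinity \<Longrightarrow> (\<lambda>y. k (x - y)) \<in> Cc_infinity"
  using Cc_affine[of k "-1" x] by simp

lemma partial_deriv_reflect: "smooth k \<Longrightarrow> partial_deriv i (\<lambda>y. k (x - y)) y = - partial_deriv i k (x - y)"
  using partial_deriv_affine[of k x "-1" y i] smooth_differentiable[of k] by simp

section \<open>Regularity of convolutions\<close>

lemma convol_integrable:
  assumes "locally_integrable f" "k \<in> Cc_infinity"
  shows "integrable lborel (\<lambda>y. k (x - y) * f y)"
  by (rule Cc_mult_integrable[OF assms(1) Cc_reflect[OF assms(2)]])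

text \<open>A Taylor estimate whose error constant does not depend on the base point
  \<open>p\<close>, as it comes from a modulus of uniform continuity of the gradient. This
  uniformity allows differentiation under the integral sign.\<close>

lemma smooth_linearization:
  assumes "smooth k" "\<And>p q. dist q p < d \<Longrightarrow> dist (grad k q) (grad k p) < e" "norm h < d"
  shows "\<bar>k (p + h) - k p - grad k p \<bullet> h\<bar> \<le> e * norm h"
proof -
  have "d > 0" using assms(3) norm_ge_zero[of h] by linarith
  have "norm (k (p + h) - k p - (grad k p \<bullet> (p + h - p))) \<le> norm (p + h - p) * e"
  proof (rule differentiable_bound_linearization[of _ _ "ball p d" k "\<lambda>x v. grad k x \<bullet> v" p])
    show "p + t *\<^sub>R (p + h - p) \<in> ball p d" if "t \<in> {0..1}" for t
      using that assms(3) mult_right_mono[of t 1 "norm h"] by (simp add: dist_norm)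
    show "onorm ((\<lambda>v. grad k x \<bullet> v) - (\<lambda>v. grad k p \<bullet> v)) \<le> e" if x: "x \<in> ball p d" for x
      unfolding fun_diff_def
    proof (rule onorm_bound)
      have le: "norm (grad k x - grad k p) \<le> e" 
        using assms(2)[of x p] x by (simp add: dist_norm less_imp_le norm_minus_commute)
      show "norm (grad k x \<bullet> v - grad k p \<bullet> v) \<le> e * norm v" for v
        using Cauchy_Schwarz_ineq2[of "grad k x - grad k p" v] mult_right_mono[OF le norm_ge_zero[of v]]
        by (simp add: inner_diff_left)
      show "0 \<le> e" using le norm_ge_zero order_trans by blast
    qed
  qed (use \<open>d > 0\<close> smooth_has_derivative[OF assms(1)] in \<open>auto intro: has_derivative_at_withinI\<close>)
  then show ?thesis by (simp add: mult.commute)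
qed

text \<open>The kernel is linearised uniformly and the error \<open>w\<close> is integrated against
  \<open>f\<close>. Since \<open>w\<close> has bounded support, local integrability of
  \<open>f\<close> suffices.\<close>

lemma convol_has_derivative:
  assumes f: "locally_integrable f" and k: "k \<in> Cc_infinity"
  shows "(convol k f has_derivative (\<lambda>h. \<Sum>i\<in>UNIV. h $ i * convol (partial_deriv i k) f x)) (at x)"
  unfolding has_derivative_at_alt
proof (intro conjI allI impI)
  show "bounded_linear (\<lambda>h. \<Sum>i\<in>UNIV. h $ i * convol (partial_deriv i k) f x)"
    by (intro bounded_linear_sum bounded_linear_mult_left[THEN bounded_linear_compose] bounded_linear_vec_nth)
  have sk: "smooth k" using k by auto
  fix e :: real assume "e > 0"
  obtain r where r: "r > 0" "\<And>x. norm x \<ge> r \<Longrightarrow> k x = 0" "\<And>x. norm x \<ge> r \<Longrightarrow> grad k x = 0"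
    using Cc_grad_support[OF k] by blast
  \<comment> \<open>The kernel has radius \<open>r\<close>, its centre moves by less than 1 from
    \<open>x\<close>; the ball of radius \<open>R\<close> therefore contains the support of the
    kernel around every centre considered.\<close>
  define R where "R = r + 1 + norm x"
  define I where "I = (LINT y|lborel. indicator (cball 0 R) y * \<bar>f y\<bar>)"
  have I: "I \<ge> 0" unfolding I_def by (rule integral_nonneg_AE) simp
  have uc: "uniformly_continuous_on UNIV (grad k)"
    by (rule continuous_bounded_support(3)[OF continuous_on_grad r(3)]) (use sk in auto)
  \<comment> \<open>\<open>I\<close> is the mass of \<open>f\<close> on that ball; the
    \<open>+ 1\<close> guards against \<open>I = 0\<close>.\<close>
  define e' where "e' = e / (I + 1)"
  have "e' > 0" using I \<open>e > 0\<close> by (simp add: e'_def)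
  then obtain d where d: "d > 0" "\<And>p q. dist q p < d \<Longrightarrow> dist (grad k q) (grad k p) < e'"
    using uniformly_continuous_onE_UNIV[OF uc] by metis
  show "\<exists>d>0. \<forall>y. norm (y - x) < d \<longrightarrow>
      norm (convol k f y - convol k f x - (\<Sum>i\<in>UNIV. (y - x) $ i * convol (partial_deriv i k) f x)) \<le> e * norm (y - x)"
  proof (intro exI[of _ "min d 1"] conjI allI impI)
    fix z assume "norm (z - x) < min d 1"
    define h where "h = z - x"
    have h: "norm h < d" "norm h < 1" using \<open>norm (z - x) < min d 1\<close> by (auto simp: h_def)
    define w where "w y = k (z - y) - k (x - y) - grad k (x - y) \<bullet> h" for y
    have "w y = 0" if "norm y \<ge> R" for y
    proof -
      have "norm y \<le> norm (z - y) + norm h + norm x" "norm y \<le> norm (x - y) + norm x"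
        using norm_triangle_ineq4[of z "z - y"] norm_triangle_ineq[of h x] norm_triangle_ineq4[of x "x - y"]
        by (auto simp: h_def)
      then have "norm (z - y) \<ge> r" "norm (x - y) \<ge> r" using that h by (auto simp: R_def)
      then show ?thesis using r by (simp add: w_def)
    qed
    moreover have "\<bar>w y\<bar> \<le> e' * norm h" for y
      using smooth_linearization[OF sk d(2) h(1), of "x - y"] by (simp add: w_def h_def algebra_simps)
    moreover have "w \<in> borel_measurable borel"
    proof -
      have "continuous_on UNIV (\<lambda>y. k (c - y))" for c
        using smooth_continuous[OF Cc_smooth[OF Cc_reflect[OF k]]] .
      moreover have "continuous_on UNIV (\<lambda>y. grad k (x - y))"
        by (rule continuous_on_compose2[OF continuous_on_grad[OF sk]]) (auto intro!: continuous_intros)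
      ultimately show ?thesis unfolding w_def
        by (intro borel_measurable_continuous_onI continuous_intros)
    qed
    ultimately have le: "\<bar>LINT y|lborel. w y * f y\<bar> \<le> (e' * norm h) * I"
      unfolding I_def by (intro locally_integrable_bounded_mult(2)[OF f]) auto
    have "(LINT y|lborel. w y * f y) = convol k f z - convol k f x - (\<Sum>i\<in>UNIV. h $ i * convol (partial_deriv i k) f x)"
    proof -
      note int = convol_integrable[OF f k] convol_integrable[OF f Cc_partial_deriv[OF k]]
      have "w y * f y = k (z - y) * f y - k (x - y) * f y - (\<Sum>i\<in>UNIV. h $ i * (partial_deriv i k (x - y) * f y))" for y
        by (simp add: w_def inner_vec_def algebra_simps sum_distrib_left)
      then show ?thesis using int by (simp add: convol_def)
    qed
    with le have "norm (convol k f z - convol k f x - (\<Sum>i\<in>UNIV. h $ i * convol (partial_deriv i k) f x)) \<le> (e' * I) * norm h"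
      by (simp add: mult_ac)
    also have "\<dots> \<le> e * norm h"
      using I \<open>e > 0\<close> by (intro mult_right_mono) (auto simp: e'_def field_simps)
    finally show "norm (convol k f z - convol k f x - (\<Sum>i\<in>UNIV. (z - x) $ i * convol (partial_deriv i k) f x)) \<le> e * norm (z - x)"
      unfolding h_def .
  qed (use d in simp)
qed

lemma partial_deriv_convol:
  assumes "locally_integrable f" "k \<in> Cc_infinity"
  shows "partial_deriv i (convol k f) x = convol (partial_deriv i k) f x"
  using partial_derivI[OF convol_has_derivative[OF assms], of i]
  by (simp add: axis_def mult_delta_left)

text \<open>A derivative of the convolution is the convolution with a derivative of the kernel,
  again a test function; the induction therefore runs over all kernels at once.\<close>

lemma smooth_convol:
  assumes "locally_integrable f" "k \<in> Cc_infinity"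
  shows "smooth (convol k f)"
proof -
  have "C_k n (convol k f)" if "k \<in> Cc_infinity" for n k
    using that
  proof (induction n arbitrary: k)
    case 0
    then show ?case
      using has_derivative_continuous[OF convol_has_derivative[OF assms(1) 0]]
      by (simp add: continuous_on_eq_continuous_at)
  next
    case (Suc n)
    have "partial_deriv i (convol k f) = convol (partial_deriv i k) f" for i
      by (rule ext) (rule partial_deriv_convol[OF assms(1) Suc.prems])
    moreover have "convol k f differentiable (at x)" for x
      using convol_has_derivative[OF assms(1) Suc.prems] by (auto simp: differentiable_def)
    ultimately show ?case using Suc by auto
  qed
  then show ?thesis using assms(2) by (simp add: smooth_def)
qed

lemma has_weak_gradient_nth:
  assumes "has_weak_gradient u G"
  shows "locally_integrable (\<lambda>x. G x $ i)"
proof -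
  have G: "locally_integrable G" using assms by (simp add: has_weak_gradient_def)
  have [measurable]: "G \<in> borel_measurable borel" by (rule locally_integrable_measurable[OF G])
  show ?thesis
  proof (rule locally_integrableI)
    show "(\<lambda>x. G x $ i) \<in> borel_measurable borel"
      by (rule borel_measurable_continuous_on[OF _ \<open>G \<in> borel_measurable borel\<close>, of "\<lambda>v. v $ i"])
        (intro continuous_intros)
    show "integrable lborel (\<lambda>x. indicator (cball 0 r) x *\<^sub>R G x $ i)" for r
      using integrable_bounded_linear[OF bounded_linear_vec_nth locally_integrable_cball[OF G, of r], of i] by simp
  qed
qed

text \<open>The kernel reflected about \<open>x\<close> is itself a test function. The sign from the
  reflection cancels the sign in the definition of the weak gradient, so the derivative moves from
  the kernel onto \<open>u\<close>.\<close>

lemma partial_deriv_convol_weak: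
  assumes u: "has_weak_gradient u G" and k: "k \<in> Cc_infinity"
  shows "partial_deriv i (convol k u) x = convol k (\<lambda>y. G y $ i) x"
proof -
  have "locally_integrable u" using u by (simp add: has_weak_gradient_def)
  then have "partial_deriv i (convol k u) x = (LINT y|lborel. partial_deriv i k (x - y) * u y)"
    using partial_deriv_convol[OF _ k] by (simp add: convol_def)
  also have "\<dots> = - (LINT y|lborel. u y * partial_deriv i (\<lambda>y. k (x - y)) y)"
    using k by (simp add: partial_deriv_reflect Cc_smooth mult.commute)
  also have "\<dots> = (LINT y|lborel. G y $ i * k (x - y))"
    using u Cc_reflect[OF k, of x] by (simp add: has_weak_gradient_def)
  finally show ?thesis by (simp add: convol_def mult.commute)
qed

lemma Cc_convol:
  assumes "locally_integrable f" "mollifier e k" "\<And>x. norm x \<ge> r \<Longrightarrow> f x = 0"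
  shows "convol k f \<in> Cc_infinity" "norm x \<ge> r + e \<Longrightarrow> convol k f x = 0"
proof -
  have k: "k \<in> Cc_infinity" using assms by (simp add: mollifier_def)
  have *: "convol k f x = 0" if "norm x \<ge> r + e" for x
  proof -
    have "k (x - y) * f y = 0" for y
    proof (cases "norm y \<ge> r")
      case False
      then have "norm (x - y) \<ge> e" using norm_triangle_sub[of x y] that by linarith
      then show ?thesis using assms(2) by (simp add: mollifier_def)
    qed (use assms(3) in simp)
    then have "(\<lambda>y. k (x - y) * f y) = (\<lambda>y. 0)" by blast
    then show ?thesis unfolding convol_def by (simp only: Bochner_Integration.integral_zero)
  qed
  then have "{x. convol k f x \<noteq> 0} \<subseteq> cball 0 (r + e)" by (force simp: not_le[symmetric])
  then have "bounded {x. convol k f x \<noteq> 0}" by (rule bounded_subset[OF bounded_cball])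
  then show "convol k f \<in> Cc_infinity"
    using smooth_convol[OF assms(1) k] by (simp add: Cc_infinity_iff)
  show "norm x \<ge> r + e \<Longrightarrow> convol k f x = 0" by (rule *)
qed

lemma convol_commuted:
  assumes "f \<in> borel_measurable borel" "k \<in> Cc_infinity"
  shows "convol k f x = (LINT y|lborel. k y * f (x - y))"
proof -
  have [measurable]: "k \<in> borel_measurable borel" using assms by (auto intro: smooth_borel)
  have "(LINT y|lborel. (\<lambda>y. k y * f (x - y)) (x + (-1) *\<^sub>R y)) = (LINT y|lborel. k y * f (x - y))"
    using assms(1) by (intro integral_translate_sign) simp_all
  then show ?thesis by (simp add: convol_def)
qed

lemma convol_mollifier_minus:
  assumes "locally_integrable f" "mollifier e k"
  shows "convol k f x - f x = (LINT y|lborel. k y * (f (x - y) - f x))"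
proof -
  have k: "k \<in> Cc_infinity" "(LINT y|lborel. k y) = 1" using assms(2) by (auto simp: mollifier_def)
  have [measurable]: "f \<in> borel_measurable borel" using assms(1) by (rule locally_integrable_measurable)
  have [measurable]: "k \<in> borel_measurable borel" using k by (auto intro: smooth_borel)
  have "integrable lborel (\<lambda>y. k y * f (x - y))"
  proof -
    have "integrable lborel (\<lambda>y. (\<lambda>y. k y * f (x - y)) (x + (-1) *\<^sub>R y))"
      using convol_integrable[OF assms(1) k(1), of x] by simp
    then show ?thesis by (subst (asm) integral_translate_sign) auto
  qed
  then show ?thesis
    using k Cc_integrable[OF k(1)] by (simp add: convol_commuted right_diff_distrib)
qed

lemma convol_uniform:
  assumes "locally_integrable f" "mollifier e k" "\<And>y. norm y < e \<Longrightarrow> \<bar>f (x - y) - f x\<bar> \<le> d"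
  shows "\<bar>convol k f x - f x\<bar> \<le> d"
proof -
  have k: "k \<in> Cc_infinity" "(LINT y|lborel. k y) = 1" using assms(2) by (auto simp: mollifier_def)
  have "\<bar>LINT y|lborel. k y * (f (x - y) - f x)\<bar> \<le> (LINT y|lborel. k y * d)"
  proof (rule integral_abs_bound[THEN order_trans], rule integral_mono_AE')
    show "AE y in lborel. \<bar>k y * (f (x - y) - f x)\<bar> \<le> k y * d"
    proof (rule AE_I2)
      fix y
      show "\<bar>k y * (f (x - y) - f x)\<bar> \<le> k y * d"
        using assms(2) assms(3)[of y] by (cases "norm y < e") (auto simp: mollifier_def abs_mult intro: mult_left_mono)
    qed
    show "AE y in lborel. 0 \<le> k y * d"
    proof (rule AE_I2)
      fix y
      show "0 \<le> k y * d"
        using assms(2) assms(3)[of y] by (cases "norm y < e") (force simp: mollifier_def intro!: mult_nonneg_nonneg)+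
    qed
  qed (use Cc_integrable[OF k(1)] in auto)
  then show ?thesis using k by (simp add: convol_mollifier_minus[OF assms(1,2)])
qed

text \<open>Jensen's inequality for the probability density \<open>k\<close>, by Cauchy-Schwarz with
  the splitting \<open>k = sqrt k * sqrt k\<close>, followed by Tonelli. With
  \<open>g x y = f (x - y)\<close> it says that mollification is a contraction; with
  \<open>g x y = u (x - y) - u x\<close> it measures the mollification error.\<close>

lemma kernel_average_nsq:
  fixes g :: "real^'n::finite \<Rightarrow> real^'n \<Rightarrow> real"
  assumes k: "mollifier e k" and g: "case_prod g \<in> borel_measurable (borel \<Otimes>\<^sub>M borel)" and "0 \<le> B"
    and B: "\<And>y. norm y < e \<Longrightarrow> (\<integral>\<^sup>+x. ennreal ((g x y)\<^sup>2) \<partial>lborel) \<le> ennreal B"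
  shows "(\<lambda>x. LINT y|lborel. k y * g x y) \<in> Lp 2" "nsq (\<lambda>x. LINT y|lborel. k y * g x y) \<le> B"
proof -
  have kC: "k \<in> Cc_infinity" "(LINT y|lborel. k y) = 1" and k0: "\<And>y. 0 \<le> k y"
    and ke: "\<And>y. norm y \<ge> e \<Longrightarrow> k y = 0"
    using k by (auto simp: mollifier_def)
  have [measurable]: "k \<in> borel_measurable borel" using kC by (auto intro: smooth_borel)
  have g' [measurable]: "(\<lambda>z. g (fst z) (snd z)) \<in> borel_measurable (borel \<Otimes>\<^sub>M borel)"
    using g by (simp add: split_beta')
  have [measurable]: "(\<lambda>y. g x y) \<in> borel_measurable borel" for x
    using measurable_compose[OF measurable_Pair1' g, of x] by simp
  have kk: "(\<integral>\<^sup>+y. ennreal (k y) \<partial>lborel) = 1"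
    using nn_integral_eq_integral[OF Cc_integrable[OF kC(1)]] k0 kC(2) by simp
  let ?h = "\<lambda>x. LINT y|lborel. k y * g x y"
  have hm: "?h \<in> borel_measurable borel"
    using lborel.borel_measurable_lebesgue_integral[of "\<lambda>x y. k y * g x y" borel] by (simp add: split_beta')
  have pt: "ennreal ((norm (?h x))\<^sup>2) \<le> (\<integral>\<^sup>+y. ennreal (k y * (g x y)\<^sup>2) \<partial>lborel)" for x
  proof -
    \<comment> \<open>If the integrand is not integrable, the left-hand side is 0 by convention and
      the bound still holds, so no integrability in \<open>y\<close> has to be established.\<close>
    have "ennreal (norm (?h x)) \<le> (\<integral>\<^sup>+y. ennreal (norm (k y * g x y)) \<partial>lborel)"
      using integral_norm_bound_ennreal[of lborel "\<lambda>y. k y * g x y"]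
      by (cases "integrable lborel (\<lambda>y. k y * g x y)") (auto simp: not_integrable_integral_eq)
    also have "\<dots> = (\<integral>\<^sup>+y. ennreal (sqrt (k y)) * ennreal (sqrt (k y) * \<bar>g x y\<bar>) \<partial>lborel)"
      using k0 by (intro nn_integral_cong) (simp add: ennreal_mult[symmetric] abs_mult mult.assoc[symmetric])
    finally have "ennreal (norm (?h x)) ^ 2 \<le> (\<integral>\<^sup>+y. ennreal (sqrt (k y)) * ennreal (sqrt (k y) * \<bar>g x y\<bar>) \<partial>lborel) ^ 2"
      by (rule power_mono) simp
    also have "\<dots> \<le> (\<integral>\<^sup>+y. ennreal (sqrt (k y)) ^ 2 \<partial>lborel) * (\<integral>\<^sup>+y. ennreal (sqrt (k y) * \<bar>g x y\<bar>) ^ 2 \<partial>lborel)"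
      by (rule Cauchy_Schwarz_nn_integral) auto
    also have "\<dots> = (\<integral>\<^sup>+y. ennreal (k y * (g x y)\<^sup>2) \<partial>lborel)"
      using k0 by (simp add: ennreal_power power_mult_distrib kk)
    finally show ?thesis using k0 by (simp add: ennreal_power)
  qed
  have "(\<integral>\<^sup>+x. ennreal ((norm (?h x))\<^sup>2) \<partial>lborel) \<le> (\<integral>\<^sup>+x. \<integral>\<^sup>+y. ennreal (k y * (g x y)\<^sup>2) \<partial>lborel \<partial>lborel)"
    by (rule nn_integral_mono) (rule pt)
  also have "\<dots> = (\<integral>\<^sup>+y. \<integral>\<^sup>+x. ennreal (k y * (g x y)\<^sup>2) \<partial>lborel \<partial>lborel)"
    by (rule lborel_pair.Fubini'[symmetric]) (simp add: split_beta')
  also have "\<dots> \<le> (\<integral>\<^sup>+y. ennreal (k y) * ennreal B \<partial>lborel)"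
  proof (rule nn_integral_mono)
    fix y
    have "(\<lambda>x. g x y) \<in> borel_measurable borel"
      using measurable_compose[OF measurable_Pair2' g, of y] by simp
    then have "(\<integral>\<^sup>+x. ennreal (k y * (g x y)\<^sup>2) \<partial>lborel) = ennreal (k y) * (\<integral>\<^sup>+x. ennreal ((g x y)\<^sup>2) \<partial>lborel)"
      using k0 by (simp add: ennreal_mult nn_integral_cmult)
    also have "\<dots> \<le> ennreal (k y) * ennreal B"
      using B[of y] ke[of y] by (cases "norm y < e") (auto intro: mult_left_mono)
    finally show "(\<integral>\<^sup>+x. ennreal (k y * (g x y)\<^sup>2) \<partial>lborel) \<le> ennreal (k y) * ennreal B" .
  qed
  also have "\<dots> = ennreal B" using kk by (simp add: nn_integral_multc)
  finally have *: "(\<integral>\<^sup>+x. ennreal ((norm (?h x))\<^sup>2) \<partial>lborel) \<le> ennreal B" .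
  show "?h \<in> Lp 2" "nsq ?h \<le> B" using Lp2_nn_integral_le[OF hm * \<open>0 \<le> B\<close>] by auto
qed

lemma Lp2_locally_integrable:
  assumes "f \<in> Lp 2"
  shows "locally_integrable f"
proof (rule locally_integrableI)
  show [measurable]: "f \<in> borel_measurable borel" by (rule Lp2_measurable[OF assms])
  fix r
  have i: "integrable lborel (\<lambda>x. (norm (f x))\<^sup>2 + indicator (cball 0 r) x * 1)"
    by (intro Bochner_Integration.integrable_add Lp2_integrable[OF assms] integrable_indicator_cball)
  have "norm (f x) \<le> (norm (f x))\<^sup>2 + 1" for x
    using sum_squares_bound[of "norm (f x)" 1] norm_ge_zero[of "f x"] unfolding power_one mult_1_right by linarith
  then have le: "norm (indicator (cball 0 r) x *\<^sub>R f x) \<le> norm ((norm (f x))\<^sup>2 + indicator (cball 0 r) x * 1)" for x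
    by (simp add: indicator_def)
  have "(\<lambda>x. indicator (cball 0 r) x *\<^sub>R f x) \<in> borel_measurable lborel"
    using \<open>f \<in> borel_measurable borel\<close> unfolding measurable_lborel1
    by (intro borel_measurable_scaleR borel_measurable_indicator) simp_all
  then show "integrable lborel (\<lambda>x. indicator (cball 0 r) x *\<^sub>R f x)"
    by (rule Bochner_Integration.integrable_bound[OF i]) (rule AE_I2, rule le)
qed

lemma convol_L2:
  assumes "f \<in> Lp 2" "mollifier e k"
  shows "convol k f \<in> Lp 2" "nsq (convol k f) \<le> nsq f"
proof -
  have k: "k \<in> Cc_infinity" using assms(2) by (simp add: mollifier_def)
  have m [measurable]: "f \<in> borel_measurable borel" using assms(1) by (rule Lp2_measurable)
  have "(\<integral>\<^sup>+x. ennreal ((f (x - y))\<^sup>2) \<partial>lborel) \<le> ennreal (nsq f)" for y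
    using nn_integral_nsq[OF Lp2_translate_sign(1)[OF assms(1), of 1 "- y"]] Lp2_translate_sign(2)[OF assms(1), of 1 "- y"]
    by simp
  moreover have "(\<lambda>(x, y). f (x - y)) \<in> borel_measurable (borel \<Otimes>\<^sub>M borel)" by measurable
  ultimately have "(\<lambda>x. LINT y|lborel. k y * f (x - y)) \<in> Lp 2 \<and> nsq (\<lambda>x. LINT y|lborel. k y * f (x - y)) \<le> nsq f"
    using kernel_average_nsq[OF assms(2), of "\<lambda>x y. f (x - y)" "nsq f"] by auto
  moreover have "convol k f = (\<lambda>x. LINT y|lborel. k y * f (x - y))"
    by (rule ext) (rule convol_commuted[OF m k])
  ultimately show "convol k f \<in> Lp 2" "nsq (convol k f) \<le> nsq f" by simp_all
qed

text \<open>Unlike plain L2 convergence of mollifications, this rate depends on \<open>u\<close>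
  only through its gradient norm; the compactness theorem relies on this uniformity.\<close>

lemma nsq_convol_diff_Cc:
  assumes "u \<in> Cc_infinity" "mollifier e k"
  shows "nsq (\<lambda>x. convol k u x - u x) \<le> e\<^sup>2 * nsq (grad u)"
proof -
  have m [measurable]: "u \<in> borel_measurable borel" using assms by (auto intro: smooth_borel)
  have "(\<integral>\<^sup>+x. ennreal ((u (x - y) - u x)\<^sup>2) \<partial>lborel) \<le> ennreal (e\<^sup>2 * nsq (grad u))" if "norm y < e" for y
  proof -
    have "(\<lambda>x. u (x - y) - u x) \<in> Lp 2"
      using Lp2_diff[OF Lp2_translate_sign(1)[OF Cc_Lp2[OF assms(1)], of 1 "- y"] Cc_Lp2[OF assms(1)]] by simp
    from nn_integral_nsq[OF this] have "(\<integral>\<^sup>+x. ennreal ((u (x - y) - u x)\<^sup>2) \<partial>lborel) = ennreal (nsq (\<lambda>x. u (x + - y) - u x))"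
      by simp
    also have "\<dots> \<le> ennreal ((norm (- y))\<^sup>2 * nsq (grad u))"
      by (intro ennreal_leI nsq_translate_le assms)
    also have "\<dots> \<le> ennreal (e\<^sup>2 * nsq (grad u))"
      using that by (intro ennreal_leI mult_right_mono power_mono) auto
    finally show ?thesis .
  qed
  moreover have "(\<lambda>(x, y). u (x - y) - u x) \<in> borel_measurable (borel \<Otimes>\<^sub>M borel)" by measurable
  ultimately have "nsq (\<lambda>x. LINT y|lborel. k y * (u (x - y) - u x)) \<le> e\<^sup>2 * nsq (grad u)"
    by (intro kernel_average_nsq(2)[OF assms(2)]) auto
  then show ?thesis
    by (simp add: convol_mollifier_minus[OF Lp2_locally_integrable[OF Cc_Lp2[OF assms(1)]] assms(2)])
qed

section \<open>Density of continuous functions and L2 convergence of mollifications\<close>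

lemma bounded_continuous_approx:
  fixes f :: "real^'n::finite \<Rightarrow> real"
  assumes f: "f \<in> borel_measurable borel" and M: "\<And>x. \<bar>f x\<bar> \<le> M" and r: "\<And>x. norm x \<ge> r \<Longrightarrow> f x = 0"
  obtains g :: "nat \<Rightarrow> real^'n \<Rightarrow> real" where "\<And>n. continuous_on UNIV (g n)" "\<And>n x. \<bar>g n x\<bar> \<le> M"
    "\<And>n x. norm x \<ge> r + 1 \<Longrightarrow> g n x = 0" "AE x in lborel. (\<lambda>n. g n x) \<longlonglongrightarrow> f x"
proof -
  have "f measurable_on UNIV"
    by (rule lebesgue_measurable_imp_measurable_on) (use f in \<open>simp_all add: measurable_completion\<close>)
  then obtain N g where N: "negligible N" and g: "\<And>n. continuous_on UNIV (g n)"
    and lim: "\<And>x. x \<notin> N \<Longrightarrow> (\<lambda>n. g n x) \<longlonglongrightarrow> f x"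
    unfolding measurable_on_def by auto
  have "M \<ge> 0" using M[of 0] by simp
  \<comment> \<open>The first factor clamps the approximant to \<open>[-M, M]\<close>; the second is
    a continuous cutoff equal to 1 up to radius \<open>r\<close> and to 0 from radius
    \<open>r + 1\<close> on. Neither changes the limit, since \<open>f\<close> already obeys both
    restrictions.\<close>
  define h where "h n x = max (- M) (min M (g n x)) * max 0 (min 1 (r + 1 - norm x))" for n x
  show ?thesis
  proof (rule that)
    show "continuous_on UNIV (h n)" for n
      unfolding h_def by (intro continuous_intros g)
    show "\<bar>h n x\<bar> \<le> M" for n x
    proof -
      have "\<bar>h n x\<bar> \<le> M * 1"
        unfolding h_def abs_mult using \<open>M \<ge> 0\<close> by (intro mult_mono) auto
      then show ?thesis by simp
    qed
    show "h n x = 0" if "norm x \<ge> r + 1" for n x using that by (simp add: h_def)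
    have "AE x in lebesgue. x \<notin> N"
      using N by (intro AE_not_in) (simp add: negligible_iff_null_sets)
    then have "AE x in lborel. x \<notin> N" by (simp add: AE_completion_iff)
    then show "AE x in lborel. (\<lambda>n. h n x) \<longlonglongrightarrow> f x"
    proof eventually_elim
      case (elim x)
      have "(\<lambda>n. h n x) \<longlonglongrightarrow> max (- M) (min M (f x)) * max 0 (min 1 (r + 1 - norm x))"
        unfolding h_def by (intro tendsto_intros lim elim)
      also have "max (- M) (min M (f x)) = f x" using M[of x] by (auto simp: abs_le_iff)
      also have "f x * max 0 (min 1 (r + 1 - norm x)) = f x" using r[of x] by (cases "norm x \<ge> r") auto
      finally show ?case .
    qed
  qed
qed

lemma L2_dense_continuous:
  fixes f :: "real^'n::finite \<Rightarrow> real"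
  assumes f: "f \<in> Lp 2" and "e > 0"
  obtains g r where "continuous_on UNIV g" "\<And>x. norm x \<ge> r \<Longrightarrow> g x = 0" "nsq (\<lambda>x. f x - g x) < e"
proof -
  have fm [measurable]: "f \<in> borel_measurable borel" by (rule Lp2_measurable[OF f])
  define F where "F k x = (if \<bar>f x\<bar> \<le> real k \<and> norm x < real k then f x else 0)" for k x
  have Fm [measurable]: "F k \<in> borel_measurable borel" for k unfolding F_def by measurable
  have "(\<lambda>k. LINT x|lborel. (f x - F k x)\<^sup>2) \<longlonglongrightarrow> (LINT x|(lborel :: (real^'n) measure). 0)"
  proof (rule integral_dominated_convergence[where w = "\<lambda>x. (norm (f x))\<^sup>2"])
    show "AE x in lborel. (\<lambda>k. (f x - F k x)\<^sup>2) \<longlonglongrightarrow> 0"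
    proof (rule AE_I2)
      fix x
      obtain K :: nat where K: "real K > max \<bar>f x\<bar> (norm x)" using reals_Archimedean2 by blast
      have "\<forall>\<^sub>F k in sequentially. (f x - F k x)\<^sup>2 = 0"
        using eventually_ge_at_top[of K] by eventually_elim (use K in \<open>auto simp: F_def\<close>)
      then show "(\<lambda>k. (f x - F k x)\<^sup>2) \<longlonglongrightarrow> 0" by (rule tendsto_eventually)
    qed
  qed (use Lp2_integrable[OF f] in \<open>auto simp: F_def\<close>)
  then have "(\<lambda>k. nsq (\<lambda>x. f x - F k x)) \<longlonglongrightarrow> 0" by (simp add: nsq_def)
  \<comment> \<open>Two errors of \<open>e / 4\<close>, each doubled by \<open>nsq_diff_le\<close>,
    stay below \<open>e\<close>.\<close>
  from order_tendstoD(2)[OF this, of "e / 4"] \<open>e > 0\<close> obtain k where k: "nsq (\<lambda>x. f x - F k x) < e / 4"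
    by (auto simp: eventually_sequentially)
  have Fk: "\<bar>F k x\<bar> \<le> real k" "norm x \<ge> real k \<Longrightarrow> F k x = 0" for x by (auto simp: F_def)
  obtain g where g: "\<And>n. continuous_on UNIV (g n)" "\<And>n x. \<bar>g n x\<bar> \<le> real k"
    "\<And>n x. norm x \<ge> real k + 1 \<Longrightarrow> g n x = 0" "AE x in lborel. (\<lambda>n. g n x) \<longlonglongrightarrow> F k x"
    using bounded_continuous_approx[where r = "real k", OF Fm Fk] by blast
  have gm [measurable]: "g n \<in> borel_measurable borel" for n by (rule borel_measurable_continuous_onI[OF g(1)])
  have "(\<lambda>n. LINT x|lborel. (F k x - g n x)\<^sup>2) \<longlonglongrightarrow> (LINT x|(lborel :: (real^'n) measure). 0)"
  proof (rule integral_dominated_convergence[where w = "\<lambda>x. indicator (cball 0 (real k + 1)) x * (2 * real k)\<^sup>2"])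
    show "AE x in lborel. (\<lambda>n. (F k x - g n x)\<^sup>2) \<longlonglongrightarrow> 0"
      using g(4)
    proof eventually_elim
      case (elim x)
      have "(\<lambda>n. (F k x - g n x)\<^sup>2) \<longlonglongrightarrow> (F k x - F k x)\<^sup>2" by (intro tendsto_intros elim)
      then show ?case by simp
    qed
    show "AE x in lborel. norm ((F k x - g n x)\<^sup>2) \<le> indicator (cball 0 (real k + 1)) x * (2 * real k)\<^sup>2" for n
    proof (rule AE_I2)
      fix x
      have "\<bar>F k x - g n x\<bar> \<le> 2 * real k" using g(2)[of n x] abs_triangle_ineq4[of "F k x" "g n x"]
        by (auto simp: F_def split: if_splits)
      then have "(F k x - g n x)\<^sup>2 \<le> (2 * real k)\<^sup>2" using abs_le_square_iff[of "F k x - g n x" "2 * real k"] by simp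
      moreover have "F k x - g n x = 0" if "x \<notin> cball 0 (real k + 1)"
        using that g(3)[of x n] by (auto simp: F_def)
      ultimately show "norm ((F k x - g n x)\<^sup>2) \<le> indicator (cball 0 (real k + 1)) x * (2 * real k)\<^sup>2"
        by (cases "x \<in> cball 0 (real k + 1)") auto
    qed
    show "integrable lborel (\<lambda>x::real^'n. indicator (cball 0 (real k + 1)) x * (2 * real k)\<^sup>2)"
      by (rule integrable_indicator_cball)
  qed auto
  then have "(\<lambda>n. nsq (\<lambda>x. F k x - g n x)) \<longlonglongrightarrow> 0" by (simp add: nsq_def)
  from order_tendstoD(2)[OF this, of "e / 4"] \<open>e > 0\<close> obtain n where n: "nsq (\<lambda>x. F k x - g n x) < e / 4"
    by (auto simp: eventually_sequentially)
  have gL: "g n \<in> Lp 2" by (rule continuous_Lp2[OF g(1) g(3)])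
  have FL: "F k \<in> Lp 2"
  proof -
    have "integrable lborel (\<lambda>x. (norm (F k x))\<^sup>2)"
      by (rule Bochner_Integration.integrable_bound[OF Lp2_integrable[OF f]]) (auto simp: F_def)
    then show ?thesis by (simp add: Lp_def)
  qed
  have "nsq (\<lambda>x. f x - g n x) < e"
    using nsq_diff_le[OF f gL FL] k n by linarith
  with g(1,3) show ?thesis by (intro that[of "g n" "real k + 1"]) auto
qed

lemma convol_uniform_continuous:
  fixes g :: "real^'n::finite \<Rightarrow> real"
  assumes g: "continuous_on UNIV g" "\<And>x. norm x \<ge> r \<Longrightarrow> g x = 0" and "d > 0"
  obtains e where "e > 0" "e \<le> 1"
    "\<And>e' k x. mollifier e' k \<Longrightarrow> e' \<le> e \<Longrightarrow> \<bar>convol k g x - g x\<bar> \<le> indicator (cball 0 (r + 1)) x * d"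
proof -
  have gL: "locally_integrable g" by (rule Lp2_locally_integrable[OF continuous_Lp2[OF g]])
  have "uniformly_continuous_on UNIV g" by (rule continuous_bounded_support(3)[OF g])
  then obtain e where e: "e > 0" "\<And>x y. dist y x < e \<Longrightarrow> dist (g y) (g x) < d"
    using uniformly_continuous_onE_UNIV[OF _ \<open>d > 0\<close>, of g] by metis
  show ?thesis
  proof (rule that[of "min e 1"])
    fix e' :: real and k :: "real^'n \<Rightarrow> real" and x assume k: "mollifier e' k" and e': "e' \<le> min e 1"
    have "\<bar>g (x - y) - g x\<bar> \<le> d" if "norm y < e'" for y
    proof -
      have "dist (x - y) x < e" using that e' by (simp add: dist_norm)
      from e(2)[OF this] show ?thesis by (simp add: dist_norm)
    qed
    then have "\<bar>convol k g x - g x\<bar> \<le> d" by (rule convol_uniform[OF gL k])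
    moreover have "convol k g x - g x = 0" if "norm x > r + 1"
      using Cc_convol(2)[where r = r and x = x, OF gL k g(2)] g(2)[of x] that e' by simp
    ultimately show "\<bar>convol k g x - g x\<bar> \<le> indicator (cball 0 (r + 1)) x * d"
      by (cases "norm x > r + 1") auto
  qed (use e in auto)
qed

lemma convol_diff:
  assumes "locally_integrable f" "locally_integrable g" "k \<in> Cc_infinity"
  shows "convol k (\<lambda>x. f x - g x) x = convol k f x - convol k g x"
  using convol_integrable[OF assms(1,3), of x] convol_integrable[OF assms(2,3), of x]
  by (simp add: convol_def right_diff_distrib)

text \<open>A density argument: mollification converges uniformly on a compactly supported
  continuous \<open>g\<close>, and being a contraction it does not enlarge the distance from
  \<open>f\<close> to \<open>g\<close>.\<close>

lemma mollify_L2: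
  fixes f :: "real^'n::finite \<Rightarrow> real"
  assumes f: "f \<in> Lp 2" and "d > 0"
  obtains e where "e > 0" "\<And>e' k. mollifier e' k \<Longrightarrow> e' \<le> e \<Longrightarrow> nsq (\<lambda>x. convol k f x - f x) < d"
proof -
  \<comment> \<open>Two applications of \<open>nsq_diff_le\<close> weight the three errors by 2, 4
    and 4, so with \<open>d / 16\<close> each they total 10 sixteenths of \<open>d\<close>.\<close>
  obtain g r where g: "continuous_on UNIV g" "\<And>x. norm x \<ge> r \<Longrightarrow> g x = 0" and fg: "nsq (\<lambda>x. f x - g x) < d / 16"
    using L2_dense_continuous[OF f, of "d / 16"] \<open>d > 0\<close> by auto
  have gL: "g \<in> Lp 2" by (rule continuous_Lp2[where r = r, OF g])
  let ?B = "cball 0 (r + 1) :: (real^'n) set"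
  define V where "V = measure lborel ?B"
  have V: "V \<ge> 0" by (simp add: V_def)
  define s where "s = sqrt (d / (16 * (V + 1)))"
  have s: "s > 0" "s\<^sup>2 * (V + 1) = d / 16"
    using \<open>d > 0\<close> V by (auto simp: s_def field_simps)
  obtain e where e: "e > 0" "e \<le> 1"
    "\<And>e' k x. mollifier e' k \<Longrightarrow> e' \<le> e \<Longrightarrow> \<bar>convol k g x - g x\<bar> \<le> indicator ?B x * s"
    using convol_uniform_continuous[OF g s(1)] by blast
  show ?thesis
  proof (rule that[OF e(1)])
    fix e' :: real and k :: "real^'n \<Rightarrow> real" assume k: "mollifier e' k" and "e' \<le> e"
    then have kC: "k \<in> Cc_infinity" by (simp add: mollifier_def)
    note L = convol_L2(1)[OF f k] convol_L2(1)[OF gL k]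
    have sq: "(norm (convol k g x - g x))\<^sup>2 \<le> indicator ?B x * s\<^sup>2" for x
      using e(3)[OF k \<open>e' \<le> e\<close>, of x] power_mono[of "\<bar>convol k g x - g x\<bar>" s 2] by (cases "x \<in> ?B") auto
    have "nsq (\<lambda>x. convol k g x - g x) \<le> (LINT x|lborel. indicator ?B x * s\<^sup>2)"
      unfolding nsq_def
      by (intro integral_mono Lp2_integrable[OF Lp2_diff[OF L(2) gL]] integrable_indicator_cball sq)
    also have "\<dots> = s\<^sup>2 * V" by (simp add: V_def mult.commute)
    also have "s\<^sup>2 * V = d / 16 - s\<^sup>2" using s(2) by (simp add: distrib_left)
    also have "\<dots> \<le> d / 16" by simp
    finally have 1: "nsq (\<lambda>x. convol k g x - g x) \<le> d / 16" .
    have "nsq (\<lambda>x. convol k f x - convol k g x) = nsq (convol k (\<lambda>x. f x - g x))"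
      by (simp add: convol_diff[OF Lp2_locally_integrable[OF f] Lp2_locally_integrable[OF gL] kC, symmetric])
    also have "\<dots> \<le> nsq (\<lambda>x. f x - g x)" by (rule convol_L2(2)[OF Lp2_diff[OF f gL] k])
    finally have 2: "nsq (\<lambda>x. convol k f x - convol k g x) \<le> d / 16" using fg by simp
    have 3: "nsq (\<lambda>x. g x - f x) \<le> d / 16" using fg nsq_minus_commute[of g f] by simp
    show "nsq (\<lambda>x. convol k f x - f x) < d"
      using nsq_diff_le[OF L(1) f L(2)] nsq_diff_le[OF L(2) f gL] 1 2 3 \<open>d > 0\<close> by linarith
  qed
qed

section \<open>Uniqueness of weak gradients\<close>

lemma du_Bois_Reymond:
  fixes u :: "real^'n::finite \<Rightarrow> real"
  assumes moll: "\<And>e. e > 0 \<Longrightarrow> \<exists>k::real^'n \<Rightarrow> real. mollifier e k"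
    and u: "locally_integrable u" and 0: "\<And>\<eta>. \<eta> \<in> Cc_infinity \<Longrightarrow> (LINT x|lborel. u x * \<eta> x) = 0"
  shows "AE x in lborel. u x = 0"
proof -
  have um [measurable]: "u \<in> borel_measurable borel" by (rule locally_integrable_measurable[OF u])
  \<comment> \<open>\<open>u\<close> is only locally integrable, so \<open>g\<close> must be
    approximated uniformly with supports in a fixed ball, which mollification achieves; L2
    approximation of \<open>g\<close> would not suffice.\<close>
  have cont: "(LINT x|lborel. g x * u x) = 0"
    if g: "continuous_on UNIV g" "\<And>x. norm x \<ge> r \<Longrightarrow> g x = 0" for g r
  proof -
    let ?B = "cball 0 (r + 2) :: (real^'n) set"
    define I where "I = (LINT x|lborel. indicator ?B x * \<bar>u x\<bar>)"
    have I: "I \<ge> 0" unfolding I_def by (rule integral_nonneg_AE) simp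
    have gL: "locally_integrable g" by (rule Lp2_locally_integrable[OF continuous_Lp2[OF g]])
    have gm: "g \<in> borel_measurable borel" by (rule borel_measurable_continuous_onI[OF g(1)])
    obtain M where M: "\<And>x. \<bar>g x\<bar> \<le> M" using continuous_bounded_support(1)[OF g] by auto
    have gi: "integrable lborel (\<lambda>x. g x * u x)"
      by (rule locally_integrable_bounded_mult(1)[where r = r, OF u gm M g(2)])
    have "\<bar>LINT x|lborel. g x * u x\<bar> \<le> d" if "d > 0" for d
    proof -
      define s where "s = d / (I + 1)"
      have s: "s > 0" "s * I \<le> d" using \<open>d > 0\<close> I by (auto simp: s_def field_simps)
      obtain e where e: "e > 0" "e \<le> 1"
        "\<And>e' k x. mollifier e' k \<Longrightarrow> e' \<le> e \<Longrightarrow> \<bar>convol k g x - g x\<bar> \<le> indicator (cball 0 (r + 1)) x * s"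
        using convol_uniform_continuous[OF g s(1)] by blast
      obtain k :: "real^'n \<Rightarrow> real" where k: "mollifier e k" using moll[OF e(1)] by blast
      have c: "convol k g \<in> Cc_infinity" by (rule Cc_convol(1)[where r = r, OF gL k g(2)])
      have le: "\<bar>convol k g x - g x\<bar> \<le> s" "norm x \<ge> r + 2 \<Longrightarrow> convol k g x - g x = 0" for x
        using e(3)[OF k order_refl, of x] s(1) by (cases "norm x \<le> r + 1"; simp)+
      have "\<bar>LINT x|lborel. (convol k g x - g x) * u x\<bar> \<le> s * I"
        unfolding I_def
        by (rule locally_integrable_bounded_mult(2)[OF u _ le]) (use gm smooth_borel[OF Cc_smooth[OF c]] in simp_all)
      moreover have "(LINT x|lborel. (convol k g x - g x) * u x) = - (LINT x|lborel. g x * u x)"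
        using gi Cc_mult_integrable[OF u c] 0[OF c] by (simp add: left_diff_distrib mult.commute[of "u _"])
      ultimately show ?thesis using s(2) by simp
    qed
    from field_le_epsilon[of "\<bar>LINT x|lborel. g x * u x\<bar>" 0] this show ?thesis by simp
  qed
  have "AE x in lborel. x \<in> ball 0 r \<longrightarrow> u x = 0" for r
  proof -
    \<comment> \<open>Pairing with this multiplier produces the integral of
      \<open>\<bar>u\<bar>\<close> over the ball; bounded continuous approximants transfer the
      vanishing of the pairing to it.\<close>
    define f where "f x = sgn (u x) * indicator (ball 0 r) x" for x
    have fm: "f \<in> borel_measurable borel" unfolding f_def
      by (intro borel_measurable_times borel_measurable_indicator borel_measurable_sgn) simp_all
    have f1: "\<bar>f x\<bar> \<le> 1" "norm x \<ge> r \<Longrightarrow> f x = 0" for x by (auto simp: f_def indicator_def sgn_if)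
    obtain g where g: "\<And>n. continuous_on UNIV (g n)" "\<And>n x. \<bar>g n x\<bar> \<le> 1"
      "\<And>n x. norm x \<ge> r + 1 \<Longrightarrow> g n x = 0" "AE x in lborel. (\<lambda>n. g n x) \<longlonglongrightarrow> f x"
      using bounded_continuous_approx[where r = r, OF fm f1] by blast
    have gm [measurable]: "g n \<in> borel_measurable borel" for n by (rule borel_measurable_continuous_onI[OF g(1)])
    have int: "integrable lborel (\<lambda>x. f x * u x)"
      by (rule locally_integrable_bounded_mult(1)[where r = r, OF u fm f1])
    have "(\<lambda>n. LINT x|lborel. g n x * u x) \<longlonglongrightarrow> (LINT x|lborel. f x * u x)"
    proof (rule integral_dominated_convergence[where w = "\<lambda>x. \<bar>indicator (cball 0 (r + 1)) x *\<^sub>R u x\<bar>"])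
      show "AE x in lborel. (\<lambda>n. g n x * u x) \<longlonglongrightarrow> f x * u x"
        using g(4) by eventually_elim (intro tendsto_intros)
      show "integrable lborel (\<lambda>x. \<bar>indicator (cball 0 (r + 1)) x *\<^sub>R u x\<bar>)"
        by (intro integrable_abs locally_integrable_cball[OF u])
      show "AE x in lborel. norm (g n x * u x) \<le> \<bar>indicator (cball 0 (r + 1)) x *\<^sub>R u x\<bar>" for n
      proof (rule AE_I2)
        fix x
        show "norm (g n x * u x) \<le> \<bar>indicator (cball 0 (r + 1)) x *\<^sub>R u x\<bar>"
          using g(2)[of n x] g(3)[of x n] by (cases "norm x \<ge> r + 1") (auto simp: abs_mult mult_left_le_one_le)
      qed
    qed (use fm in auto)
    then have "(LINT x|lborel. f x * u x) = 0"
      using cont[OF g(1) g(3)] by (simp add: LIMSEQ_const_iff)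
    moreover have nn: "0 \<le> f x * u x" for x by (auto simp: f_def indicator_def sgn_if)
    ultimately have "AE x in lborel. f x * u x = 0"
      using integral_nonneg_eq_0_iff_AE[OF int] by simp
    then show ?thesis by eventually_elim (auto simp: f_def indicator_def sgn_if split: if_splits)
  qed
  then have "AE x in lborel. \<forall>n::nat. x \<in> ball 0 (real n) \<longrightarrow> u x = 0"
    unfolding AE_all_countable by blast
  then show ?thesis
  proof eventually_elim
    case (elim x)
    obtain n :: nat where "norm x < real n" using reals_Archimedean2 by blast
    then show ?case using elim by auto
  qed
qed

lemma has_weak_gradient_unique:
  fixes u :: "real^'n::finite \<Rightarrow> real"
  assumes moll: "\<And>e. e > 0 \<Longrightarrow> \<exists>k::real^'n \<Rightarrow> real. mollifier e k"
    and G: "has_weak_gradient u G" and H: "has_weak_gradient u H"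
  shows "AE x in lborel. G x = H x"
proof -
  have "AE x in lborel. G x $ i - H x $ i = 0" for i
  proof (rule du_Bois_Reymond[OF moll])
    note L = has_weak_gradient_nth[OF G, of i] has_weak_gradient_nth[OF H, of i]
    show "locally_integrable (\<lambda>x. G x $ i - H x $ i)"
    proof (rule locally_integrableI)
      show "integrable lborel (\<lambda>x. indicator (cball 0 r) x *\<^sub>R (G x $ i - H x $ i))" for r
        unfolding scaleR_diff_right by (intro Bochner_Integration.integrable_diff locally_integrable_cball L)
    qed (intro borel_measurable_diff locally_integrable_measurable L)
    fix \<eta> :: "real^'n \<Rightarrow> real" assume \<eta>: "\<eta> \<in> Cc_infinity"
    have "integrable lborel (\<lambda>x. G x $ i * \<eta> x)" "integrable lborel (\<lambda>x. H x $ i * \<eta> x)"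
      using Cc_mult_integrable[OF L(1) \<eta>] Cc_mult_integrable[OF L(2) \<eta>] by (simp_all add: mult.commute)
    moreover have "(LINT x|lborel. G x $ i * \<eta> x) = (LINT x|lborel. H x $ i * \<eta> x)"
    proof -
      have "(LINT x|lborel. u x * partial_deriv i \<eta> x) = - (LINT x|lborel. G x $ i * \<eta> x)"
        "(LINT x|lborel. u x * partial_deriv i \<eta> x) = - (LINT x|lborel. H x $ i * \<eta> x)"
        using G H \<eta> by (auto simp: has_weak_gradient_def)
      then show ?thesis by simp
    qed
    ultimately show "(LINT x|lborel. (G x $ i - H x $ i) * \<eta> x) = 0"
      by (simp add: left_diff_distrib)
  qed
  then have "AE x in lborel. \<forall>i. G x $ i - H x $ i = 0"
    by (subst AE_all_countable) simp
  then show ?thesis by eventually_elim (simp add: vec_eq_iff)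
qed

text \<open>\<open>weak_gradient\<close> is an arbitrary choice; uniqueness almost everywhere makes
  the norm computable from any weak gradient at hand.\<close>

lemma H1_dot_norm_eq:
  assumes moll: "\<And>e. e > 0 \<Longrightarrow> \<exists>k::real^3 \<Rightarrow> real. mollifier e k"
    and G: "has_weak_gradient u G"
  shows "(H1_dot_norm u)\<^sup>2 = nsq G"
proof -
  have W: "has_weak_gradient u (weak_gradient u)"
    unfolding weak_gradient_def by (rule someI[where P = "has_weak_gradient u", OF G])
  have [measurable]: "G \<in> borel_measurable borel" "weak_gradient u \<in> borel_measurable borel"
    using G W by (auto simp: has_weak_gradient_def intro: locally_integrable_measurable)
  have "(LINT x|lborel. (norm (weak_gradient u x))\<^sup>2) = nsq G"
    unfolding nsq_def using has_weak_gradient_unique[OF moll W G]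
    by (intro integral_cong_AE) (auto elim: eventually_mono)
  then show ?thesis by (simp add: H1_dot_norm_def)
qed

subsection \<open>Density of test functions\<close>

text \<open>Every mollifier and every cutoff below is a rescaling of one fixed nonzero test function.\<close>

locale bump =
  fixes b :: "real^'n::finite \<Rightarrow> real" and x0 :: "real^'n"
  assumes b_Cc: "b \<in> Cc_infinity" and b_nonneg: "\<And>x. 0 \<le> b x" and b_x0: "b x0 \<noteq> 0"
begin

text \<open>The bump is recentred at \<open>x0\<close> and compressed by the factor
  \<open>s\<close>, then divided by its integral. That integral is positive because a nonempty open
  set is never null.\<close>

lemma mollifier_exists:
  assumes "e > 0"
  shows "\<exists>k::real^'n \<Rightarrow> real. mollifier e k"
proof -
  obtain r where r: "r > 0" "\<And>x. norm x \<ge> r \<Longrightarrow> b x = 0" using Cc_support[OF b_Cc] by blast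
  \<comment> \<open>For \<open>norm x \<ge> e\<close> this gives
    \<open>norm (s *\<^sub>R x) \<ge> r + norm x0\<close>, hence an argument of \<open>b\<close> of
    norm at least \<open>r\<close>.\<close>
  define s where "s = (r + norm x0) / e"
  have "r + norm x0 > 0" using r(1) norm_ge_zero[of x0] by linarith
  then have s: "s > 0" "s * e = r + norm x0" using assms by (auto simp: s_def)
  define h where "h x = b (x0 + s *\<^sub>R x)" for x
  have h: "h \<in> Cc_infinity" unfolding h_def using Cc_affine[OF b_Cc, of s x0] s by simp
  have supp: "h x = 0" if "norm x \<ge> e" for x
  proof -
    have "norm (s *\<^sub>R x) \<ge> r + norm x0" using s that mult_left_mono[OF that, of s] by simp
    moreover have "norm (s *\<^sub>R x) \<le> norm (x0 + s *\<^sub>R x) + norm x0"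
      using norm_triangle_ineq4[of "x0 + s *\<^sub>R x" x0] by simp
    ultimately show ?thesis using r(2) by (simp add: h_def)
  qed
  define c where "c = (LINT x|lborel. h x)"
  have c: "c > 0"
  proof (rule ccontr)
    assume "\<not> c > 0"
    moreover have "c \<ge> 0" unfolding c_def by (rule integral_nonneg_AE) (simp add: h_def b_nonneg)
    ultimately have "c = 0" by simp
    then have ae: "AE x in lborel. h x = 0"
      unfolding c_def using integral_nonneg_eq_0_iff_AE[OF Cc_integrable[OF h]] by (simp add: h_def b_nonneg)
    have cont: "continuous_on UNIV h" using h by (auto intro: smooth_continuous)
    have op: "open {x. h x \<noteq> 0}"
      using open_Collect_neq[of h "\<lambda>_. 0"] cont by simp
    have "{x. h x \<noteq> 0} \<in> null_sets lborel"
      using ae op AE_iff_null_sets[of "{x. h x \<noteq> 0}" lborel] by (simp add: borel_open)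
    then have "negligible {x. h x \<noteq> 0}" by (simp add: negligible_iff_null_sets null_sets_completionI)
    moreover have "0 \<in> {x. h x \<noteq> 0}" by (simp add: h_def b_x0)
    ultimately show False using open_not_negligible[OF op] by blast
  qed
  have "mollifier e (\<lambda>x. (1 / c) * h x)"
    unfolding mollifier_def
    using Cc_cmul[OF h, of "1 / c"] c supp c_def by (auto simp: h_def b_nonneg)
  then show ?thesis by blast
qed

text \<open>Dividing by \<open>b x0\<close> normalises the value at the origin to 1, and dilation
  spreads it over space. \<open>b\<close> need not be largest at \<open>x0\<close>, so values above
  1 occur, which is why later bounds carry a constant \<open>C\<close>.\<close>

definition cutoff :: "nat \<Rightarrow> real^'n \<Rightarrow> real" where
  "cutoff n x = b (x0 + (1 / real (Suc n)) *\<^sub>R x) / b x0"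

lemma cutoff_Cc: "cutoff n \<in> Cc_infinity"
proof -
  have "(\<lambda>x. (1 / b x0) * b (x0 + (1 / real (Suc n)) *\<^sub>R x)) \<in> Cc_infinity"
    by (intro Cc_cmul Cc_affine b_Cc) simp
  then show ?thesis by (simp add: cutoff_def[abs_def])
qed

lemma cutoff_tendsto: "(\<lambda>n. cutoff n x) \<longlonglongrightarrow> 1"
proof -
  have "isCont b x0" using smooth_continuous[OF Cc_smooth[OF b_Cc]] by (simp add: continuous_on_eq_continuous_at)
  moreover have "(\<lambda>n. x0 + (1 / real (Suc n)) *\<^sub>R x) \<longlonglongrightarrow> x0 + 0 *\<^sub>R x"
    using LIMSEQ_inverse_real_of_nat by (intro tendsto_intros) (simp add: inverse_eq_divide)
  ultimately have "(\<lambda>n. b (x0 + (1 / real (Suc n)) *\<^sub>R x)) \<longlonglongrightarrow> b x0"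
    by (intro isCont_tendsto_compose[of x0 b]) auto
  then have "(\<lambda>n. b (x0 + (1 / real (Suc n)) *\<^sub>R x) / b x0) \<longlonglongrightarrow> b x0 / b x0"
    by (intro tendsto_intros) (auto simp: b_x0)
  then show ?thesis using b_x0 by (simp add: cutoff_def)
qed

lemma cutoff_bounds:
  obtains C where "C > 0" "\<And>n x. \<bar>cutoff n x\<bar> \<le> C" "\<And>n x. norm (grad (cutoff n) x) \<le> C / real (Suc n)"
    "\<And>n x. norm x \<ge> C * real (Suc n) \<Longrightarrow> cutoff n x = 0"
    "\<And>n x. norm x > C * real (Suc n) \<Longrightarrow> grad (cutoff n) x = 0"
proof -
  have p: "b x0 > 0" using b_nonneg[of x0] b_x0 by linarith
  obtain r where r: "r > 0" "\<And>x. norm x \<ge> r \<Longrightarrow> b x = 0" using Cc_support[OF b_Cc] by blast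
  obtain M where M: "M > 0" "\<And>x. \<bar>b x\<bar> \<le> M" using Cc_bounded[OF b_Cc] by auto
  obtain L where L: "L > 0" "\<And>x. norm (grad b x) \<le> L" using Cc_grad_bounded[OF b_Cc] by auto
  \<comment> \<open>The sum of the three constants required separately for value, gradient and
    support, so that a single \<open>C\<close> serves for all.\<close>
  define C where "C = M / b x0 + L / b x0 + (r + norm x0)"
  have pos: "M / b x0 > 0" "L / b x0 > 0" "r + norm x0 > 0"
    using M(1) L(1) r(1) p by (auto intro: add_pos_nonneg)
  have g: "grad (cutoff n) x = (1 / b x0) *\<^sub>R (1 / real (Suc n)) *\<^sub>R grad b (x0 + (1 / real (Suc n)) *\<^sub>R x)" for n x
  proof -
    have "cutoff n = (\<lambda>x. (1 / b x0) * b (x0 + (1 / real (Suc n)) *\<^sub>R x))" by (simp add: cutoff_def[abs_def])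
    then show ?thesis
      using grad_cmul[OF smooth_affine[OF Cc_smooth[OF b_Cc]]] grad_affine[OF Cc_smooth[OF b_Cc]] by metis
  qed
  have supp: "cutoff n x = 0" if "norm x \<ge> C * real (Suc n)" for n x
  proof -
    have "(r + norm x0) * real (Suc n) \<le> C * real (Suc n)" using pos by (intro mult_right_mono) (auto simp: C_def)
    then have "norm ((1 / real (Suc n)) *\<^sub>R x) \<ge> r + norm x0" using that by (simp add: field_simps del: of_nat_Suc)
    moreover have "norm ((1 / real (Suc n)) *\<^sub>R x) \<le> norm (x0 + (1 / real (Suc n)) *\<^sub>R x) + norm x0"
      using norm_triangle_ineq4[of "x0 + (1 / real (Suc n)) *\<^sub>R x" x0] by simp
    ultimately have "b (x0 + (1 / real (Suc n)) *\<^sub>R x) = 0" by (intro r(2)) linarith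
    then show ?thesis by (simp add: cutoff_def)
  qed
  show ?thesis
  proof (rule that)
    show "C > 0" unfolding C_def using pos by linarith
    show "\<bar>cutoff n x\<bar> \<le> C" for n x
    proof -
      have "\<bar>cutoff n x\<bar> \<le> M / b x0" using p M(2) by (auto simp: cutoff_def abs_divide intro!: divide_right_mono)
      then show ?thesis using pos unfolding C_def by linarith
    qed
    show "norm (grad (cutoff n) x) \<le> C / real (Suc n)" for n x
    proof -
      have "norm (grad (cutoff n) x) = (norm (grad b (x0 + (1 / real (Suc n)) *\<^sub>R x)) / b x0) / real (Suc n)"
        using p by (simp add: g del: of_nat_Suc)
      also have "\<dots> \<le> C / real (Suc n)"
      proof (rule divide_right_mono)
        have "norm (grad b (x0 + (1 / real (Suc n)) *\<^sub>R x)) / b x0 \<le> L / b x0"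
          using p L(2) by (intro divide_right_mono) auto
        then show "norm (grad b (x0 + (1 / real (Suc n)) *\<^sub>R x)) / b x0 \<le> C" using pos unfolding C_def by linarith
      qed simp
      finally show ?thesis .
    qed
    show "norm x \<ge> C * real (Suc n) \<Longrightarrow> cutoff n x = 0" for n x by (rule supp)
    show "norm x > C * real (Suc n) \<Longrightarrow> grad (cutoff n) x = 0" for n x
      using grad_support[of "C * real (Suc n)" "cutoff n" x] supp by blast
  qed
qed

end

text \<open>For a test function \<eta> the product of \<open>c\<close> and \<eta> is again one;
  inserting it into the definition for \<open>u\<close> and expanding its derivative yields the
  Leibniz rule.\<close>

lemma weak_gradient_mult:
  assumes u: "has_weak_gradient u G" and c: "c \<in> Cc_infinity"
  shows "has_weak_gradient (\<lambda>x. c x * u x) (\<lambda>x. c x *\<^sub>R G x + u x *\<^sub>R grad c x)"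
proof -
  have uL: "locally_integrable u" and GL: "locally_integrable G" using u by (auto simp: has_weak_gradient_def)
  note [measurable] = locally_integrable_measurable[OF uL] locally_integrable_measurable[OF GL]
  have [measurable]: "c \<in> borel_measurable borel" "grad c \<in> borel_measurable borel"
    using c by (auto intro: smooth_borel borel_measurable_continuous_onI continuous_on_grad)
  obtain M where M: "\<And>x. \<bar>c x\<bar> \<le> M" using Cc_bounded[OF c] by auto
  obtain L where L: "\<And>x. norm (grad c x) \<le> L" using Cc_grad_bounded[OF c] by auto
  have bd: "integrable lborel (\<lambda>x. c x *\<^sub>R F x)" if "locally_integrable F" for F :: "real^'a \<Rightarrow> real^'a"
  proof -
    obtain r where r: "\<And>x. norm x \<ge> r \<Longrightarrow> c x = 0" using Cc_support[OF c] by blast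
    note [measurable] = locally_integrable_measurable[OF that]
    show ?thesis
    proof (rule Bochner_Integration.integrable_bound)
      show "integrable lborel (\<lambda>x. M *\<^sub>R (indicator (cball 0 r) x *\<^sub>R F x))"
        by (intro integrable_scaleR_right locally_integrable_cball that)
      show "AE x in lborel. norm (c x *\<^sub>R F x) \<le> norm (M *\<^sub>R (indicator (cball 0 r) x *\<^sub>R F x))"
      proof (rule AE_I2)
        fix x
        show "norm (c x *\<^sub>R F x) \<le> norm (M *\<^sub>R (indicator (cball 0 r) x *\<^sub>R F x))"
          using M[of x] r[of x] by (cases "norm x \<ge> r") (auto intro!: mult_right_mono)
      qed
    qed simp
  qed
  have int1: "integrable lborel (\<lambda>x. c x * u x)" by (rule Cc_mult_integrable[OF uL c])
  have int2: "integrable lborel (\<lambda>x. u x *\<^sub>R grad c x)"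
  proof -
    obtain r where "r > 0" "\<And>x. norm x \<ge> r \<Longrightarrow> c x = 0" and r: "\<And>x. norm x \<ge> r \<Longrightarrow> grad c x = 0"
      using Cc_grad_support[OF c] by blast
    show ?thesis
    proof (rule Bochner_Integration.integrable_bound)
      show "integrable lborel (\<lambda>x. L *\<^sub>R (indicator (cball 0 r) x *\<^sub>R u x))"
        by (intro integrable_scaleR_right locally_integrable_cball uL)
      show "AE x in lborel. norm (u x *\<^sub>R grad c x) \<le> norm (L *\<^sub>R (indicator (cball 0 r) x *\<^sub>R u x))"
      proof (rule AE_I2)
        fix x
        have "L \<ge> 0" using L[of x] norm_ge_zero[of "grad c x"] by linarith
        then show "norm (u x *\<^sub>R grad c x) \<le> norm (L *\<^sub>R (indicator (cball 0 r) x *\<^sub>R u x))"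
          using mult_right_mono[OF L[of x], of "\<bar>u x\<bar>"] r[of x]
          by (cases "norm x \<ge> r") (simp_all add: mult.commute[of "\<bar>u x\<bar>"])
      qed
    qed simp
  qed
  have loc: "locally_integrable F" if "integrable lborel F" for F :: "real^'a \<Rightarrow> 'b::euclidean_space"
    using that by (intro locally_integrableI integrable_mult_indicator) auto
  have "(LINT x|lborel. (c x * u x) * partial_deriv i \<eta> x) =
      - (LINT x|lborel. (c x *\<^sub>R G x + u x *\<^sub>R grad c x) $ i * \<eta> x)" if \<eta>: "\<eta> \<in> Cc_infinity" for \<eta> i
  proof -
    have c\<eta>: "(\<lambda>x. c x * \<eta> x) \<in> Cc_infinity" using c \<eta> by auto
    have pd: "partial_deriv i (\<lambda>x. c x * \<eta> x) x = c x * partial_deriv i \<eta> x + partial_deriv i c x * \<eta> x" for x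
      using c \<eta> by (intro partial_deriv_mult smooth_differentiable) auto
    have eq: "(LINT x|lborel. u x * partial_deriv i (\<lambda>x. c x * \<eta> x) x) = - (LINT x|lborel. G x $ i * (c x * \<eta> x))"
      using u c\<eta> by (auto simp: has_weak_gradient_def)
    have C: "(\<lambda>x. c x * partial_deriv i \<eta> x) \<in> Cc_infinity" "(\<lambda>x. partial_deriv i c x * \<eta> x) \<in> Cc_infinity"
      using c \<eta> by auto
    note I = Cc_mult_integrable[OF uL C(1)] Cc_mult_integrable[OF uL C(2)] Cc_mult_integrable[OF has_weak_gradient_nth[OF u, of i] c\<eta>]
    have "(LINT x|lborel. (c x * u x) * partial_deriv i \<eta> x) = (LINT x|lborel. (c x * partial_deriv i \<eta> x) * u x)"
      by (intro Bochner_Integration.integral_cong) auto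
    also have "\<dots> = (LINT x|lborel. u x * partial_deriv i (\<lambda>x. c x * \<eta> x) x - (partial_deriv i c x * \<eta> x) * u x)"
      by (intro Bochner_Integration.integral_cong) (simp_all only: pd, simp_all add: algebra_simps)
    also have "\<dots> = (LINT x|lborel. u x * partial_deriv i (\<lambda>x. c x * \<eta> x) x) - (LINT x|lborel. (partial_deriv i c x * \<eta> x) * u x)"
    proof (rule Bochner_Integration.integral_diff)
      show "integrable lborel (\<lambda>x. u x * partial_deriv i (\<lambda>x. c x * \<eta> x) x)"
        using Bochner_Integration.integrable_add[OF I(1) I(2)] unfolding pd by (simp add: algebra_simps)
    qed (rule I(2))
    also have "\<dots> = - ((LINT x|lborel. (c x * \<eta> x) * G x $ i) + (LINT x|lborel. (partial_deriv i c x * \<eta> x) * u x))"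
      unfolding eq by (simp add: mult.commute)
    also have "\<dots> = - (LINT x|lborel. (c x * \<eta> x) * G x $ i + (partial_deriv i c x * \<eta> x) * u x)"
      using I(2,3) by simp
    also have "\<dots> = - (LINT x|lborel. (c x *\<^sub>R G x + u x *\<^sub>R grad c x) $ i * \<eta> x)"
      by (intro arg_cong[where f = uminus] Bochner_Integration.integral_cong) (auto simp: algebra_simps)
    finally show ?thesis .
  qed
  then show ?thesis
    unfolding has_weak_gradient_def
    using loc[OF int1] loc[OF Bochner_Integration.integrable_add[OF bd[OF GL] int2]] by simp
qed

lemma Lp2_nth:
  fixes H :: "real^'n::finite \<Rightarrow> real^'m::finite"
  assumes "H \<in> Lp 2" shows "(\<lambda>x. H x $ i) \<in> Lp 2"
proof -
  have [measurable]: "H \<in> borel_measurable borel" by (rule Lp2_measurable[OF assms])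
  have m: "(\<lambda>x. H x $ i) \<in> borel_measurable borel"
    by (rule borel_measurable_continuous_on[OF _ \<open>H \<in> borel_measurable borel\<close>, of "\<lambda>v. v $ i"]) (intro continuous_intros)
  have "integrable lborel (\<lambda>x. (norm (H x $ i))\<^sup>2)"
  proof (rule Bochner_Integration.integrable_bound[OF Lp2_integrable[OF assms]])
    show "AE x in lborel. norm ((norm (H x $ i))\<^sup>2) \<le> norm ((norm (H x))\<^sup>2)"
    proof (rule AE_I2)
      fix x
      have "(norm (H x $ i))\<^sup>2 \<le> (norm (H x))\<^sup>2"
        by (rule power_mono) (simp_all add: component_le_norm_cart)
      then show "norm ((norm (H x $ i))\<^sup>2) \<le> norm ((norm (H x))\<^sup>2)" by simp
    qed
  qed (use m in simp)
  then show ?thesis using m by (simp add: Lp_def)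
qed

lemma norm_sq_cart: "(norm x)\<^sup>2 = (\<Sum>i\<in>UNIV. (x $ i)\<^sup>2)" for x :: "real^'n::finite"
  unfolding power2_norm_eq_inner inner_vec_def by (simp add: power2_eq_square)

lemma nsq_cart:
  fixes H :: "real^'n::finite \<Rightarrow> real^'m::finite"
  assumes "H \<in> Lp 2"
  shows "nsq H = (\<Sum>i\<in>UNIV. nsq (\<lambda>x. H x $ i))"
proof -
  have "nsq H = (LINT x|lborel. (\<Sum>i\<in>UNIV. (norm (H x $ i))\<^sup>2))"
    by (simp add: nsq_def norm_sq_cart)
  also have "\<dots> = (\<Sum>i\<in>UNIV. nsq (\<lambda>x. H x $ i))"
    unfolding nsq_def by (rule Bochner_Integration.integral_sum[OF Lp2_integrable[OF Lp2_nth[OF assms]]])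
  finally show ?thesis .
qed

context bump
begin

text \<open>Bounded support of \<open>v\<close> makes its mollification a test function, and the
  gradient of the mollification is the mollification of \<open>H\<close>, to which L2 convergence
  applies componentwise.\<close>

lemma dense_compact_support:
  fixes v :: "real^'n \<Rightarrow> real" and H :: "real^'n \<Rightarrow> real^'n"
  assumes v: "v \<in> Lp 2" "\<And>x. norm x \<ge> r \<Longrightarrow> v x = 0" and H: "has_weak_gradient v H" "H \<in> Lp 2" and "d > 0"
  obtains w where "w \<in> Cc_infinity" "nsq (\<lambda>x. w x - v x) < d" "nsq (\<lambda>x. grad w x - H x) < d"
proof -
  have vL: "locally_integrable v" by (rule Lp2_locally_integrable[OF v(1)])
  define d' where "d' = d / real CARD('n)"
  have d': "d' > 0" using \<open>d > 0\<close> by (simp add: d'_def)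
  obtain e0 where e0: "e0 > 0" "\<And>e' k. mollifier e' k \<Longrightarrow> e' \<le> e0 \<Longrightarrow> nsq (\<lambda>x. convol k v x - v x) < d"
    using mollify_L2[OF v(1) \<open>d > 0\<close>] by blast
  have "\<forall>i. \<exists>e>0. \<forall>e' k. mollifier e' k \<longrightarrow> e' \<le> e \<longrightarrow> nsq (\<lambda>x. convol k (\<lambda>x. H x $ i) x - H x $ i) < d'"
    using mollify_L2[OF Lp2_nth[OF H(2)] d'] by blast
  from choice[OF this] obtain E where E': "\<forall>i. E i > 0 \<and>
    (\<forall>e' k. mollifier e' k \<longrightarrow> e' \<le> E i \<longrightarrow> nsq (\<lambda>x. convol k (\<lambda>x. H x $ i) x - H x $ i) < d')" by blast
  have E: "E i > 0" "mollifier e' k \<Longrightarrow> e' \<le> E i \<Longrightarrow> nsq (\<lambda>x. convol k (\<lambda>x. H x $ i) x - H x $ i) < d'" for i e' k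
    using E' by auto
  \<comment> \<open>Finitely many coordinates, so one kernel serves for \<open>v\<close> and for
    every component of \<open>H\<close>; each component is allowed the share
    \<open>d'\<close>.\<close>
  define e where "e = Min (insert e0 (range E))"
  have e: "e > 0" "e \<le> e0" "\<And>i. e \<le> E i"
    using e0(1) E(1) unfolding e_def by (auto intro!: Min_le simp del: Min_insert)
  obtain k :: "real^'n \<Rightarrow> real" where k: "mollifier e k" using mollifier_exists[OF e(1)] by blast
  then have kC: "k \<in> Cc_infinity" by (simp add: mollifier_def)
  show ?thesis
  proof (rule that)
    show w: "convol k v \<in> Cc_infinity" by (rule Cc_convol(1)[where r = r, OF vL k v(2)])
    show "nsq (\<lambda>x. convol k v x - v x) < d" by (rule e0(2)[OF k e(2)])
    have "(\<lambda>x. grad (convol k v) x - H x) \<in> Lp 2" by (intro Lp2_diff Cc_grad_Lp2 w H(2))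
    then have "nsq (\<lambda>x. grad (convol k v) x - H x) = (\<Sum>i\<in>UNIV. nsq (\<lambda>x. convol k (\<lambda>x. H x $ i) x - H x $ i))"
      by (subst nsq_cart) (simp_all add: partial_deriv_convol_weak[OF H(1) kC])
    also have "\<dots> < (\<Sum>i\<in>(UNIV :: 'n set). d')" by (rule sum_strict_mono) (use E(2)[OF k e(3)] in auto)
    also have "\<dots> = d" by (simp add: d'_def)
    finally show "nsq (\<lambda>x. grad (convol k v) x - H x) < d" .
  qed
qed

end

lemma Lp2_bounded_mult:
  fixes F :: "real^'n::finite \<Rightarrow> 'b::euclidean_space"
  assumes "F \<in> Lp 2" "c \<in> borel_measurable borel" "\<And>x. \<bar>c x\<bar> \<le> M"
  shows "(\<lambda>x. c x *\<^sub>R F x) \<in> Lp 2"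
proof -
  note [measurable] = Lp2_measurable[OF assms(1)] assms(2)
  have "integrable lborel (\<lambda>x. (norm (c x *\<^sub>R F x))\<^sup>2)"
  proof (rule Bochner_Integration.integrable_bound)
    show "integrable lborel (\<lambda>x. M\<^sup>2 * (norm (F x))\<^sup>2)" using Lp2_integrable[OF assms(1)] by simp
    show "AE x in lborel. norm ((norm (c x *\<^sub>R F x))\<^sup>2) \<le> norm (M\<^sup>2 * (norm (F x))\<^sup>2)"
    proof (rule AE_I2)
      fix x
      have "(c x)\<^sup>2 \<le> M\<^sup>2" using assms(3)[of x] abs_le_square_iff[of "c x" M] by simp
      then show "norm ((norm (c x *\<^sub>R F x))\<^sup>2) \<le> norm (M\<^sup>2 * (norm (F x))\<^sup>2)"
        by (simp add: power_mult_distrib mult_right_mono)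
    qed
  qed simp
  then show ?thesis by (simp add: Lp_def)
qed

lemma L2lim_bounded_mult:
  fixes F :: "real^'n::finite \<Rightarrow> 'b::euclidean_space"
  assumes F: "F \<in> Lp 2" and c: "\<And>n. c n \<in> borel_measurable borel" "\<And>n x. \<bar>c n x\<bar> \<le> M"
    and lim: "\<And>x. (\<lambda>n. c n x) \<longlonglongrightarrow> 1"
  shows "L2lim (\<lambda>n x. c n x *\<^sub>R F x) F"
proof -
  note [measurable] = Lp2_measurable[OF F] c(1)
  have "(\<lambda>n. LINT x|lborel. (norm (c n x *\<^sub>R F x - F x))\<^sup>2) \<longlonglongrightarrow> (LINT x|(lborel :: (real^'n) measure). 0)"
  proof (rule integral_dominated_convergence[where w = "\<lambda>x. (M + 1)\<^sup>2 * (norm (F x))\<^sup>2"])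
    show "integrable lborel (\<lambda>x. (M + 1)\<^sup>2 * (norm (F x))\<^sup>2)" using Lp2_integrable[OF F] by simp
    show "AE x in lborel. (\<lambda>n. (norm (c n x *\<^sub>R F x - F x))\<^sup>2) \<longlonglongrightarrow> 0"
    proof (rule AE_I2)
      fix x
      have "(\<lambda>n. (norm (c n x *\<^sub>R F x - F x))\<^sup>2) \<longlonglongrightarrow> (norm (1 *\<^sub>R F x - F x))\<^sup>2" by (intro tendsto_intros lim)
      then show "(\<lambda>n. (norm (c n x *\<^sub>R F x - F x))\<^sup>2) \<longlonglongrightarrow> 0" by simp
    qed
    show "AE x in lborel. norm ((norm (c n x *\<^sub>R F x - F x))\<^sup>2) \<le> (M + 1)\<^sup>2 * (norm (F x))\<^sup>2" for n
    proof (rule AE_I2)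
      fix x
      have "c n x *\<^sub>R F x - F x = (c n x - 1) *\<^sub>R F x" by (simp add: scaleR_left_diff_distrib)
      then have "norm (c n x *\<^sub>R F x - F x) \<le> (M + 1) * norm (F x)"
        using c(2)[of n x] by (auto intro!: mult_right_mono)
      then have "(norm (c n x *\<^sub>R F x - F x))\<^sup>2 \<le> ((M + 1) * norm (F x))\<^sup>2" by (rule power_mono) simp
      then show "norm ((norm (c n x *\<^sub>R F x - F x))\<^sup>2) \<le> (M + 1)\<^sup>2 * (norm (F x))\<^sup>2" by (simp add: power_mult_distrib)
    qed
  qed auto
  then show ?thesis
    using Lp2_bounded_mult[OF F c] F by (simp add: L2lim_def nsq_def)
qed

lemma LIMSEQ_0_le:
  fixes F G :: "nat \<Rightarrow> real"
  assumes "\<And>n. 0 \<le> F n" "\<And>n. F n \<le> G n" "G \<longlonglongrightarrow> 0"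
  shows "F \<longlonglongrightarrow> 0"
  by (rule tendsto_sandwich[OF _ _ tendsto_const assms(3)]) (use assms in auto)

lemma nsq_bounded_square:
  fixes f :: "real^'n::finite \<Rightarrow> 'b::euclidean_space"
  assumes "f \<in> borel_measurable borel" "integrable lborel g" "\<And>x. (norm (f x))\<^sup>2 \<le> g x"
  shows "f \<in> Lp 2" "nsq f \<le> (LINT x|lborel. g x)"
proof -
  have i: "integrable lborel (\<lambda>x. (norm (f x))\<^sup>2)"
    using assms by (intro Bochner_Integration.integrable_bound[OF assms(2)]) (simp, intro AE_I2, simp add: order_trans[OF assms(3) abs_ge_self])
  then show "f \<in> Lp 2" using assms(1) by (simp add: Lp_def)
  show "nsq f \<le> (LINT x|lborel. g x)"
    unfolding nsq_def by (intro integral_mono i assms)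
qed

context bump
begin

theorem dense_weak_gradient:
  fixes u :: "real^'n \<Rightarrow> real"
  assumes u: "has_weak_gradient u G" "G \<in> Lp 2"
    and sq: "\<And>r. integrable lborel (\<lambda>x. indicator (cball 0 r) x * (u x)\<^sup>2)"
    and tail: "(\<lambda>n. nsq (\<lambda>x. u x *\<^sub>R grad (cutoff n) x)) \<longlonglongrightarrow> 0"
  obtains w where "\<And>n. w n \<in> Cc_infinity" "L2lim (\<lambda>n. grad (w n)) G"
    "AE x in lborel. (\<lambda>n. w n x) \<longlonglongrightarrow> u x" "u \<in> Lp 2 \<Longrightarrow> L2lim w u"
proof -
  obtain C where C: "C > 0" "\<And>n x. \<bar>cutoff n x\<bar> \<le> C" "\<And>n x. norm (grad (cutoff n) x) \<le> C / real (Suc n)"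
    "\<And>n x. norm x \<ge> C * real (Suc n) \<Longrightarrow> cutoff n x = 0"
    "\<And>n x. norm x > C * real (Suc n) \<Longrightarrow> grad (cutoff n) x = 0"
    using cutoff_bounds by blast
  have [measurable]: "u \<in> borel_measurable borel"
    using u(1) by (auto simp: has_weak_gradient_def intro: locally_integrable_measurable)
  have cm [measurable]: "cutoff n \<in> borel_measurable borel" for n
    using cutoff_Cc by (auto intro: smooth_borel)
  have gm [measurable]: "grad (cutoff n) \<in> borel_measurable borel" for n
    using cutoff_Cc by (auto intro!: borel_measurable_continuous_onI continuous_on_grad)
  define v where "v n x = cutoff n x * u x" for n x
  define H where "H n x = cutoff n x *\<^sub>R G x + u x *\<^sub>R grad (cutoff n) x" for n x
  have vL: "v n \<in> Lp 2" for n
  proof (rule nsq_bounded_square(1))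
    show "integrable lborel (\<lambda>x. C\<^sup>2 * (indicator (cball 0 (C * real (Suc n))) x * (u x)\<^sup>2))"
      by (intro integrable_mult_right sq)
    fix x
    have "(cutoff n x)\<^sup>2 \<le> C\<^sup>2" using C(1) C(2)[of n x] abs_le_square_iff[of "cutoff n x" C] by simp
    then show "(norm (v n x))\<^sup>2 \<le> C\<^sup>2 * (indicator (cball 0 (C * real (Suc n))) x * (u x)\<^sup>2)"
      using C(4)[of n x] by (cases "norm x \<ge> C * real (Suc n)") (auto simp: v_def power_mult_distrib mult_right_mono simp del: of_nat_Suc)
  qed (simp add: v_def[abs_def])
  have gL: "(\<lambda>x. u x *\<^sub>R grad (cutoff n) x) \<in> Lp 2" for n
  proof (rule nsq_bounded_square(1))
    show "integrable lborel (\<lambda>x. (C / real (Suc n))\<^sup>2 * (indicator (cball 0 (C * real (Suc n))) x * (u x)\<^sup>2))"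
      by (intro integrable_mult_right sq)
    fix x
    have "(norm (grad (cutoff n) x))\<^sup>2 \<le> (C / real (Suc n))\<^sup>2" by (rule power_mono[OF C(3)]) simp
    then show "(norm (u x *\<^sub>R grad (cutoff n) x))\<^sup>2 \<le> (C / real (Suc n))\<^sup>2 * (indicator (cball 0 (C * real (Suc n))) x * (u x)\<^sup>2)"
      using C(5)[of n x] mult_right_mono[of "(norm (grad (cutoff n) x))\<^sup>2" "(C / real (Suc n))\<^sup>2" "(u x)\<^sup>2"]
      by (cases "norm x > C * real (Suc n)") (simp_all add: power_mult_distrib mult.commute[of "(u x)\<^sup>2"] del: of_nat_Suc)
  qed simp
  have cG: "L2lim (\<lambda>n x. cutoff n x *\<^sub>R G x) G"
    by (rule L2lim_bounded_mult[where M = C]) (use u(2) cm C(2) cutoff_tendsto in auto)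
  have HL: "H n \<in> Lp 2" for n
    unfolding H_def[abs_def] by (intro Lp2_add L2lim_Lp(1)[OF cG] gL)
  have wv: "has_weak_gradient (v n) (H n)" for n
    unfolding v_def[abs_def] H_def[abs_def] by (rule weak_gradient_mult[OF u(1) cutoff_Cc])
  have "\<exists>w. w \<in> Cc_infinity \<and> nsq (\<lambda>x. w x - v n x) < inverse (real (Suc n)) \<and> nsq (\<lambda>x. grad w x - H n x) < inverse (real (Suc n))" for n
  proof -
    have v0: "v n x = 0" if "norm x \<ge> C * real (Suc n)" for x using C(4)[OF that] by (simp add: v_def)
    have "inverse (real (Suc n)) > 0" by simp
    from dense_compact_support[where r = "C * real (Suc n)", OF vL[of n] v0 wv[of n] HL[of n] this]
    show ?thesis by blast
  qed
  then have "\<forall>n. \<exists>w. w \<in> Cc_infinity \<and> nsq (\<lambda>x. w x - v n x) < inverse (real (Suc n)) \<and> nsq (\<lambda>x. grad w x - H n x) < inverse (real (Suc n))" by blast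
  from choice[OF this] obtain w where w': "\<forall>n. w n \<in> Cc_infinity \<and> nsq (\<lambda>x. w n x - v n x) < inverse (real (Suc n)) \<and> nsq (\<lambda>x. grad (w n) x - H n x) < inverse (real (Suc n))" by blast
  then have w: "w n \<in> Cc_infinity" "nsq (\<lambda>x. w n x - v n x) < inverse (real (Suc n))" "nsq (\<lambda>x. grad (w n) x - H n x) < inverse (real (Suc n))" for n
    by auto
  note wL = Cc_Lp2[OF w(1)] and gwL = Cc_grad_Lp2[OF w(1)]
  have dwv: "(\<lambda>n. nsq (\<lambda>x. w n x - v n x)) \<longlonglongrightarrow> 0"
    by (rule LIMSEQ_0_le[OF _ _ LIMSEQ_inverse_real_of_nat]) (use w(2) in \<open>auto intro: less_imp_le\<close>)
  have dwH: "(\<lambda>n. nsq (\<lambda>x. grad (w n) x - H n x)) \<longlonglongrightarrow> 0"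
    by (rule LIMSEQ_0_le[OF _ _ LIMSEQ_inverse_real_of_nat]) (use w(3) in \<open>auto intro: less_imp_le\<close>)
  have dHG: "(\<lambda>n. nsq (\<lambda>x. H n x - G x)) \<longlonglongrightarrow> 0"
  proof (rule LIMSEQ_0_le)
    show "nsq (\<lambda>x. H n x - G x) \<le> 2 * nsq (\<lambda>x. cutoff n x *\<^sub>R G x - G x) + 2 * nsq (\<lambda>x. u x *\<^sub>R grad (cutoff n) x)" for n
      using nsq_add_le[OF Lp2_diff[OF L2lim_Lp(1)[OF cG] u(2)] gL, of n n] by (simp add: H_def algebra_simps)
    have "(\<lambda>n. nsq (\<lambda>x. cutoff n x *\<^sub>R G x - G x)) \<longlonglongrightarrow> 0" using cG by (simp add: L2lim_def)
    from tendsto_add[OF tendsto_mult[OF tendsto_const[of 2] this] tendsto_mult[OF tendsto_const[of 2] tail]]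
    show "(\<lambda>n. 2 * nsq (\<lambda>x. cutoff n x *\<^sub>R G x - G x) + 2 * nsq (\<lambda>x. u x *\<^sub>R grad (cutoff n) x)) \<longlonglongrightarrow> 0" by simp
  qed simp
  have "(\<lambda>n. nsq (\<lambda>x. grad (w n) x - G x)) \<longlonglongrightarrow> 0"
  proof (rule LIMSEQ_0_le)
    show "nsq (\<lambda>x. grad (w n) x - G x) \<le> 2 * nsq (\<lambda>x. grad (w n) x - H n x) + 2 * nsq (\<lambda>x. H n x - G x)" for n
      by (rule nsq_diff_le[OF gwL u(2) HL])
    from tendsto_add[OF tendsto_mult[OF tendsto_const[of 2] dwH] tendsto_mult[OF tendsto_const[of 2] dHG]]
    show "(\<lambda>n. 2 * nsq (\<lambda>x. grad (w n) x - H n x) + 2 * nsq (\<lambda>x. H n x - G x)) \<longlonglongrightarrow> 0" by simp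
  qed simp
  then have gw: "L2lim (\<lambda>n. grad (w n)) G" using gwL u(2) by (simp add: L2lim_def)
  have z: "(\<lambda>x. 0::real) \<in> Lp 2" by (simp add: Lp_def)
  have "L2lim (\<lambda>n x. w n x - v n x) (\<lambda>x. 0)"
    using dwv Lp2_diff[OF wL vL] z by (simp add: L2lim_def)
  \<comment> \<open>The truncations \<open>v n\<close> converge to \<open>u\<close> at every point,
    so it is enough to make \<open>w n - v n\<close> tend to 0 almost everywhere along a
    subsequence.\<close>
  from L2lim_AE_subseq[OF this] obtain \<sigma> where \<sigma>: "strict_mono (\<sigma>::nat\<Rightarrow>nat)"
    "AE x in lborel. (\<lambda>n. w (\<sigma> n) x - v (\<sigma> n) x) \<longlonglongrightarrow> 0" by blast
  have vlim: "(\<lambda>n. v n x) \<longlonglongrightarrow> u x" for x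
    using tendsto_mult[OF cutoff_tendsto[of x] tendsto_const[of "u x"]] by (simp add: v_def)
  show ?thesis
  proof (rule that)
    show "w (\<sigma> n) \<in> Cc_infinity" for n by (rule w(1))
    show "L2lim (\<lambda>n. grad (w (\<sigma> n))) G" by (rule L2lim_subseq[OF gw \<sigma>(1)])
    show "AE x in lborel. (\<lambda>n. w (\<sigma> n) x) \<longlonglongrightarrow> u x"
      using \<sigma>(2)
    proof eventually_elim
      case (elim x)
      have "(\<lambda>n. v (\<sigma> n) x) \<longlonglongrightarrow> u x" using LIMSEQ_subseq_LIMSEQ[OF vlim \<sigma>(1)] by (simp add: o_def)
      from tendsto_add[OF elim this] show ?case by simp
    qed
    show "L2lim (\<lambda>n. w (\<sigma> n)) u" if "u \<in> Lp 2"
    proof (rule L2lim_subseq[OF _ \<sigma>(1)])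
      have "L2lim (\<lambda>n x. cutoff n x *\<^sub>R u x) u"
        by (rule L2lim_bounded_mult[where M = C]) (use that cm C(2) cutoff_tendsto in auto)
      then have dv: "(\<lambda>n. nsq (\<lambda>x. v n x - u x)) \<longlonglongrightarrow> 0" by (simp add: L2lim_def v_def)
      have "(\<lambda>n. nsq (\<lambda>x. w n x - u x)) \<longlonglongrightarrow> 0"
      proof (rule LIMSEQ_0_le)
        show "nsq (\<lambda>x. w n x - u x) \<le> 2 * nsq (\<lambda>x. w n x - v n x) + 2 * nsq (\<lambda>x. v n x - u x)" for n
          by (rule nsq_diff_le[OF wL that vL])
        from tendsto_add[OF tendsto_mult[OF tendsto_const[of 2] dwv] tendsto_mult[OF tendsto_const[of 2] dv]]
        show "(\<lambda>n. 2 * nsq (\<lambda>x. w n x - v n x) + 2 * nsq (\<lambda>x. v n x - u x)) \<longlonglongrightarrow> 0" by simp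
      qed simp
      then show "L2lim w u" using wL that by (simp add: L2lim_def)
    qed
  qed
qed

lemma tail_Lp2:
  fixes u :: "real^'n \<Rightarrow> real"
  assumes "u \<in> Lp 2"
  shows "(\<lambda>n. nsq (\<lambda>x. u x *\<^sub>R grad (cutoff n) x)) \<longlonglongrightarrow> 0"
proof -
  obtain C where C: "C > 0" "\<And>n x. \<bar>cutoff n x\<bar> \<le> C" "\<And>n x. norm (grad (cutoff n) x) \<le> C / real (Suc n)"
    "\<And>n x. norm x \<ge> C * real (Suc n) \<Longrightarrow> cutoff n x = 0"
    "\<And>n x. norm x > C * real (Suc n) \<Longrightarrow> grad (cutoff n) x = 0"
    using cutoff_bounds by blast
  have [measurable]: "u \<in> borel_measurable borel" by (rule Lp2_measurable[OF assms])
  have gm [measurable]: "grad (cutoff n) \<in> borel_measurable borel" for n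
    using cutoff_Cc by (auto intro!: borel_measurable_continuous_onI continuous_on_grad)
  have "nsq (\<lambda>x. u x *\<^sub>R grad (cutoff n) x) \<le> (C / real (Suc n))\<^sup>2 * nsq u" for n
  proof -
    have "nsq (\<lambda>x. u x *\<^sub>R grad (cutoff n) x) \<le> (LINT x|lborel. (C / real (Suc n))\<^sup>2 * (norm (u x))\<^sup>2)"
    proof (rule nsq_bounded_square(2))
      fix x
      have "(norm (grad (cutoff n) x))\<^sup>2 \<le> (C / real (Suc n))\<^sup>2" by (rule power_mono[OF C(3)]) simp
      then show "(norm (u x *\<^sub>R grad (cutoff n) x))\<^sup>2 \<le> (C / real (Suc n))\<^sup>2 * (norm (u x))\<^sup>2"
        using mult_right_mono[of "(norm (grad (cutoff n) x))\<^sup>2" "(C / real (Suc n))\<^sup>2" "(u x)\<^sup>2"]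
        by (simp add: power_mult_distrib mult.commute[of "(u x)\<^sup>2"] del: of_nat_Suc)
    qed (use Lp2_integrable[OF assms] in simp_all)
    then show ?thesis unfolding nsq_def[of u] by (simp only: integral_mult_right_zero)
  qed
  then show ?thesis
  proof (rule LIMSEQ_0_le[OF nsq_nonneg])
    show "(\<lambda>n. (C / real (Suc n))\<^sup>2 * nsq u) \<longlonglongrightarrow> 0"
  proof -
    have "(\<lambda>n. (C * inverse (real (Suc n)))\<^sup>2 * nsq u) \<longlonglongrightarrow> (C * 0)\<^sup>2 * nsq u"
      by (intro tendsto_intros LIMSEQ_inverse_real_of_nat)
    then show ?thesis unfolding divide_inverse by simp
  qed
  qed
qed

end

text \<open>Below the threshold \<open>t^2 = 1 / (s^3 N)\<close> the second term dominates, above it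
  the first. The scaling suits dimension 3: over a ball of radius proportional to \<open>N\<close>
  the second term integrates to a multiple of \<open>1 / s^3\<close>, whatever \<open>N\<close>
  is.\<close>

lemma young_sixth_power:
  fixes t s N :: real
  assumes "s > 0" "N > 0"
  shows "t\<^sup>2 / N\<^sup>2 \<le> s ^ 6 * t ^ 6 + 1 / (s ^ 3 * N ^ 3)"
proof (cases "t\<^sup>2 \<le> 1 / (s ^ 3 * N)")
  case True
  then have "t\<^sup>2 / N\<^sup>2 \<le> 1 / (s ^ 3 * N) / N\<^sup>2" by (rule divide_right_mono) simp
  also have "\<dots> = 1 / (s ^ 3 * N ^ 3)" using assms by (simp add: power2_eq_square power3_eq_cube)
  also have "\<dots> \<le> s ^ 6 * t ^ 6 + 1 / (s ^ 3 * N ^ 3)" using assms(1) by simp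
  finally show ?thesis .
next
  case False
  then have "(1 / (s ^ 3 * N))\<^sup>2 \<le> (t\<^sup>2)\<^sup>2" using assms by (intro power_mono) auto
  then have "1 / (s ^ 6 * N\<^sup>2) \<le> t ^ 4" by (simp add: power_divide power_mult_distrib flip: power_mult)
  from mult_left_mono[OF this, of "s ^ 6"] have "1 / N\<^sup>2 \<le> s ^ 6 * t ^ 4" using assms by simp
  then have "t\<^sup>2 * (1 / N\<^sup>2) \<le> t\<^sup>2 * (s ^ 6 * t ^ 4)" by (rule mult_left_mono) simp
  also have "\<dots> = s ^ 6 * t ^ 6" by (simp flip: power_add)
  also have "\<dots> \<le> s ^ 6 * t ^ 6 + 1 / (s ^ 3 * N ^ 3)" using assms by simp
  finally show ?thesis by simp
qed

text \<open>Hoelder's inequality would bound this by the L6 norm of \<open>u\<close> times the L3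
  norm of the cutoff gradient, which in dimension 3 is invariant under dilation: that is
  boundedness, not decay. Decay is won by splitting off a part of total mass
  \<open>C^5 \<kappa> / s^3\<close>, as small as desired; the rest is dominated by a multiple of
  \<open>u^6\<close> and tends to 0 pointwise.\<close>

lemma tail_Lp6:
  fixes u :: "real^3 \<Rightarrow> real"
  assumes "bump b x0" and u: "u \<in> Lp 6"
  shows "(\<lambda>n. nsq (\<lambda>x. u x *\<^sub>R grad (bump.cutoff b x0 n) x)) \<longlonglongrightarrow> 0"
proof -
  interpret bump b x0 by fact
  obtain C where C: "C > 0" "\<And>n x. \<bar>cutoff n x\<bar> \<le> C" "\<And>n x. norm (grad (cutoff n) x) \<le> C / real (Suc n)"
    "\<And>n x. norm x \<ge> C * real (Suc n) \<Longrightarrow> cutoff n x = 0"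
    "\<And>n x. norm x > C * real (Suc n) \<Longrightarrow> grad (cutoff n) x = 0"
    using cutoff_bounds by blast
  have [measurable]: "u \<in> borel_measurable borel" and u6: "integrable lborel (\<lambda>x. u x ^ 6)"
    using u by (auto simp: Lp_def)
  have gm [measurable]: "grad (cutoff n) \<in> borel_measurable borel" for n
    using cutoff_Cc by (auto intro!: borel_measurable_continuous_onI continuous_on_grad)
  define f where "f n x = (norm (u x *\<^sub>R grad (cutoff n) x))\<^sup>2" for n x
  have fm [measurable]: "f n \<in> borel_measurable borel" for n unfolding f_def by measurable
  have f0: "0 \<le> f n x" for n x by (simp add: f_def)
  have f_le: "f n x \<le> C\<^sup>2 * (u x)\<^sup>2 * (inverse (real (Suc n)))\<^sup>2" for n x
  proof -
    have "(norm (grad (cutoff n) x))\<^sup>2 \<le> (C / real (Suc n))\<^sup>2" by (rule power_mono[OF C(3)]) simp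
    from mult_left_mono[OF this, of "(u x)\<^sup>2"] show ?thesis
      by (simp add: f_def power_mult_distrib divide_inverse mult_ac del: of_nat_Suc)
  qed
  define \<kappa> where "\<kappa> = unit_ball_vol (real 3)"
  have \<kappa>: "\<kappa> \<ge> 0" by (simp add: \<kappa>_def)
  have vol: "measure lborel (cball (0::real^3) (C * real (Suc n))) = \<kappa> * C ^ 3 * real (Suc n) ^ 3" for n
    using content_cball[of "C * real (Suc n)" "0::real^3"] C(1) by (simp add: \<kappa>_def power_mult_distrib del: of_nat_Suc)
  have key: "\<forall>\<^sub>F n in sequentially. nsq (\<lambda>x. u x *\<^sub>R grad (cutoff n) x) < d" if "d > 0" for d
  proof -
    \<comment> \<open>Makes the mass \<open>C^5 \<kappa> / s^3\<close> of the split-off part less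
      than \<open>d / 2\<close>; \<open>s \<ge> 1\<close> permits replacing \<open>s\<close> by
      \<open>s^3\<close>.\<close>
    define s where "s = 2 * (C ^ 5 * \<kappa>) / d + 1"
    have s: "s \<ge> 1" using C(1) \<kappa> \<open>d > 0\<close> by (simp add: s_def)
    have "s \<le> s ^ 3" using s power_increasing[of 1 3 s] by simp
    have "2 * (C ^ 5 * \<kappa>) < d * s" using \<open>d > 0\<close> by (simp add: s_def field_simps)
    also have "\<dots> \<le> d * s ^ 3" using \<open>s \<le> s ^ 3\<close> \<open>d > 0\<close> by simp
    finally have sd: "C ^ 5 * \<kappa> / s ^ 3 < d / 2" using s by (simp add: field_simps)
    define m where "m n = C\<^sup>2 / (s ^ 3 * real (Suc n) ^ 3)" for n
    have m0: "0 \<le> m n" for n using s by (simp add: m_def)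
    define B where "B n = cball (0::real^3) (C * real (Suc n))" for n
    have le: "f n x \<le> C\<^sup>2 * (s ^ 6 * u x ^ 6) + indicator (B n) x * m n" for n x
    proof (cases "x \<in> B n")
      case True
      have "f n x \<le> C\<^sup>2 * ((u x)\<^sup>2 / (real (Suc n))\<^sup>2)"
        using f_le[of n x] by (simp add: power_inverse divide_inverse mult_ac del: of_nat_Suc)
      also have "\<dots> \<le> C\<^sup>2 * (s ^ 6 * u x ^ 6 + 1 / (s ^ 3 * real (Suc n) ^ 3))"
        using s by (intro mult_left_mono young_sixth_power) auto
      finally show ?thesis using True by (simp add: m_def distrib_left del: of_nat_Suc)
    next
      case False
      then have "grad (cutoff n) x = 0" using C(5)[of n x] by (auto simp: B_def)
      then show ?thesis using False s by (simp add: f_def)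
    qed
    \<comment> \<open>The excess of \<open>f n\<close> over the constant \<open>m n\<close> on the
      ball: it inherits the integrable majorant and still tends to 0 at each point.\<close>
    define g where "g n x = max 0 (f n x - indicator (B n) x * m n)" for n x
    have g: "f n x \<le> g n x + indicator (B n) x * m n" "\<bar>g n x\<bar> \<le> C\<^sup>2 * (s ^ 6 * u x ^ 6)" "g n x \<le> f n x" "0 \<le> g n x" for n x
      using le[of n x] s f0[of n x] m0[of n] by (auto simp: g_def indicator_def)
    have [measurable]: "g n \<in> borel_measurable borel" for n
      unfolding g_def B_def
      by (intro borel_measurable_max borel_measurable_diff borel_measurable_times borel_measurable_indicator fm) auto
    have "(\<lambda>n. LINT x|lborel. g n x) \<longlonglongrightarrow> (LINT x|(lborel :: (real^3) measure). 0)"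
    proof (rule integral_dominated_convergence[where w = "\<lambda>x. C\<^sup>2 * (s ^ 6 * u x ^ 6)"])
      show "integrable lborel (\<lambda>x. C\<^sup>2 * (s ^ 6 * u x ^ 6))" using u6 by simp
      show "AE x in lborel. (\<lambda>n. g n x) \<longlonglongrightarrow> 0"
      proof (rule AE_I2, rule tendsto_sandwich[OF _ _ tendsto_const])
        fix x
        have "(\<lambda>n. C\<^sup>2 * (u x)\<^sup>2 * (inverse (real (Suc n)))\<^sup>2) \<longlonglongrightarrow> C\<^sup>2 * (u x)\<^sup>2 * 0\<^sup>2"
          by (intro tendsto_intros LIMSEQ_inverse_real_of_nat)
        then show "(\<lambda>n. C\<^sup>2 * (u x)\<^sup>2 * (inverse (real (Suc n)))\<^sup>2) \<longlonglongrightarrow> 0" by simp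
        show "\<forall>\<^sub>F n in sequentially. g n x \<le> C\<^sup>2 * (u x)\<^sup>2 * (inverse (real (Suc n)))\<^sup>2"
          by (intro always_eventually allI order_trans[OF g(3) f_le])
      qed (use g(4) in auto)
    qed (use g(2) in auto)
    then have "(\<lambda>n. LINT x|lborel. g n x) \<longlonglongrightarrow> 0" by simp
    from order_tendstoD(2)[OF this, of "d / 2"] \<open>d > 0\<close>
    have "\<forall>\<^sub>F n in sequentially. (LINT x|lborel. g n x) < d / 2" by simp
    then show ?thesis
    proof eventually_elim
      case (elim n)
      have gi: "integrable lborel (g n)"
      proof (rule Bochner_Integration.integrable_bound)
        show "integrable lborel (\<lambda>x. C\<^sup>2 * (s ^ 6 * u x ^ 6))" using u6 by simp
        show "AE x in lborel. norm (g n x) \<le> norm (C\<^sup>2 * (s ^ 6 * u x ^ 6))"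
          unfolding real_norm_def by (intro AE_I2 order_trans[OF g(2) abs_ge_self])
      qed simp
      have ii: "integrable lborel (\<lambda>x. indicator (B n) x * m n)" unfolding B_def by (rule integrable_indicator_cball)
      have "nsq (\<lambda>x. u x *\<^sub>R grad (cutoff n) x) \<le> (LINT x|lborel. g n x + indicator (B n) x * m n)"
        using g(1)[of n] unfolding f_def by (intro nsq_bounded_square(2) Bochner_Integration.integrable_add gi ii) auto
      also have "\<dots> = (LINT x|lborel. g n x) + measure lborel (B n) * m n"
        using gi ii by (simp add: B_def)
      also have "measure lborel (B n) * m n = C ^ 5 * \<kappa> / s ^ 3"
        using s by (simp add: B_def vol m_def field_simps power_numeral_reduce del: of_nat_Suc)
      finally show ?case using elim sd by linarith
    qed
  qed
  show ?thesis
  proof (rule order_tendstoI)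
    fix a :: real assume "a < 0"
    then show "\<forall>\<^sub>F n in sequentially. a < nsq (\<lambda>x. u x *\<^sub>R grad (cutoff n) x)"
      by (intro always_eventually allI) (auto intro: less_le_trans)
  qed (rule key)
qed

subsection \<open>A Hardy inequality\<close>

text \<open>The vector field \<open>x / (1 + \<bar>x\<bar>\<^sup>2)\<close> has divergence at least \<open>1 / (1 + \<bar>x\<bar>\<^sup>2)\<close>; integrate it against
  \<open>u\<^sup>2\<close> by parts.\<close>

lemma Hardy_weight:
  defines "w \<equiv> \<lambda>x::real^'n::finite. inverse (1 + (norm x)\<^sup>2)"
  shows "smooth w" and "partial_deriv i (\<lambda>x. x $ i * w x) x = w x - 2 * (x $ i)\<^sup>2 * (w x)\<^sup>2"
    and "w x > 0" and "w x \<le> 1" and "w x * (norm x)\<^sup>2 \<le> 1"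
proof -
  have p: "1 + (norm x)\<^sup>2 > 0" for x :: "real^'n" by (simp add: add_pos_nonneg)
  have "smooth (\<lambda>x::real^'n. 1 + (\<Sum>i\<in>UNIV. x $ i * x $ i))"
    by (intro smooth_add smooth_sum smooth_mult smooth_const smooth_nth)
  then have "smooth (\<lambda>x::real^'n. 1 + (norm x)\<^sup>2)" by (simp only: norm_sq_cart power2_eq_square[symmetric])
  then show sw: "smooth w" unfolding w_def by (rule smooth_inverse) (use p in \<open>simp add: less_imp_neq[symmetric]\<close>)
  have "((\<lambda>x. 1 + x \<bullet> x) has_derivative (\<lambda>h. 2 * (x \<bullet> h))) (at x)"
    by (auto intro!: derivative_eq_intros simp: inner_commute)
  then have "((\<lambda>x. inverse (1 + x \<bullet> x)) has_derivative
      (\<lambda>h. - (inverse (1 + x \<bullet> x) * (2 * (x \<bullet> h)) * inverse (1 + x \<bullet> x)))) (at x)"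
    by (rule Deriv.has_derivative_inverse[rotated]) (use p[of x] in \<open>simp add: power2_norm_eq_inner less_imp_neq[symmetric]\<close>)
  from partial_derivI[OF this, of i] have "partial_deriv i w x = - (2 * x $ i * (w x)\<^sup>2)"
    unfolding w_def power2_norm_eq_inner by (simp add: inner_axis power2_eq_square)
  then show "partial_deriv i (\<lambda>x. x $ i * w x) x = w x - 2 * (x $ i)\<^sup>2 * (w x)\<^sup>2"
    by (subst partial_deriv_mult) (auto intro: smooth_differentiable sw simp: partial_deriv_nth axis_def power2_eq_square)
  show "w x > 0" using p[of x] by (simp add: w_def)
  show "w x \<le> 1" unfolding w_def by (rule inverse_le_1_iff[THEN iffD2]) simp
  show "w x * (norm x)\<^sup>2 \<le> 1" using p[of x] by (simp add: w_def field_simps)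
qed

text \<open>The weight is regularised at the origin, so its product with \<open>u^2\<close> is again
  a test function and parts can be integrated directly. It also dominates every test function up to
  a constant, which is how \<open>V\<close> comes under this bound.\<close>

theorem Hardy_inequality:
  fixes u :: "real^3 \<Rightarrow> real"
  assumes u: "u \<in> Cc_infinity"
  shows "integrable lborel (\<lambda>x. (u x)\<^sup>2 / (1 + (norm x)\<^sup>2))"
    and "(LINT x|lborel. (u x)\<^sup>2 / (1 + (norm x)\<^sup>2)) \<le> 4 * nsq (grad u)"
proof -
  define w where "w x = inverse (1 + (norm x)\<^sup>2)" for x :: "real^3"
  note W = Hardy_weight[where 'n = 3, folded w_def]
  have su: "smooth u" using u by auto
  have u2: "(\<lambda>x. u x * u x) \<in> Cc_infinity" by (rule Cc_mult_smooth[OF su u])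
  have wu: "(\<lambda>x. w x * (u x * u x)) \<in> Cc_infinity" by (rule Cc_mult_smooth[OF W(1) u2])
  note i1 = Cc_integrable[OF wu]
  have eq: "(u x)\<^sup>2 / (1 + (norm x)\<^sup>2) = w x * (u x * u x)" for x
    unfolding w_def divide_inverse power2_eq_square[of "u x"] by (rule mult.commute)
  from i1 show "integrable lborel (\<lambda>x. (u x)\<^sup>2 / (1 + (norm x)\<^sup>2))" unfolding eq .
  have sF: "smooth (\<lambda>x. x $ i * w x)" for i by (rule smooth_mult[OF smooth_nth W(1)])
  have pd: "partial_deriv i (\<lambda>x. u x * u x) x = 2 * u x * partial_deriv i u x" for i x
    using su by (subst partial_deriv_mult) (auto intro: smooth_differentiable)
  have ia: "integrable lborel (\<lambda>x. (x $ i * w x) * partial_deriv i (\<lambda>x. u x * u x) x)" for i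
    by (intro Cc_integrable Cc_mult_smooth sF Cc_partial_deriv u2)
  have ib: "integrable lborel (\<lambda>x. partial_deriv i (\<lambda>x. x $ i * w x) x * (u x * u x))" for i
    by (intro Cc_integrable Cc_mult_smooth smooth_partial_deriv sF u2)
  have "(LINT x|lborel. w x * (u x * u x)) \<le> (LINT x|lborel. (\<Sum>i\<in>UNIV. partial_deriv i (\<lambda>x. x $ i * w x) x * (u x * u x)))"
  proof (rule integral_mono[OF i1])
    fix x
    \<comment> \<open>The dimension enters here as the coefficient 3; the subtracted term is at most
      \<open>2 w\<close> because \<open>w x * (norm x)^2 \<le> 1\<close>.\<close>
    have div: "(\<Sum>i\<in>UNIV. partial_deriv i (\<lambda>x. x $ i * w x) x) = 3 * w x - 2 * (norm x)\<^sup>2 * (w x)\<^sup>2"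
      unfolding W(2) norm_sq_cart sum_subtractf sum_distrib_left sum_distrib_right by simp
    have "(norm x)\<^sup>2 * (w x)\<^sup>2 = (w x * (norm x)\<^sup>2) * w x" by (simp add: power2_eq_square)
    also have "\<dots> \<le> 1 * w x" by (rule mult_right_mono[OF W(5) less_imp_le[OF W(3)]])
    finally have "w x \<le> (\<Sum>i\<in>UNIV. partial_deriv i (\<lambda>x. x $ i * w x) x)"
      unfolding div by linarith
    from mult_right_mono[OF this, of "u x * u x"]
    show "w x * (u x * u x) \<le> (\<Sum>i\<in>UNIV. partial_deriv i (\<lambda>x. x $ i * w x) x * (u x * u x))"
      by (simp add: sum_distrib_right)
  qed (intro Bochner_Integration.integrable_sum ib)
  also have "\<dots> = (\<Sum>i\<in>UNIV. LINT x|lborel. partial_deriv i (\<lambda>x. x $ i * w x) x * (u x * u x))"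
    by (rule Bochner_Integration.integral_sum[OF ib])
  also have "\<dots> = (\<Sum>i\<in>UNIV. - (LINT x|lborel. (x $ i * w x) * partial_deriv i (\<lambda>x. u x * u x) x))"
    by (intro sum.cong refl) (simp add: integration_by_parts[OF sF u2])
  also have "\<dots> = (LINT x|lborel. - (\<Sum>i\<in>UNIV. (x $ i * w x) * partial_deriv i (\<lambda>x. u x * u x) x))"
  proof -
    have "(LINT x|lborel. (\<Sum>i\<in>UNIV. (x $ i * w x) * partial_deriv i (\<lambda>x. u x * u x) x)) =
        (\<Sum>i\<in>UNIV. LINT x|lborel. (x $ i * w x) * partial_deriv i (\<lambda>x. u x * u x) x)"
      by (rule Bochner_Integration.integral_sum[OF ia])
    then show ?thesis by (simp add: sum_negf)
  qed
  \<comment> \<open>The weights 1/2 and 2 in the AM-GM inequality let half of the left-hand side be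
    absorbed, which doubles the 2 to the final constant 4.\<close>
  also have "\<dots> \<le> (LINT x|lborel. (1/2) * (w x * (u x * u x)) + 2 * (norm (grad u x))\<^sup>2)"
  proof (rule integral_mono)
    show "integrable lborel (\<lambda>x. (1/2) * (w x * (u x * u x)) + 2 * (norm (grad u x))\<^sup>2)"
      using i1 Lp2_integrable[OF Cc_grad_Lp2[OF u]] by simp
    show "integrable lborel (\<lambda>x. - (\<Sum>i\<in>UNIV. (x $ i * w x) * partial_deriv i (\<lambda>x. u x * u x) x))"
      by (intro Bochner_Integration.integrable_minus Bochner_Integration.integrable_sum ia)
    fix x
    have "- (\<Sum>i\<in>UNIV. (x $ i * w x) * partial_deriv i (\<lambda>x. u x * u x) x) = - 2 * w x * u x * (x \<bullet> grad u x)"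
    proof -
      have "(\<Sum>i\<in>UNIV. (x $ i * w x) * partial_deriv i (\<lambda>x. u x * u x) x) =
          (\<Sum>i\<in>UNIV. 2 * w x * u x * (x $ i * partial_deriv i u x))"
        by (intro sum.cong refl) (simp only: pd, simp)
      then show ?thesis unfolding inner_vec_def by (simp add: sum_distrib_left sum_negf)
    qed
    also have "\<dots> \<le> 2 * w x * \<bar>u x\<bar> * (norm x * norm (grad u x))"
    proof -
      have "- (u x * (x \<bullet> grad u x)) \<le> \<bar>u x\<bar> * \<bar>x \<bullet> grad u x\<bar>" using abs_ge_minus_self[of "u x * (x \<bullet> grad u x)"] by (simp add: abs_mult)
      also have "\<dots> \<le> \<bar>u x\<bar> * (norm x * norm (grad u x))" by (intro mult_left_mono Cauchy_Schwarz_ineq2) simp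
      finally have "- (u x * (x \<bullet> grad u x)) \<le> \<bar>u x\<bar> * (norm x * norm (grad u x))" .
      then have "(2 * w x) * - (u x * (x \<bullet> grad u x)) \<le> (2 * w x) * (\<bar>u x\<bar> * (norm x * norm (grad u x)))"
        using W(3)[of x] by (intro mult_left_mono) simp_all
      then show ?thesis by (simp only: mult.assoc mult_minus_left mult_minus_right)
    qed
    also have "\<dots> \<le> w x * ((1/2) * \<bar>u x\<bar>\<^sup>2 + 2 * (norm x * norm (grad u x))\<^sup>2)"
    proof -
      have "2 * a * b \<le> (1/2) * a\<^sup>2 + 2 * b\<^sup>2" for a b :: real
        using zero_le_power2[of "a - 2 * b"] by (simp add: power2_eq_square algebra_simps)
      then have "2 * \<bar>u x\<bar> * (norm x * norm (grad u x)) \<le> (1/2) * \<bar>u x\<bar>\<^sup>2 + 2 * (norm x * norm (grad u x))\<^sup>2" .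
      from mult_left_mono[OF this less_imp_le[OF W(3)[of x]]] show ?thesis by (simp only: mult.left_commute[of "w x"] mult.assoc)
    qed
    also have "\<dots> = (1/2) * (w x * (u x * u x)) + 2 * ((w x * (norm x)\<^sup>2) * (norm (grad u x))\<^sup>2)"
      by (simp add: power_mult_distrib power2_eq_square distrib_left)
    also have "\<dots> \<le> (1/2) * (w x * (u x * u x)) + 2 * (1 * (norm (grad u x))\<^sup>2)"
      using W(5)[of x] by (intro add_left_mono mult_left_mono mult_right_mono) auto
    finally show "- (\<Sum>i\<in>UNIV. (x $ i * w x) * partial_deriv i (\<lambda>x. u x * u x) x)
        \<le> (1/2) * (w x * (u x * u x)) + 2 * (norm (grad u x))\<^sup>2" by simp
  qed
  also have "\<dots> = (1/2) * (LINT x|lborel. w x * (u x * u x)) + 2 * nsq (grad u)"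
    using i1 Lp2_integrable[OF Cc_grad_Lp2[OF u]] by (simp add: nsq_def)
  finally have "(LINT x|lborel. w x * (u x * u x)) \<le> 4 * nsq (grad u)" by linarith
  then show "(LINT x|lborel. (u x)\<^sup>2 / (1 + (norm x)\<^sup>2)) \<le> 4 * nsq (grad u)"
    unfolding eq .
qed

subsection \<open>Compactness\<close>

lemma convol_bound:
  assumes "k \<in> Cc_infinity" "f \<in> Lp 2"
  shows "\<bar>convol k f x\<bar> \<le> sqrt (nsq k * nsq f)"
proof -
  have k: "(\<lambda>y. k (x - y)) \<in> Lp 2" "nsq (\<lambda>y. k (x - y)) = nsq k"
    using Lp2_translate_sign[OF Cc_Lp2[OF assms(1)], of "-1" x] by simp_all
  have "(convol k f x)\<^sup>2 \<le> nsq k * nsq f"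
    using ip_Cauchy_Schwarz[OF k(1) assms(2)] k(2) by (simp add: convol_def ip_def)
  then show ?thesis using real_sqrt_le_mono by fastforce
qed

lemma convol_Lipschitz:
  fixes k :: "real^'n::finite \<Rightarrow> real"
  assumes "k \<in> Cc_infinity"
  obtains L where "L > 0"
    "\<And>f x y. f \<in> Lp 2 \<Longrightarrow> nsq f \<le> A \<Longrightarrow> \<bar>convol k f y - convol k f x\<bar> \<le> L * norm (y - x)"
proof -
  define L where "L = (\<Sum>i\<in>UNIV. sqrt (nsq (partial_deriv i k) * A)) + 1"
  show ?thesis
  \<comment> \<open>\<open>A\<close> is arbitrary here and \<open>sqrt\<close> of a negative number
    is negative, so \<open>L\<close> alone need not be positive.\<close>
  proof (rule that[of "max L 1"])
    fix f :: "real^'n \<Rightarrow> real" and x y assume f: "f \<in> Lp 2" "nsq f \<le> A"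
    have "norm (grad (convol k f) x) \<le> max L 1" for x
    proof -
      have "norm (grad (convol k f) x) \<le> (\<Sum>i\<in>UNIV. \<bar>grad (convol k f) x $ i\<bar>)" by (rule norm_le_l1_cart)
      also have "\<dots> \<le> (\<Sum>i\<in>UNIV. sqrt (nsq (partial_deriv i k) * A))"
      proof (rule sum_mono)
        fix i
        have "\<bar>grad (convol k f) x $ i\<bar> = \<bar>convol (partial_deriv i k) f x\<bar>"
          by (simp add: partial_deriv_convol[OF Lp2_locally_integrable[OF f(1)] assms])
        also have "\<dots> \<le> sqrt (nsq (partial_deriv i k) * nsq f)"
          by (rule convol_bound[OF Cc_partial_deriv[OF assms] f(1)])
        also have "\<dots> \<le> sqrt (nsq (partial_deriv i k) * A)"
          by (intro real_sqrt_le_mono mult_left_mono f(2) nsq_nonneg)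
        finally show "\<bar>grad (convol k f) x $ i\<bar> \<le> sqrt (nsq (partial_deriv i k) * A)" .
      qed
      finally show ?thesis by (simp add: L_def)
    qed
    from smooth_diff_bound[OF smooth_convol[OF Lp2_locally_integrable[OF f(1)] assms] this]
    show "\<bar>convol k f y - convol k f x\<bar> \<le> max L 1 * norm (y - x)" .
  qed simp
qed

text \<open>The part of the Arzela-Ascoli argument that upgrades convergence on a dense set to
  convergence everywhere, by a common Lipschitz constant.\<close>

lemma convergent_from_dense:
  fixes F :: "nat \<Rightarrow> 'a::real_normed_vector \<Rightarrow> real"
  assumes "L > 0" and lip: "\<And>n x y. \<bar>F n y - F n x\<bar> \<le> L * norm (y - x)"
    and dense: "\<And>U. open U \<Longrightarrow> U \<noteq> {} \<Longrightarrow> \<exists>d\<in>D. d \<in> U" and conv: "\<And>d. d \<in> D \<Longrightarrow> convergent (\<lambda>n. F n d)"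
  shows "convergent (\<lambda>n. F n x)"
proof -
  have "Cauchy (\<lambda>n. F n x)"
  proof (rule CauchyI)
    fix e :: real assume "e > 0"
    have "x \<in> ball x (e / (4 * L))" using \<open>e > 0\<close> \<open>L > 0\<close> by simp
    then obtain d where d: "d \<in> D" "d \<in> ball x (e / (4 * L))"
      using dense[OF open_ball, of x "e / (4 * L)"] by blast
    have "L * norm (x - d) \<le> L * (e / (4 * L))"
      using d(2) \<open>L > 0\<close> by (intro mult_left_mono) (simp_all add: dist_norm)
    also have "\<dots> = e / 4" using \<open>L > 0\<close> by simp
    finally have Ld: "\<bar>F n x - F n d\<bar> \<le> e / 4" for n using lip[of n x d] by linarith
    from conv[OF d(1)] have "Cauchy (\<lambda>n. F n d)" by (simp add: Cauchy_convergent_iff)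
    from CauchyD[OF this, of "e / 4"] \<open>e > 0\<close>
    obtain M where M: "\<forall>m\<ge>M. \<forall>n\<ge>M. norm (F m d - F n d) < e / 4" by auto
    have "norm (F m x - F n x) < e" if "m \<ge> M" "n \<ge> M" for m n
    proof -
      have "norm (F m d - F n d) < e / 4" using M that by blast
      then show ?thesis using Ld[of m] Ld[of n] unfolding real_norm_def by linarith
    qed
    then show "\<exists>M. \<forall>m\<ge>M. \<forall>n\<ge>M. norm (F m x - F n x) < e" by blast
  qed
  then show ?thesis by (simp add: Cauchy_convergent_iff)
qed

lemma square_four_le: "(a + b + c + d)\<^sup>2 \<le> 4 * (a\<^sup>2 + b\<^sup>2 + c\<^sup>2 + d\<^sup>2)" for a b c d :: real
proof -
  have "0 \<le> (a - b)\<^sup>2 + (a - c)\<^sup>2 + (a - d)\<^sup>2 + (b - c)\<^sup>2 + (b - d)\<^sup>2 + (c - d)\<^sup>2" by simp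
  then show ?thesis by (simp add: power2_eq_square algebra_simps)
qed

context bump
begin

text \<open>Mollifying at a fixed scale turns an \<open>L\<^sup>2\<close>-bounded sequence into an equi-Lipschitz one, which
  converges along a subsequence; the mollification error is controlled by the gradients.\<close>

theorem Rellich:
  fixes u :: "nat \<Rightarrow> real^'n \<Rightarrow> real"
  assumes u: "\<And>n. u n \<in> Cc_infinity" "\<And>n. nsq (u n) \<le> A" "\<And>n. nsq (grad (u n)) \<le> A"
    and q: "q \<in> Cc_infinity" "\<And>x. 0 \<le> q x"
  obtains r where "strict_mono (r::nat\<Rightarrow>nat)"
    "\<And>e. e > 0 \<Longrightarrow> \<exists>N. \<forall>m\<ge>N. \<forall>n\<ge>N. (LINT x|lborel. q x * (u (r m) x - u (r n) x)\<^sup>2) < e"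
proof -
  have A: "A \<ge> 0" using u(2)[of 0] nsq_nonneg[of "u 0"] by linarith
  note uL = Cc_Lp2[OF u(1)]
  have [measurable]: "q \<in> borel_measurable borel" "u n \<in> borel_measurable borel" for n
    using q u by (auto intro: smooth_borel)
  obtain M where M: "M > 0" "\<And>x. \<bar>q x\<bar> \<le> M" using Cc_bounded[OF q(1)] by auto
  have "\<forall>j. \<exists>k::real^'n \<Rightarrow> real. mollifier (inverse (real (Suc j))) k"
    by (intro allI mollifier_exists) simp
  from choice[OF this] obtain k :: "nat \<Rightarrow> real^'n \<Rightarrow> real" where k: "\<And>j. mollifier (inverse (real (Suc j))) (k j)" by blast
  have kC: "k j \<in> Cc_infinity" for j using k[of j] by (simp add: mollifier_def)
  define K where "K j = sqrt (nsq (k j) * A)" for j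
  have K: "\<bar>convol (k j) (u n) x\<bar> \<le> K j" for j n x
    unfolding K_def
    by (rule order_trans[OF convol_bound[OF kC uL]]) (intro real_sqrt_le_mono mult_left_mono u nsq_nonneg)
  have K0: "K j \<ge> 0" for j using A by (simp add: K_def)
  obtain D :: "(real^'n) set" where D: "countable D" "\<And>U. open U \<Longrightarrow> U \<noteq> {} \<Longrightarrow> \<exists>d\<in>D. d \<in> U"
    using countable_dense_exists by metis
  \<comment> \<open>Pairs of a mollification scale and a point: one diagonal extraction then serves
    for all scales simultaneously.\<close>
  define S where "S = (UNIV :: nat set) \<times> D"
  have "countable S" using D(1) by (simp add: S_def)
  \<comment> \<open>The bound \<open>K\<close> varies with the scale, whereas the extraction needs
    one bound on all of \<open>S\<close>; dividing by \<open>1 + K\<close> normalises it to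
    1.\<close>
  define f where "f n p = convol (k (fst p)) (u n) (snd p) / (1 + K (fst p))" for n p
  have f1: "norm (f n p) \<le> 1" if "p \<in> S" for n p
    using K[of "fst p" n "snd p"] K0[of "fst p"] by (simp add: f_def)
  obtain r where r: "strict_mono (r::nat\<Rightarrow>nat)" "\<And>p. p \<in> S \<Longrightarrow> \<exists>l. (\<lambda>n. f (r n) p) \<longlonglongrightarrow> l"
    using function_convergent_subsequence[where f = f and M = 1, OF \<open>countable S\<close> f1] by blast
  define F where "F j n x = convol (k j) (u (r n)) x" for j n x
  have convD: "convergent (\<lambda>n. F j n d)" if "d \<in> D" for j d
  proof -
    have "convergent (\<lambda>n. f (r n) (j, d))" using r(2)[of "(j, d)"] that by (simp add: S_def convergent_def)
    then have "convergent (\<lambda>n. (1 + K j) * f (r n) (j, d))" by (intro convergent_mult convergent_const)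
    moreover have "(1 + K j) * f (r n) (j, d) = F j n d" for n
      using K0[of j] by (simp add: f_def F_def)
    ultimately show ?thesis by simp
  qed
  have conv: "convergent (\<lambda>n. F j n x)" for j x
  proof -
    obtain L where L: "L > 0" "\<And>f x y. f \<in> Lp 2 \<Longrightarrow> nsq f \<le> A \<Longrightarrow> \<bar>convol (k j) f y - convol (k j) f x\<bar> \<le> L * norm (y - x)"
      using convol_Lipschitz[OF kC[of j], of A] by blast
    have lip: "\<bar>F j n y - F j n x\<bar> \<le> L * norm (y - x)" for n x y
      unfolding F_def by (rule L(2)[OF uL u(2)])
    show ?thesis by (rule convergent_from_dense[OF L(1) lip D(2) convD])
  qed
  define v where "v j x = lim (\<lambda>n. F j n x)" for j x
  have v: "(\<lambda>n. F j n x) \<longlonglongrightarrow> v j x" for j x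
    using conv by (simp add: v_def convergent_LIMSEQ_iff)
  have vK: "\<bar>v j x\<bar> \<le> K j" for j x
    by (rule LIMSEQ_le_const2[OF tendsto_rabs[OF v]]) (use K in \<open>auto simp: F_def\<close>)
  have Fm [measurable]: "F j n \<in> borel_measurable borel" for j n
    unfolding F_def using smooth_convol[OF Lp2_locally_integrable[OF uL] kC] by (intro smooth_borel)
  have vm [measurable]: "v j \<in> borel_measurable borel" for j
    unfolding v_def by measurable
  define t where "t j n = (LINT x|lborel. q x * (F j n x - v j x)\<^sup>2)" for j n
  have bnd: "q x * (F j n x - v j x)\<^sup>2 \<le> q x * (2 * K j)\<^sup>2" for j n x
  proof (rule mult_left_mono[OF _ q(2)])
    have "\<bar>F j n x - v j x\<bar> \<le> \<bar>2 * K j\<bar>" using K[of j "r n" x] vK[of j x] unfolding F_def by linarith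
    then show "(F j n x - v j x)\<^sup>2 \<le> (2 * K j)\<^sup>2" by (simp only: abs_le_square_iff)
  qed
  have qi: "integrable lborel (\<lambda>x. q x * (2 * K j)\<^sup>2)" for j using Cc_integrable[OF q(1)] by simp
  have ti: "integrable lborel (\<lambda>x. q x * (F j n x - v j x)\<^sup>2)" for j n
  proof (rule Bochner_Integration.integrable_bound[OF qi])
    show "AE x in lborel. norm (q x * (F j n x - v j x)\<^sup>2) \<le> norm (q x * (2 * K j)\<^sup>2)"
      using bnd q(2) by (intro AE_I2) (simp add: abs_mult)
  qed simp
  have t: "(\<lambda>n. t j n) \<longlonglongrightarrow> 0" for j
  proof -
    have "(\<lambda>n. t j n) \<longlonglongrightarrow> (LINT x|(lborel :: (real^'n) measure). 0)"
      unfolding t_def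
    proof (rule integral_dominated_convergence[OF _ _ qi])
      show "AE x in lborel. (\<lambda>n. q x * (F j n x - v j x)\<^sup>2) \<longlonglongrightarrow> 0"
      proof (rule AE_I2)
        fix x
        have "(\<lambda>n. q x * (F j n x - v j x)\<^sup>2) \<longlonglongrightarrow> q x * (v j x - v j x)\<^sup>2" by (intro tendsto_intros v)
        then show "(\<lambda>n. q x * (F j n x - v j x)\<^sup>2) \<longlonglongrightarrow> 0" by simp
      qed
      show "AE x in lborel. norm (q x * (F j n x - v j x)\<^sup>2) \<le> q x * (2 * K j)\<^sup>2" for n
        using bnd q(2) by (intro AE_I2) (simp add: abs_mult)
    qed simp_all
    then show ?thesis by simp
  qed
  define s where "s j n = nsq (\<lambda>x. F j n x - u (r n) x)" for j n
  have s: "s j n \<le> (inverse (real (Suc j)))\<^sup>2 * A" for j n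
    unfolding s_def F_def
    by (rule order_trans[OF nsq_convol_diff_Cc[OF u(1) k]]) (intro mult_left_mono u zero_le_power2)
  have FuL: "(\<lambda>x. F j n x - u (r n) x) \<in> Lp 2" for j n
    unfolding F_def by (intro Lp2_diff convol_L2(1)[OF uL k] uL)
  have si: "integrable lborel (\<lambda>x. (F j n x - u (r n) x)\<^sup>2)" for j n
    using Lp2_integrable[OF FuL] by simp
  \<comment> \<open>The path from \<open>u (r m)\<close> to \<open>u (r n)\<close> leads through
    both mollified functions and their common limit \<open>v j\<close>; squaring four summands costs
    the factor 4.\<close>
  have main: "(LINT x|lborel. q x * (u (r m) x - u (r n) x)\<^sup>2) \<le> 4 * (M * s j m + t j m + t j n + M * s j n)" for j m n
  proof -
    have "(LINT x|lborel. q x * (u (r m) x - u (r n) x)\<^sup>2) \<le> (LINT x|lborel. 4 * (M * (F j m x - u (r m) x)\<^sup>2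
        + q x * (F j m x - v j x)\<^sup>2 + q x * (F j n x - v j x)\<^sup>2 + M * (F j n x - u (r n) x)\<^sup>2))"
    proof (rule integral_mono)
      have "(\<lambda>x. (u (r m) x - u (r n) x) * (u (r m) x - u (r n) x)) \<in> Cc_infinity"
        by (intro Cc_mult_smooth Cc_smooth Cc_diff u)
      from Cc_integrable[OF Cc_mult_smooth[OF Cc_smooth[OF q(1)] this]]
      show "integrable lborel (\<lambda>x. q x * (u (r m) x - u (r n) x)\<^sup>2)" by (simp add: power2_eq_square)
      show "integrable lborel (\<lambda>x. 4 * (M * (F j m x - u (r m) x)\<^sup>2
        + q x * (F j m x - v j x)\<^sup>2 + q x * (F j n x - v j x)\<^sup>2 + M * (F j n x - u (r n) x)\<^sup>2))"
        by (intro integrable_mult_right Bochner_Integration.integrable_add si ti)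
      fix x
      have "(u (r m) x - u (r n) x)\<^sup>2 = ((u (r m) x - F j m x) + (F j m x - v j x) + (v j x - F j n x) + (F j n x - u (r n) x))\<^sup>2"
        by simp
      also have "\<dots> \<le> 4 * ((F j m x - u (r m) x)\<^sup>2 + (F j m x - v j x)\<^sup>2 + (F j n x - v j x)\<^sup>2 + (F j n x - u (r n) x)\<^sup>2)"
        using square_four_le[of "u (r m) x - F j m x" "F j m x - v j x" "v j x - F j n x" "F j n x - u (r n) x"]
        by (simp add: power2_commute[of "u (r m) x"] power2_commute[of "v j x"])
      finally have "q x * (u (r m) x - u (r n) x)\<^sup>2
          \<le> q x * (4 * ((F j m x - u (r m) x)\<^sup>2 + (F j m x - v j x)\<^sup>2 + (F j n x - v j x)\<^sup>2 + (F j n x - u (r n) x)\<^sup>2))"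
        by (rule mult_left_mono[OF _ q(2)])
      also have "\<dots> = 4 * (q x * (F j m x - u (r m) x)\<^sup>2 + q x * (F j m x - v j x)\<^sup>2 + q x * (F j n x - v j x)\<^sup>2 + q x * (F j n x - u (r n) x)\<^sup>2)"
        by (simp add: distrib_left)
      also have "\<dots> \<le> 4 * (M * (F j m x - u (r m) x)\<^sup>2 + q x * (F j m x - v j x)\<^sup>2 + q x * (F j n x - v j x)\<^sup>2 + M * (F j n x - u (r n) x)\<^sup>2)"
        using M(2)[of x] by (intro mult_left_mono add_mono mult_right_mono order_refl) auto
      finally show "q x * (u (r m) x - u (r n) x)\<^sup>2 \<le> 4 * (M * (F j m x - u (r m) x)\<^sup>2
        + q x * (F j m x - v j x)\<^sup>2 + q x * (F j n x - v j x)\<^sup>2 + M * (F j n x - u (r n) x)\<^sup>2)" .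
    qed
    also have "\<dots> = 4 * (M * s j m + t j m + t j n + M * s j n)"
      using si ti by (simp add: s_def t_def nsq_def)
    finally show ?thesis .
  qed
  show ?thesis
  proof (rule that[OF r(1)])
    fix e :: real assume "e > 0"
    \<comment> \<open>The scale \<open>j\<close> is chosen first, as its error is uniform in the
      sequence index; \<open>N\<close> then depends on that one scale. The 8 is 4 times two
      mollification errors, and \<open>e / 16\<close> pays for 4 times two limit errors.\<close>
    have "(\<lambda>j. 8 * (M * ((inverse (real (Suc j)))\<^sup>2 * A))) \<longlonglongrightarrow> 8 * (M * (0\<^sup>2 * A))"
      by (intro tendsto_intros LIMSEQ_inverse_real_of_nat)
    then have "(\<lambda>j. 8 * (M * ((inverse (real (Suc j)))\<^sup>2 * A))) \<longlonglongrightarrow> 0" by simp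
    from order_tendstoD(2)[OF this, of "e / 2"] \<open>e > 0\<close> obtain j where
      j: "8 * (M * ((inverse (real (Suc j)))\<^sup>2 * A)) < e / 2" by (auto simp: eventually_sequentially)
    from order_tendstoD(2)[OF t[of j], of "e / 16"] \<open>e > 0\<close> obtain N where N: "\<And>n. n \<ge> N \<Longrightarrow> t j n < e / 16"
      by (auto simp: eventually_sequentially)
    have "(LINT x|lborel. q x * (u (r m) x - u (r n) x)\<^sup>2) < e" if "m \<ge> N" "n \<ge> N" for m n
    proof -
      have "M * s j m \<le> M * ((inverse (real (Suc j)))\<^sup>2 * A)" "M * s j n \<le> M * ((inverse (real (Suc j)))\<^sup>2 * A)"
        using s M(1) by (auto intro!: mult_left_mono)
      moreover define X where "X = M * ((inverse (real (Suc j)))\<^sup>2 * A)"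
      ultimately have "M * s j m \<le> X" "M * s j n \<le> X" by simp_all
      moreover have "8 * X < e / 2" using j by (simp only: X_def)
      moreover have "I < e" if "I \<le> 4 * (a + b + c + d)" "a \<le> X" "d \<le> X" "8 * X < e / 2" "b < e / 16" "c < e / 16"
        for I a b c d :: real using that by simp
      ultimately show ?thesis using main[of m n j] N[OF that(1)] N[OF that(2)] by blast
    qed
    then show "\<exists>N. \<forall>m\<ge>N. \<forall>n\<ge>N. (LINT x|lborel. q x * (u (r m) x - u (r n) x)\<^sup>2) < e" by blast
  qed
qed

end

subsection \<open>Existence of a negative eigenvalue\<close>

text \<open>Meant for the coordinate projections, which recover the limits of the separate entries
  of \<open>form_map\<close>.\<close>

lemma L2lim_contraction:
  assumes "L2lim F f" and p: "bounded_linear p" "\<And>v. norm (p v) \<le> norm v"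
  shows "L2lim (\<lambda>n x. p (F n x)) (\<lambda>x. p (f x))"
proof -
  have pm: "(\<lambda>x. p (g x)) \<in> borel_measurable borel" if "g \<in> borel_measurable borel" for g :: "real^'a \<Rightarrow> 'b"
    by (rule borel_measurable_continuous_on[OF linear_continuous_on[OF p(1)] that])
  have pL: "(\<lambda>x. p (g x)) \<in> Lp 2" "nsq (\<lambda>x. p (g x)) \<le> nsq g" if "g \<in> Lp 2" for g :: "real^'a \<Rightarrow> 'b"
    unfolding nsq_def[of g]
    by (rule nsq_bounded_square[OF pm[OF Lp2_measurable[OF that]] Lp2_integrable[OF that]];
      intro power_mono p norm_ge_zero)+
  note L = L2lim_Lp[OF assms(1)]
  have "(\<lambda>n. nsq (\<lambda>x. p (F n x) - p (f x))) \<longlonglongrightarrow> 0"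
  proof (rule LIMSEQ_0_le[OF nsq_nonneg])
    show "nsq (\<lambda>x. p (F n x) - p (f x)) \<le> nsq (\<lambda>x. F n x - f x)" for n
      using pL(2)[OF Lp2_diff[OF L(1) L(2)]] by (simp add: linear_diff[OF bounded_linear.linear[OF p(1)]])
    show "(\<lambda>n. nsq (\<lambda>x. F n x - f x)) \<longlonglongrightarrow> 0" using assms(1) by (simp add: L2lim_def)
  qed
  then show ?thesis using pL(1)[OF L(1)] pL(1)[OF L(2)] by (simp add: L2lim_def)
qed

lemma L2lim_scaleR:
  assumes "L2lim F f"
  shows "L2lim (\<lambda>n x. c *\<^sub>R F n x) (\<lambda>x. c *\<^sub>R f x)"
proof -
  have "(\<lambda>n. c\<^sup>2 * nsq (\<lambda>x. F n x - f x)) \<longlonglongrightarrow> c\<^sup>2 * 0"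
    using assms by (intro tendsto_intros) (simp add: L2lim_def)
  then show ?thesis using assms
    by (simp add: L2lim_def Lp2_scaleR nsq_def power_mult_distrib flip: scaleR_diff_right)
qed

text \<open>Encodes the form norm of \<open>-\<Delta> + P + c\<close> as an \<open>L\<^sup>2\<close> norm, so that completeness of \<open>L\<^sup>2\<close> applies.\<close>

definition form_map ::
    "(real^'n::finite \<Rightarrow> real) \<Rightarrow> real \<Rightarrow> (real^'n \<Rightarrow> real) \<Rightarrow> real^'n \<Rightarrow> (real^'n) \<times> real \<times> real" where
  "form_map P c u x = (grad u x, sqrt (P x) * u x, sqrt c * u x)"

lemma form_map_add:
  "smooth u \<Longrightarrow> smooth v \<Longrightarrow> form_map P c (\<lambda>x. u x + t * v x) x = form_map P c u x + t *\<^sub>R form_map P c v x"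
  by (simp add: form_map_def grad_add grad_cmul smooth_mult algebra_simps)

context
  fixes P :: "real^'n::finite \<Rightarrow> real" and c :: real
  assumes P: "locally_integrable P" "\<And>x. 0 \<le> P x" and c: "0 \<le> c"
begin

lemma P_borel [measurable]: "P \<in> borel_measurable borel"
  by (rule locally_integrable_measurable[OF P(1)])

lemma potential_integrable:
  assumes "u \<in> Cc_infinity" "v \<in> Cc_infinity"
  shows "integrable lborel (\<lambda>x. P x * (u x * v x))"
  using Cc_mult_integrable[OF P(1) Cc_mult_smooth[OF Cc_smooth[OF assms(1)] assms(2)]] by (simp add: mult.commute)

lemma potential_Lp2:
  assumes "u \<in> Cc_infinity"
  shows "(\<lambda>x. sqrt (P x) * u x) \<in> Lp 2"
proof -
  have [measurable]: "u \<in> borel_measurable borel" using assms by (auto intro: smooth_borel)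
  have "(norm (sqrt (P x) * u x))\<^sup>2 = P x * (u x * u x)" for x
    using P(2) by (simp add: power_mult_distrib power2_eq_square)
  then show ?thesis using potential_integrable[OF assms assms] by (simp add: Lp_def)
qed

lemma form_map_Lp2:
  assumes "u \<in> Cc_infinity"
  shows "form_map P c u \<in> Lp 2"
proof -
  note L = Cc_grad_Lp2[OF assms] potential_Lp2[OF assms] Cc_Lp2[OF assms]
  note [measurable] = L[THEN Lp2_measurable]
  have "(norm (form_map P c u x))\<^sup>2 = (norm (grad u x))\<^sup>2 + (norm (sqrt (P x) * u x))\<^sup>2 + c * (norm (u x))\<^sup>2" for x
    using c by (simp add: form_map_def norm_Pair power_mult_distrib)
  moreover have "integrable lborel (\<lambda>x. (norm (grad u x))\<^sup>2 + (norm (sqrt (P x) * u x))\<^sup>2 + c * (norm (u x))\<^sup>2)"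
    using L[THEN Lp2_integrable] by (intro Bochner_Integration.integrable_add integrable_mult_right)
  moreover have "form_map P c u \<in> borel_measurable borel"
    unfolding form_map_def[abs_def] using L[THEN Lp2_measurable]
    by (intro borel_measurable_Pair borel_measurable_times) simp_all
  ultimately show ?thesis by (simp add: Lp_def)
qed

lemma ip_form_map:
  assumes "u \<in> Cc_infinity" "v \<in> Cc_infinity"
  shows "ip (form_map P c u) (form_map P c v)
    = ip (grad u) (grad v) + (LINT x|lborel. P x * (u x * v x)) + c * ip u v"
proof -
  have "form_map P c u x \<bullet> form_map P c v x = grad u x \<bullet> grad v x + P x * (u x * v x) + c * (u x \<bullet> v x)" for x
  proof -
    have "sqrt a * y * (sqrt a * z) = a * (y * z)" if "a \<ge> 0" for a y z :: real
    proof -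
      have "sqrt a * y * (sqrt a * z) = (sqrt a * sqrt a) * (y * z)" by (simp only: mult_ac)
      then show ?thesis using that by simp
    qed
    from this[OF P(2), of x "u x" "v x"] this[OF c, of "u x" "v x"] show ?thesis
      unfolding form_map_def inner_prod_def fst_conv snd_conv inner_real_def by linarith
  qed
  then show ?thesis
    using Lp2_inner_integrable[OF Cc_grad_Lp2[OF assms(1)] Cc_grad_Lp2[OF assms(2)]]
      Lp2_inner_integrable[OF Cc_Lp2[OF assms(1)] Cc_Lp2[OF assms(2)]] potential_integrable[OF assms]
    by (simp add: ip_def)
qed

lemma nsq_form_map:
  "u \<in> Cc_infinity \<Longrightarrow> nsq (form_map P c u) = nsq (grad u) + (LINT x|lborel. P x * (u x)\<^sup>2) + c * nsq u"
  using ip_form_map[of u u] by (simp add: nsq_ip power2_eq_square)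

lemma nsq_form_map_add:
  assumes "u \<in> Cc_infinity" "v \<in> Cc_infinity"
  shows "nsq (form_map P c (\<lambda>x. u x + t * v x))
    = nsq (form_map P c u) + 2 * t * ip (form_map P c u) (form_map P c v) + t\<^sup>2 * nsq (form_map P c v)"
proof -
  have "form_map P c (\<lambda>x. u x + t * v x) = (\<lambda>x. form_map P c u x + t *\<^sub>R form_map P c v x)"
    by (rule ext) (rule form_map_add[OF Cc_smooth[OF assms(1)] Cc_smooth[OF assms(2)]])
  then show ?thesis
    by (simp only: nsq_add_scaleR[OF form_map_Lp2[OF assms(1)] form_map_Lp2[OF assms(2)]])
qed

end

text \<open>The infimum of the Rayleigh quotient, here \<open>- \<kappa>\<close>, is approached by a sequence normalised in the
  compact form \<open>\<integral> q u\<^sup>2\<close> rather than in \<open>L\<^sup>2\<close>.\<close>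

lemma minimizing_sequence:
  fixes P q u0 :: "real^'n::finite \<Rightarrow> real"
  assumes P: "locally_integrable P" "\<And>x. 0 \<le> P x" and q: "q \<in> Cc_infinity" "\<And>x. 0 \<le> q x"
    and u0: "u0 \<in> Cc_infinity"
      "nsq (grad u0) + (LINT x|lborel. P x * (u0 x)\<^sup>2) < (LINT x|lborel. q x * (u0 x)\<^sup>2)"
  obtains \<kappa> u where "\<kappa> > 0" "\<And>n. u n \<in> Cc_infinity" "\<And>n. nsq (u n) \<le> 2 / \<kappa>"
    "\<And>v. v \<in> Cc_infinity \<Longrightarrow> (LINT x|lborel. q x * (v x)\<^sup>2) \<le> nsq (form_map P \<kappa> v)"
    "\<And>n. (LINT x|lborel. q x * (u n x)\<^sup>2) = 1"
    "(\<lambda>n. nsq (form_map P \<kappa> (u n))) \<longlonglongrightarrow> 1"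
proof -
  define E where "E u = nsq (grad u) + (LINT x|lborel. P x * (u x)\<^sup>2)" for u
  define B where "B u = (LINT x|lborel. q x * (u x)\<^sup>2)" for u
  have E0: "E u \<ge> 0" for u
    unfolding E_def using P(2) by (intro add_nonneg_nonneg nsq_nonneg integral_nonneg_AE) simp
  have qloc: "locally_integrable q" by (rule Lp2_locally_integrable[OF Cc_Lp2[OF q(1)]])
  obtain M where M: "M > 0" "\<And>x. \<bar>q x\<bar> \<le> M" using Cc_bounded[OF q(1)] by auto
  have BM: "B u \<le> M * nsq u" if "u \<in> Cc_infinity" for u
  proof -
    have "B u \<le> (LINT x|lborel. M * (norm (u x))\<^sup>2)" unfolding B_def
    proof (rule integral_mono)
      show "integrable lborel (\<lambda>x. q x * (u x)\<^sup>2)"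
        using potential_integrable[OF qloc q(2) order_refl that that] by (simp add: power2_eq_square)
      show "q x * (u x)\<^sup>2 \<le> M * (norm (u x))\<^sup>2" for x
        using M(2)[of x] by (auto intro!: mult_right_mono)
    qed (use Lp2_integrable[OF Cc_Lp2[OF that]] in simp)
    then show ?thesis by (simp add: nsq_def)
  qed
  \<comment> \<open>Negated Rayleigh quotients: bounded above since \<open>q\<close> is bounded and
    \<open>E\<close> nonnegative, and positive at \<open>u0\<close>.\<close>
  define X where "X = {(B u - E u) / nsq u | u. u \<in> Cc_infinity \<and> nsq u > 0}"
  have bdd: "bdd_above X"
  proof (rule bdd_aboveI)
    fix y assume "y \<in> X"
    then obtain u where u: "u \<in> Cc_infinity" "nsq u > 0" "y = (B u - E u) / nsq u" by (auto simp: X_def)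
    then show "y \<le> M" using BM[OF u(1)] E0[of u] by (simp add: divide_le_eq)
  qed
  have EB0: "E u0 < B u0" using u0(2) by (simp add: E_def B_def)
  have n0: "nsq u0 > 0"
  proof (rule ccontr)
    assume "\<not> nsq u0 > 0"
    then have "nsq u0 = 0" using nsq_nonneg[of u0] by linarith
    then show False using BM[OF u0(1)] E0[of u0] EB0 by simp
  qed
  define \<kappa> where "\<kappa> = Sup X"
  have inX: "(B u0 - E u0) / nsq u0 \<in> X" using u0(1) n0 by (auto simp: X_def)
  have "0 < (B u0 - E u0) / nsq u0" using EB0 n0 by simp
  also have "\<dots> \<le> \<kappa>" unfolding \<kappa>_def by (rule cSup_upper[OF inX bdd])
  finally have \<kappa>: "\<kappa> > 0" .
  have form: "nsq (form_map P \<kappa> v) = E v + \<kappa> * nsq v" if "v \<in> Cc_infinity" for v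
    using nsq_form_map[OF P less_imp_le[OF \<kappa>] that] by (simp add: E_def)
  have le: "B v \<le> nsq (form_map P \<kappa> v)" if v: "v \<in> Cc_infinity" for v
  proof (cases "nsq v > 0")
    case True
    then have "(B v - E v) / nsq v \<in> X" using v by (auto simp: X_def)
    then have "(B v - E v) / nsq v \<le> \<kappa>" unfolding \<kappa>_def by (rule cSup_upper[OF _ bdd])
    then show ?thesis using True by (simp add: form[OF v] divide_le_eq)
  next
    case False
    then have "nsq v = 0" using nsq_nonneg[of v] by linarith
    then show ?thesis using BM[OF v] E0[of v] by (simp add: form[OF v])
  qed
  \<comment> \<open>A slack that tends to 0 but never exceeds \<open>\<kappa> / 2\<close>: the
    coefficient \<open>\<kappa> - d n\<close> stays at least \<open>\<kappa> / 2\<close>, which is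
    where the L2 bound \<open>2 / \<kappa>\<close> comes from.\<close>
  define d where "d n = \<kappa> * inverse (real (Suc n)) / 2" for n
  have d: "0 < d n" "d n \<le> \<kappa> / 2" for n
    using \<kappa> by (auto simp: d_def mult_left_le inverse_le_1_iff)
  have "\<exists>u. u \<in> Cc_infinity \<and> B u = 1 \<and> E u + (\<kappa> - d n) * nsq u \<le> 1" for n
  proof -
    have "\<kappa> - d n < Sup X" using d[of n] by (simp add: \<kappa>_def[symmetric])
    then obtain y where "y \<in> X" "\<kappa> - d n < y" using less_cSup_iff[OF _ bdd] inX by blast
    then obtain v where v: "v \<in> Cc_infinity" "nsq v > 0" "\<kappa> - d n < (B v - E v) / nsq v" by (auto simp: X_def)
    have v': "E v + (\<kappa> - d n) * nsq v \<le> B v" using v(2,3) by (simp add: less_divide_eq)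
    have "(\<kappa> - d n) * nsq v > 0" using v(2) d[of n] \<kappa> by (intro mult_pos_pos) auto
    then have Bv: "B v > 0" using v' E0[of v] by linarith
    \<comment> \<open>Normalisation in \<open>B\<close> is possible because near-optimality forces
      \<open>B v > 0\<close>.\<close>
    define s where "s = 1 / sqrt (B v)"
    have s2: "s\<^sup>2 = 1 / B v" using Bv by (simp add: s_def power_divide)
    let ?u = "\<lambda>x. s * v x"
    have sc: "B ?u = s\<^sup>2 * B v" "E ?u = s\<^sup>2 * E v" "nsq ?u = s\<^sup>2 * nsq v"
    proof -
      have "B ?u = (LINT x|lborel. s\<^sup>2 * (q x * (v x)\<^sup>2))"
        unfolding B_def by (intro Bochner_Integration.integral_cong refl) (simp add: power_mult_distrib)
      then show "B ?u = s\<^sup>2 * B v" by (simp add: B_def)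
      have "(LINT x|lborel. P x * (?u x)\<^sup>2) = (LINT x|lborel. s\<^sup>2 * (P x * (v x)\<^sup>2))"
        by (intro Bochner_Integration.integral_cong refl) (simp add: power_mult_distrib)
      moreover have "nsq (grad ?u) = s\<^sup>2 * nsq (grad v)"
        unfolding nsq_def by (simp add: grad_cmul[OF Cc_smooth[OF v(1)]] power_mult_distrib)
      ultimately show "E ?u = s\<^sup>2 * E v" by (simp add: E_def distrib_left)
      show "nsq ?u = s\<^sup>2 * nsq v" by (simp add: nsq_def power_mult_distrib)
    qed
    have "E ?u + (\<kappa> - d n) * nsq ?u = s\<^sup>2 * (E v + (\<kappa> - d n) * nsq v)"
      unfolding sc by (simp add: algebra_simps)
    also have "\<dots> \<le> s\<^sup>2 * B v" by (intro mult_left_mono v') simp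
    also have "\<dots> = 1" using Bv by (simp add: s2)
    finally have "E ?u + (\<kappa> - d n) * nsq ?u \<le> 1" .
    moreover have "B ?u = 1" using Bv by (simp add: sc s2)
    ultimately show ?thesis using Cc_cmul[OF v(1)] by blast
  qed
  then have "\<forall>n. \<exists>u. u \<in> Cc_infinity \<and> B u = 1 \<and> E u + (\<kappa> - d n) * nsq u \<le> 1" by blast
  from choice[OF this] obtain u where "\<forall>n. u n \<in> Cc_infinity \<and> B (u n) = 1 \<and> E (u n) + (\<kappa> - d n) * nsq (u n) \<le> 1" by blast
  then have u: "u n \<in> Cc_infinity" "B (u n) = 1" "E (u n) + (\<kappa> - d n) * nsq (u n) \<le> 1" for n by auto
  have nu: "nsq (u n) \<le> 2 / \<kappa>" for n
  proof -
    have "(\<kappa> / 2) * nsq (u n) \<le> (\<kappa> - d n) * nsq (u n)" using d[of n] by (intro mult_right_mono nsq_nonneg) auto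
    also have "\<dots> \<le> 1" using u(3)[of n] E0[of "u n"] by linarith
    finally show ?thesis using \<kappa> by (simp add: field_simps)
  qed
  have lim: "(\<lambda>n. nsq (form_map P \<kappa> (u n))) \<longlonglongrightarrow> 1"
  proof (rule tendsto_sandwich[OF _ _ tendsto_const])
    show "\<forall>\<^sub>F n in sequentially. 1 \<le> nsq (form_map P \<kappa> (u n))"
      using le[OF u(1)] u(2) by (intro always_eventually allI) simp
    have "nsq (form_map P \<kappa> (u n)) \<le> 1 + inverse (real (Suc n))" for n
    proof -
      have "nsq (form_map P \<kappa> (u n)) = (E (u n) + (\<kappa> - d n) * nsq (u n)) + d n * nsq (u n)"
        by (simp add: form[OF u(1)] algebra_simps)
      also have "\<dots> \<le> 1 + d n * (2 / \<kappa>)"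
        using d(1)[of n] by (intro add_mono u(3) mult_left_mono nu) simp
      also have "d n * (2 / \<kappa>) = inverse (real (Suc n))" using \<kappa> by (simp add: d_def)
      finally show ?thesis .
    qed
    then show "\<forall>\<^sub>F n in sequentially. nsq (form_map P \<kappa> (u n)) \<le> 1 + inverse (real (Suc n))"
      by (intro always_eventually allI)
    show "(\<lambda>n. 1 + inverse (real (Suc n))) \<longlonglongrightarrow> 1"
      using tendsto_add[OF tendsto_const[of 1] LIMSEQ_inverse_real_of_nat] by simp
  qed
  show ?thesis
    by (rule that[of \<kappa> u, OF \<kappa> u(1) nu le[unfolded B_def] u(2)[unfolded B_def] lim])
qed

text \<open>A normalised minimizing sequence is Cauchy in the form norm: by the parallelogram law the nonnegative
  form \<open>Q = a - \<integral> q u\<^sup>2\<close> of a difference is at most \<open>2 Q u + 2 Q v\<close>, and the compact part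
  converges along a subsequence.\<close>

lemma (in bump) minimizing_sequence_convergent:
  fixes P q u0 :: "real^'n \<Rightarrow> real"
  assumes P: "locally_integrable P" "\<And>x. 0 \<le> P x" and q: "q \<in> Cc_infinity" "\<And>x. 0 \<le> q x"
    and u0: "u0 \<in> Cc_infinity"
      "nsq (grad u0) + (LINT x|lborel. P x * (u0 x)\<^sup>2) < (LINT x|lborel. q x * (u0 x)\<^sup>2)"
  obtains \<kappa> w F where "\<kappa> > 0" "\<And>n. w n \<in> Cc_infinity" "L2lim (\<lambda>n. form_map P \<kappa> (w n)) F"
    "\<And>n. (LINT x|lborel. q x * (w n x)\<^sup>2) = 1"
    "\<And>v. v \<in> Cc_infinity \<Longrightarrow>
      (\<lambda>n. ip (form_map P \<kappa> (w n)) (form_map P \<kappa> v) - (LINT x|lborel. q x * (w n x * v x))) \<longlonglongrightarrow> 0"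
proof -
  obtain \<kappa> u where \<kappa>: "\<kappa> > 0" and u: "\<And>n. u n \<in> Cc_infinity" "\<And>n. nsq (u n) \<le> 2 / \<kappa>"
    and le: "\<And>v. v \<in> Cc_infinity \<Longrightarrow> (LINT x|lborel. q x * (v x)\<^sup>2) \<le> nsq (form_map P \<kappa> v)"
    and B1: "\<And>n. (LINT x|lborel. q x * (u n x)\<^sup>2) = 1"
    and lim: "(\<lambda>n. nsq (form_map P \<kappa> (u n))) \<longlonglongrightarrow> 1"
    using minimizing_sequence[OF P q u0] by blast
  have \<kappa>0: "0 \<le> \<kappa>" using \<kappa> by simp
  have qloc: "locally_integrable q" by (rule Lp2_locally_integrable[OF Cc_Lp2[OF q(1)]])
  define S where "S = form_map P \<kappa>"
  define \<beta> where "\<beta> v w = (LINT x|lborel. q x * (v x * w x))" for v w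
  note S_add = nsq_form_map_add[OF P \<kappa>0, folded S_def]
  note SL = form_map_Lp2[OF P \<kappa>0, folded S_def]
  have \<beta>_add: "\<beta> (\<lambda>x. v x + t * w x) (\<lambda>x. v x + t * w x) = \<beta> v v + 2 * t * \<beta> v w + t\<^sup>2 * \<beta> w w"
    if "v \<in> Cc_infinity" "w \<in> Cc_infinity" for v w t
  proof -
    note i = potential_integrable[OF qloc q(2) \<kappa>0 that(1) that(1)] potential_integrable[OF qloc q(2) \<kappa>0 that]
      potential_integrable[OF qloc q(2) \<kappa>0 that(2) that(2)]
    have "\<beta> (\<lambda>x. v x + t * w x) (\<lambda>x. v x + t * w x) =
        (LINT x|lborel. q x * (v x * v x) + 2 * t * (q x * (v x * w x)) + t\<^sup>2 * (q x * (w x * w x)))"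
      unfolding \<beta>_def by (intro Bochner_Integration.integral_cong refl) (simp add: power2_eq_square algebra_simps)
    also have "\<dots> = \<beta> v v + 2 * t * \<beta> v w + t\<^sup>2 * \<beta> w w" using i by (simp add: \<beta>_def)
    finally show ?thesis .
  qed
  define Q where "Q v = nsq (S v) - \<beta> v v" for v
  have Q0: "Q v \<ge> 0" if "v \<in> Cc_infinity" for v
    using le[OF that] by (simp add: Q_def S_def \<beta>_def power2_eq_square)
  have Q_add: "Q (\<lambda>x. v x + t * w x) = Q v + 2 * t * (ip (S v) (S w) - \<beta> v w) + t\<^sup>2 * Q w"
    if "v \<in> Cc_infinity" "w \<in> Cc_infinity" for v w t
    unfolding Q_def S_add[OF that] \<beta>_add[OF that] by (simp add: algebra_simps)
  have add_Cc: "(\<lambda>x. v x + t * w x) \<in> Cc_infinity" if "v \<in> Cc_infinity" "w \<in> Cc_infinity" for v w :: "real^'n \<Rightarrow> real" and t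
    using that by (intro Cc_add Cc_cmul)
  have Qu: "(\<lambda>n. Q (u n)) \<longlonglongrightarrow> 0"
    using tendsto_diff[OF lim tendsto_const[of 1]] B1 by (simp add: Q_def S_def \<beta>_def power2_eq_square)
  have "Bseq (\<lambda>n. nsq (S (u n)))" using lim by (simp add: S_def convergentI convergent_imp_Bseq)
  then obtain A where A: "\<And>n. nsq (S (u n)) \<le> A" unfolding Bseq_def by (auto simp: abs_le_iff)
  \<comment> \<open>The remaining terms of the form are nonnegative, so its bound passes to the
    gradients, as Rellich requires.\<close>
  have g: "nsq (grad (u n)) \<le> max A (2 / \<kappa>)" for n
  proof -
    have "0 \<le> (LINT x|lborel. P x * (u n x)\<^sup>2)" using P(2) by (intro integral_nonneg_AE) simp
    moreover have "0 \<le> \<kappa> * nsq (u n)" using \<kappa>0 by simp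
    ultimately show ?thesis using A[of n] nsq_form_map[OF P \<kappa>0 u(1)[of n]] by (simp add: S_def)
  qed
  have n2: "nsq (u n) \<le> max A (2 / \<kappa>)" for n using u(2)[of n] by simp
  obtain r where r: "strict_mono (r::nat\<Rightarrow>nat)"
    "\<And>e. e > 0 \<Longrightarrow> \<exists>N. \<forall>m\<ge>N. \<forall>n\<ge>N. (LINT x|lborel. q x * (u (r m) x - u (r n) x)\<^sup>2) < e"
    by (rule Rellich[OF u(1) n2 g q]) (rule that)
  define w where "w n = u (r n)" for n
  have w: "w n \<in> Cc_infinity" for n by (simp add: w_def u(1))
  have Qw: "(\<lambda>n. Q (w n)) \<longlonglongrightarrow> 0"
    using LIMSEQ_subseq_LIMSEQ[OF Qu r(1)] by (simp add: w_def o_def)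
  have S_diff: "nsq (\<lambda>x. S (w m) x - S (w n) x) \<le> 2 * Q (w m) + 2 * Q (w n) + (LINT x|lborel. q x * (w m x - w n x)\<^sup>2)" for m n
  proof -
    have "S (\<lambda>x. w m x - w n x) = (\<lambda>x. S (w m) x - S (w n) x)"
      using form_map_add[OF Cc_smooth[OF w[of m]] Cc_smooth[OF w[of n]], of P \<kappa> "-1"] by (simp add: S_def fun_eq_iff)
    then have "nsq (\<lambda>x. S (w m) x - S (w n) x) = Q (\<lambda>x. w m x - w n x) + (LINT x|lborel. q x * (w m x - w n x)\<^sup>2)"
      by (simp add: Q_def \<beta>_def power2_eq_square)
    moreover have "Q (\<lambda>x. w m x - w n x) = 2 * Q (w m) + 2 * Q (w n) - Q (\<lambda>x. w m x + 1 * w n x)"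
      using Q_add[OF w[of m] w[of n], of 1] Q_add[OF w[of m] w[of n], of "-1"] by simp
    moreover have "Q (\<lambda>x. w m x + 1 * w n x) \<ge> 0" by (rule Q0[OF add_Cc[OF w w]])
    ultimately show ?thesis by linarith
  qed
  obtain F where F: "L2lim (\<lambda>n. S (w n)) F"
  proof (rule L2_complete)
    show "S (w n) \<in> Lp 2" for n by (rule SL[OF w])
    fix e :: real assume "e > 0"
    then have e: "e / 8 > 0" "e / 4 > 0" by simp_all
    from order_tendstoD(2)[OF Qw e(1)] obtain N1 where N1: "\<And>n. n \<ge> N1 \<Longrightarrow> Q (w n) < e / 8"
      by (auto simp: eventually_sequentially)
    from r(2)[OF e(2)] obtain N2 where N2: "\<forall>m\<ge>N2. \<forall>n\<ge>N2. (LINT x|lborel. q x * (w m x - w n x)\<^sup>2) < e / 4"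
      by (auto simp: w_def)
    have "nsq (\<lambda>x. S (w m) x - S (w n) x) < e" if "m \<ge> max N1 N2" "n \<ge> max N1 N2" for m n
    proof -
      have 1: "Q (w m) < e / 8" "Q (w n) < e / 8" using N1 that by auto
      have 2: "(LINT x|lborel. q x * (w m x - w n x)\<^sup>2) < e / 4" using N2 that by auto
      show ?thesis using S_diff[of m n] 1 2 \<open>e > 0\<close> by linarith
    qed
    then show "\<exists>N. \<forall>m\<ge>N. \<forall>n\<ge>N. nsq (\<lambda>x. S (w m) x - S (w n) x) < e" by blast
  qed
  \<comment> \<open>Cauchy-Schwarz for the nonnegative form \<open>Q\<close> bounds the square of
    its mixed term by \<open>Q (w n) * Q v\<close>. As \<open>Q (w n)\<close> tends to 0, the
    Euler-Lagrange equation holds in the limit.\<close>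
  have EL: "(\<lambda>n. ip (S (w n)) (S v) - \<beta> (w n) v) \<longlonglongrightarrow> 0" if v: "v \<in> Cc_infinity" for v
  proof -
    have "(ip (S (w n)) (S v) - \<beta> (w n) v)\<^sup>2 \<le> Q (w n) * Q v" for n
      by (rule quadratic_nonneg_discrim) (use Q0[OF add_Cc[OF w v]] Q_add[OF w v] in simp)
    moreover have "(\<lambda>n. Q (w n) * Q v) \<longlonglongrightarrow> 0" using tendsto_mult[OF Qw tendsto_const[of "Q v"]] by simp
    ultimately have "(\<lambda>n. (ip (S (w n)) (S v) - \<beta> (w n) v)\<^sup>2) \<longlonglongrightarrow> 0"
      by (intro LIMSEQ_0_le[of "\<lambda>n. (ip (S (w n)) (S v) - \<beta> (w n) v)\<^sup>2"]) auto
    from tendsto_real_sqrt[OF this] show ?thesis by (simp add: tendsto_rabs_zero_iff)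
  qed
  show ?thesis
  proof (rule that[OF \<kappa> w])
    show "L2lim (\<lambda>n. form_map P \<kappa> (w n)) F" using F by (simp add: S_def)
    show "(LINT x|lborel. q x * (w n x)\<^sup>2) = 1" for n using B1 by (simp add: w_def)
    show "(\<lambda>n. ip (form_map P \<kappa> (w n)) (form_map P \<kappa> v) - (LINT x|lborel. q x * (w n x * v x))) \<longlonglongrightarrow> 0"
      if "v \<in> Cc_infinity" for v using EL[OF that] by (simp add: S_def \<beta>_def)
  qed
qed

section \<open>The limit as an eigenfunction\<close>

lemma weak_gradient_laplacian:
  assumes \<psi>: "has_weak_gradient \<psi> G" and \<eta>: "\<eta> \<in> Cc_infinity"
  shows "(LINT x|lborel. \<psi> x * laplacian \<eta> x) = - ip G (grad \<eta>)"
proof -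
  have \<psi>L: "locally_integrable \<psi>" using \<psi> by (simp add: has_weak_gradient_def)
  have pC: "partial_deriv i \<eta> \<in> Cc_infinity" for i using \<eta> by auto
  have gi: "integrable lborel (\<lambda>x. G x $ i * partial_deriv i \<eta> x)" for i
    using Cc_mult_integrable[OF has_weak_gradient_nth[OF \<psi>, of i] pC[of i]] by (simp add: mult.commute)
  have pi: "integrable lborel (\<lambda>x. \<psi> x * partial_deriv i (partial_deriv i \<eta>) x)" for i
    using Cc_mult_integrable[OF \<psi>L Cc_partial_deriv[OF pC[of i], of i]] by (simp add: mult.commute)
  have wk: "(LINT x|lborel. \<psi> x * partial_deriv i (partial_deriv i \<eta>) x) = - (LINT x|lborel. G x $ i * partial_deriv i \<eta> x)" for i
    using \<psi> pC[of i] by (simp add: has_weak_gradient_def)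
  have "(LINT x|lborel. \<psi> x * laplacian \<eta> x) = (LINT x|lborel. (\<Sum>i\<in>UNIV. \<psi> x * partial_deriv i (partial_deriv i \<eta>) x))"
    by (simp add: laplacian_def sum_distrib_left)
  also have "\<dots> = (\<Sum>i\<in>UNIV. LINT x|lborel. \<psi> x * partial_deriv i (partial_deriv i \<eta>) x)"
    by (rule Bochner_Integration.integral_sum[OF pi])
  also have "\<dots> = - (\<Sum>i\<in>UNIV. LINT x|lborel. G x $ i * partial_deriv i \<eta> x)"
    by (simp add: wk sum_negf)
  also have "(\<Sum>i\<in>UNIV. LINT x|lborel. G x $ i * partial_deriv i \<eta> x) = (LINT x|lborel. (\<Sum>i\<in>UNIV. G x $ i * partial_deriv i \<eta> x))"
    by (rule Bochner_Integration.integral_sum[OF gi, symmetric])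
  also have "\<dots> = ip G (grad \<eta>)" by (simp add: ip_def inner_vec_def)
  finally show ?thesis .
qed

text \<open>The limit of the triples \<open>form_map\<close> consists of a gradient, of
  \<open>sqrt P\<close> times and of \<open>sqrt \<kappa>\<close> times one and the same function
  \<open>\<psi>\<close>. The Euler-Lagrange relation passes to the limit and is the weak equation
  with eigenvalue \<open>- \<kappa>\<close>.\<close>

theorem negative_eigenvalue_exists:
  fixes P q u0 :: "real^3 \<Rightarrow> real"
  assumes b: "bump b (x0 :: real^3)"
    and P: "locally_integrable P" "\<And>x. 0 \<le> P x" and q: "q \<in> Cc_infinity" "\<And>x. 0 \<le> q x"
    and u0: "u0 \<in> Cc_infinity"
      "nsq (grad u0) + (LINT x|lborel. P x * (u0 x)\<^sup>2) < (LINT x|lborel. q x * (u0 x)\<^sup>2)"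
  shows "\<exists>\<mu><0. schrodinger_eigenvalue (\<lambda>x. - q x + P x) \<mu>"
proof -
  interpret bump b x0 by fact
  obtain \<kappa> w F where \<kappa>: "\<kappa> > 0" and w: "\<And>n. w n \<in> Cc_infinity" and F: "L2lim (\<lambda>n. form_map P \<kappa> (w n)) F"
    and B1: "\<And>n. (LINT x|lborel. q x * (w n x)\<^sup>2) = 1"
    and EL: "\<And>v. v \<in> Cc_infinity \<Longrightarrow>
      (\<lambda>n. ip (form_map P \<kappa> (w n)) (form_map P \<kappa> v) - (LINT x|lborel. q x * (w n x * v x))) \<longlonglongrightarrow> 0"
    using minimizing_sequence_convergent[OF P q u0] by blast
  have \<kappa>0: "0 \<le> \<kappa>" using \<kappa> by simp
  define G where "G x = fst (F x)" for x
  define H where "H x = fst (snd (F x))" for x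
  \<comment> \<open>The third entry of \<open>form_map\<close> carries the factor
    \<open>sqrt \<kappa>\<close>, which is divided out; this is possible since
    \<open>\<kappa>\<close> is strictly positive.\<close>
  define \<psi> where "\<psi> x = (1 / sqrt \<kappa>) *\<^sub>R snd (snd (F x))" for x
  have nfst: "norm (fst v) \<le> norm v" and nsnd: "norm (snd v) \<le> norm v" for v :: "'a::real_normed_vector \<times> 'b::real_normed_vector"
    using norm_fst_le[of "fst v" "snd v"] norm_snd_le[of "snd v" "fst v"] by simp_all
  have G: "L2lim (\<lambda>n. grad (w n)) G"
    using L2lim_contraction[OF F bounded_linear_fst nfst] by (simp add: form_map_def G_def[abs_def])
  have F2: "L2lim (\<lambda>n x. snd (form_map P \<kappa> (w n) x)) (\<lambda>x. snd (F x))"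
    by (rule L2lim_contraction[OF F bounded_linear_snd nsnd])
  have H: "L2lim (\<lambda>n x. sqrt (P x) * w n x) H"
    using L2lim_contraction[OF F2 bounded_linear_fst nfst] by (simp add: form_map_def H_def[abs_def])
  have \<psi>: "L2lim w \<psi>"
    using L2lim_scaleR[OF L2lim_contraction[OF F2 bounded_linear_snd nsnd], of "1 / sqrt \<kappa>"] \<kappa>
    by (simp add: form_map_def \<psi>_def[abs_def])
  note GL = L2lim_Lp(2)[OF G] and HL = L2lim_Lp(2)[OF H] and \<psi>L = L2lim_Lp(2)[OF \<psi>]
  note [measurable] = P_borel[OF P \<kappa>0] GL[THEN Lp2_measurable] HL[THEN Lp2_measurable] \<psi>L[THEN Lp2_measurable]
  have qm [measurable]: "q \<in> borel_measurable borel" using q by (auto intro: smooth_borel)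
  \<comment> \<open>Multiplication by \<open>sqrt P\<close> need not be bounded on L2, so
    \<open>H\<close> is identified through pointwise limits along a common subsequence.\<close>
  have HP: "AE x in lborel. H x = sqrt (P x) * \<psi> x"
  proof -
    obtain r where r: "strict_mono (r::nat\<Rightarrow>nat)" "AE x in lborel. (\<lambda>n. sqrt (P x) * w (r n) x) \<longlonglongrightarrow> H x"
      using L2lim_AE_subseq[OF H] by blast
    obtain s where s: "strict_mono (s::nat\<Rightarrow>nat)" "AE x in lborel. (\<lambda>n. w (r (s n)) x) \<longlonglongrightarrow> \<psi> x"
      using L2lim_AE_subseq[OF L2lim_subseq[OF \<psi> r(1)]] by blast
    from r(2) s(2) show ?thesis
    proof eventually_elim
      case (elim x)
      have "(\<lambda>n. sqrt (P x) * w (r (s n)) x) \<longlonglongrightarrow> H x"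
        using LIMSEQ_subseq_LIMSEQ[OF elim(1) s(1)] by (simp add: o_def)
      moreover have "(\<lambda>n. sqrt (P x) * w (r (s n)) x) \<longlonglongrightarrow> sqrt (P x) * \<psi> x"
        by (intro tendsto_intros elim)
      ultimately show ?case by (rule LIMSEQ_unique)
    qed
  qed
  have P\<psi>: "integrable lborel (\<lambda>x. P x * (\<psi> x)\<^sup>2)"
  proof -
    have "integrable lborel (\<lambda>x. P x * (\<psi> x)\<^sup>2) \<longleftrightarrow> integrable lborel (\<lambda>x. (norm (H x))\<^sup>2)"
      using HP P(2) by (intro integrable_cong_AE) (auto elim!: eventually_mono simp: power_mult_distrib)
    then show ?thesis using Lp2_integrable[OF HL] by simp
  qed
  \<comment> \<open>On a ball the product is dominated by \<open>P + P \<psi>^2\<close>: the first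
    summand is integrable there by assumption, the second because it equals \<open>H^2\<close>
    almost everywhere.\<close>
  have P\<psi>_loc: "locally_integrable (\<lambda>x. P x * \<psi> x)"
  proof (rule locally_integrableI)
    fix r
    show "integrable lborel (\<lambda>x. indicator (cball 0 r) x *\<^sub>R (P x * \<psi> x))"
    proof (rule Bochner_Integration.integrable_bound)
      show "integrable lborel (\<lambda>x. indicator (cball 0 r) x *\<^sub>R P x + P x * (\<psi> x)\<^sup>2)"
        by (intro Bochner_Integration.integrable_add locally_integrable_cball P P\<psi>)
      show "AE x in lborel. norm (indicator (cball 0 r) x *\<^sub>R (P x * \<psi> x)) \<le> norm (indicator (cball 0 r) x *\<^sub>R P x + P x * (\<psi> x)\<^sup>2)"
      proof (rule AE_I2)
        fix x
        have "2 * \<bar>\<psi> x\<bar> \<le> 1 + (\<psi> x)\<^sup>2" using sum_squares_bound[of "\<bar>\<psi> x\<bar>" 1] by (simp add: power2_eq_square)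
        then have "\<bar>\<psi> x\<bar> \<le> 1 + (\<psi> x)\<^sup>2" by simp
        from mult_left_mono[OF this P(2)[of x]] have "P x * \<bar>\<psi> x\<bar> \<le> P x + P x * (\<psi> x)\<^sup>2" by (simp add: distrib_left)
        then show "norm (indicator (cball 0 r) x *\<^sub>R (P x * \<psi> x)) \<le> norm (indicator (cball 0 r) x *\<^sub>R P x + P x * (\<psi> x)\<^sup>2)"
          using P(2)[of x] by (simp add: indicator_def abs_mult)
      qed
      show "(\<lambda>x. indicator (cball 0 r) x *\<^sub>R (P x * \<psi> x)) \<in> borel_measurable lborel"
        unfolding measurable_lborel1
        by (intro borel_measurable_scaleR borel_measurable_indicator borel_measurable_times) simp_all
    qed
  qed simp
  have \<psi>_loc: "locally_integrable \<psi>" by (rule Lp2_locally_integrable[OF \<psi>L])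
  have eq: "ip G (grad v) + (LINT x|lborel. P x * \<psi> x * v x) + \<kappa> * ip \<psi> v - (LINT x|lborel. q x * \<psi> x * v x) = 0"
    if v: "v \<in> Cc_infinity" for v
  proof -
    note vL = Cc_Lp2[OF v] potential_Lp2[OF P \<kappa>0 v] Cc_Lp2[OF Cc_mult_smooth[OF Cc_smooth[OF q(1)] v]]
    have "ip (\<lambda>x. sqrt (P x) * w n x) (\<lambda>x. sqrt (P x) * v x) = (LINT x|lborel. P x * (w n x * v x))" for n
    proof -
      have "(sqrt (P x) * w n x) * (sqrt (P x) * v x) = P x * (w n x * v x)" for x
      proof -
        have "(sqrt (P x) * w n x) * (sqrt (P x) * v x) = (sqrt (P x) * sqrt (P x)) * (w n x * v x)" by (simp only: mult_ac)
        then show ?thesis using P(2)[of x] by simp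
      qed
      then show ?thesis unfolding ip_def inner_real_def by (simp only:)
    qed
    then have A: "ip (form_map P \<kappa> (w n)) (form_map P \<kappa> v) - (LINT x|lborel. q x * (w n x * v x)) =
        ip (grad (w n)) (grad v) + ip (\<lambda>x. sqrt (P x) * w n x) (\<lambda>x. sqrt (P x) * v x) + \<kappa> * ip (w n) v - ip (w n) (\<lambda>x. q x * v x)" for n
      using ip_form_map[OF P \<kappa>0 w[of n] v] by (simp add: ip_def mult.left_commute)
    have lim: "(\<lambda>n. ip (grad (w n)) (grad v) + ip (\<lambda>x. sqrt (P x) * w n x) (\<lambda>x. sqrt (P x) * v x) + \<kappa> * ip (w n) v - ip (w n) (\<lambda>x. q x * v x))
      \<longlonglongrightarrow> ip G (grad v) + ip H (\<lambda>x. sqrt (P x) * v x) + \<kappa> * ip \<psi> v - ip \<psi> (\<lambda>x. q x * v x)"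
      by (intro tendsto_intros L2lim_ip[OF G Cc_grad_Lp2[OF v]] L2lim_ip[OF H vL(2)] L2lim_ip[OF \<psi> vL(1)] L2lim_ip[OF \<psi> vL(3)])
    from LIMSEQ_unique[OF lim EL[OF v, unfolded A]]
    have "ip G (grad v) + ip H (\<lambda>x. sqrt (P x) * v x) + \<kappa> * ip \<psi> v - ip \<psi> (\<lambda>x. q x * v x) = 0" .
    moreover have "ip H (\<lambda>x. sqrt (P x) * v x) = (LINT x|lborel. P x * \<psi> x * v x)"
      unfolding ip_def
    proof (rule integral_cong_AE)
      show "AE x in lborel. H x \<bullet> (sqrt (P x) * v x) = P x * \<psi> x * v x"
        using HP
      proof eventually_elim
        case (elim x)
        have "(sqrt (P x) * \<psi> x) * (sqrt (P x) * v x) = (sqrt (P x) * sqrt (P x)) * (\<psi> x * v x)" by (simp only: mult_ac)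
        then show ?case using P(2)[of x] elim by simp
      qed
    qed (use vL(1)[THEN Lp2_measurable] in simp_all)
    moreover have "ip \<psi> (\<lambda>x. q x * v x) = (LINT x|lborel. q x * \<psi> x * v x)"
      by (simp add: ip_def mult_ac)
    ultimately show ?thesis by simp
  qed
  have wk: "(LINT x|lborel. \<psi> x * partial_deriv i \<eta> x) = - (LINT x|lborel. G x $ i * \<eta> x)" if \<eta>: "\<eta> \<in> Cc_infinity" for \<eta> i
  proof -
    have e: "(\<lambda>x. \<eta> x *\<^sub>R (axis i 1 :: real^3)) \<in> Lp 2"
    proof -
      have "norm (axis i (1::real) :: real^3) = 1" by simp
      moreover have "(\<lambda>x. \<eta> x *\<^sub>R (axis i 1 :: real^3)) \<in> borel_measurable borel"
        using Lp2_measurable[OF Cc_Lp2[OF \<eta>]] by simp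
      ultimately show ?thesis using Lp2_integrable[OF Cc_Lp2[OF \<eta>]] by (simp add: Lp_def)
    qed
    have "(\<lambda>n. ip (w n) (partial_deriv i \<eta>)) \<longlonglongrightarrow> ip \<psi> (partial_deriv i \<eta>)"
      by (rule L2lim_ip[OF \<psi> Cc_Lp2[OF Cc_partial_deriv[OF \<eta>]]])
    moreover have "ip (w n) (partial_deriv i \<eta>) = - ip (grad (w n)) (\<lambda>x. \<eta> x *\<^sub>R axis i 1)" for n
      using integration_by_parts[OF Cc_smooth[OF w[of n]] \<eta>, of i] by (simp add: ip_def inner_axis mult.commute)
    moreover have "(\<lambda>n. - ip (grad (w n)) (\<lambda>x. \<eta> x *\<^sub>R axis i 1)) \<longlonglongrightarrow> - ip G (\<lambda>x. \<eta> x *\<^sub>R axis i 1)"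
      by (intro tendsto_minus L2lim_ip[OF G e])
    ultimately have "ip \<psi> (partial_deriv i \<eta>) = - ip G (\<lambda>x. \<eta> x *\<^sub>R axis i 1)"
      using LIMSEQ_unique by simp
    then show ?thesis by (simp add: ip_def inner_axis mult.commute)
  qed
  have wg: "has_weak_gradient \<psi> G"
    unfolding has_weak_gradient_def using \<psi>_loc Lp2_locally_integrable[OF GL] wk by blast
  then have H1: "\<psi> \<in> H1"
    unfolding H1_def using \<psi>L GL by blast
  \<comment> \<open>The normalisation survives strong convergence: 1 is at most
    \<open>M * nsq (w n)\<close>, so these norms cannot tend to 0.\<close>
  have nt: "nontrivial \<psi>"
    unfolding nontrivial_def
  proof
    assume "AE x in lborel. \<psi> x = 0"
    then have "nsq \<psi> = 0" unfolding nsq_def by (intro integral_eq_zero_AE) (auto elim: eventually_mono)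
    then have lim: "(\<lambda>n. nsq (w n)) \<longlonglongrightarrow> 0" using L2lim_nsq[OF \<psi>] by simp
    obtain M where M: "M > 0" "\<And>x. \<bar>q x\<bar> \<le> M" using Cc_bounded[OF q(1)] by auto
    have "1 \<le> M * nsq (w n)" for n
    proof -
      have "(LINT x|lborel. q x * (w n x)\<^sup>2) \<le> (LINT x|lborel. M * (norm (w n x))\<^sup>2)"
      proof (rule integral_mono)
        show "integrable lborel (\<lambda>x. q x * (w n x)\<^sup>2)"
          using potential_integrable[OF Lp2_locally_integrable[OF Cc_Lp2[OF q(1)]] q(2) \<kappa>0 w w] by (simp add: power2_eq_square)
        show "q x * (w n x)\<^sup>2 \<le> M * (norm (w n x))\<^sup>2" for x
          using M(2)[of x] by (auto intro!: mult_right_mono)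
      qed (use Lp2_integrable[OF Cc_Lp2[OF w]] in simp)
      then show ?thesis by (simp add: B1 nsq_def)
    qed
    moreover have "(\<lambda>n. M * nsq (w n)) \<longlonglongrightarrow> M * 0" by (intro tendsto_intros lim)
    ultimately have "1 \<le> M * 0" by (intro LIMSEQ_le_const) auto
    then show False by simp
  qed
  let ?f = "\<lambda>x. (- q x + P x) * \<psi> x - (- \<kappa>) * \<psi> x"
  have lap: "(LINT x|lborel. \<psi> x * laplacian \<eta> x) = (LINT x|lborel. ?f x * \<eta> x)" if \<eta>: "\<eta> \<in> Cc_infinity" for \<eta>
  proof -
    have "(LINT x|lborel. \<psi> x * laplacian \<eta> x) = - ip G (grad \<eta>)"
      by (rule weak_gradient_laplacian[OF wg \<eta>])
    also have "\<dots> = (LINT x|lborel. P x * \<psi> x * \<eta> x) + \<kappa> * ip \<psi> \<eta> - (LINT x|lborel. q x * \<psi> x * \<eta> x)"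
      using eq[OF \<eta>] by simp
    also have "\<dots> = (LINT x|lborel. P x * \<psi> x * \<eta> x + \<kappa> * (\<psi> x * \<eta> x) - q x * \<psi> x * \<eta> x)"
    proof -
      have "integrable lborel (\<lambda>x. P x * \<psi> x * \<eta> x)"
        using Cc_mult_integrable[OF P\<psi>_loc \<eta>] by (simp add: mult.commute)
      moreover have "integrable lborel (\<lambda>x. \<psi> x * \<eta> x)"
        using Cc_mult_integrable[OF \<psi>_loc \<eta>] by (simp add: mult.commute)
      moreover have "integrable lborel (\<lambda>x. q x * \<psi> x * \<eta> x)"
        using Cc_mult_integrable[OF \<psi>_loc Cc_mult_smooth[OF Cc_smooth[OF q(1)] \<eta>]] by (simp add: mult_ac)
      ultimately show ?thesis by (simp add: ip_def)
    qed
    also have "\<dots> = (LINT x|lborel. ?f x * \<eta> x)"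
      by (intro Bochner_Integration.integral_cong refl) (simp add: algebra_simps)
    finally show ?thesis .
  qed
  have floc: "locally_integrable ?f"
  proof (rule locally_integrableI)
    fix r
    obtain M where M: "M > 0" "\<And>x. \<bar>q x\<bar> \<le> M" using Cc_bounded[OF q(1)] by auto
    have i1: "integrable lborel (\<lambda>x. q x * \<psi> x)" by (rule Cc_mult_integrable[OF \<psi>_loc q(1)])
    have "integrable lborel (\<lambda>x. indicator (cball 0 r) x *\<^sub>R (P x * \<psi> x) + \<kappa> *\<^sub>R (indicator (cball 0 r) x *\<^sub>R \<psi> x) - indicator (cball 0 r) x *\<^sub>R (q x * \<psi> x))"
      by (intro Bochner_Integration.integrable_diff Bochner_Integration.integrable_add integrable_scaleR_right
        locally_integrable_cball P\<psi>_loc \<psi>_loc integrable_mult_indicator i1) simp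
    then show "integrable lborel (\<lambda>x. indicator (cball 0 r) x *\<^sub>R ?f x)"
      by (rule Bochner_Integration.integrable_cong[THEN iffD1, rotated 2]) (simp_all add: algebra_simps)
  qed simp
  have "schrodinger_op (\<lambda>x. - q x + P x) \<psi> (\<lambda>x. (- \<kappa>) * \<psi> x)"
    unfolding schrodinger_op_def has_distr_laplacian_def
    using H1 Lp2_cmul[OF \<psi>L, of "- \<kappa>"] \<psi>_loc floc lap by blast
  then show ?thesis
    unfolding schrodinger_eigenvalue_def using nt \<kappa> by (intro exI[of _ "- \<kappa>"]) auto
qed

section \<open>From a negative eigenvalue to a test function of negative energy\<close>

lemma L2lim_mult_bounded:
  fixes F :: "nat \<Rightarrow> real^'n::finite \<Rightarrow> real"
  assumes F: "L2lim F f" and c: "c \<in> borel_measurable borel" "\<And>x. \<bar>c x\<bar> \<le> M"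
  shows "L2lim (\<lambda>n x. c x * F n x) (\<lambda>x. c x * f x)"
proof -
  note L = L2lim_Lp[OF F]
  have cL: "(\<lambda>x. c x * g x) \<in> Lp 2" if "g \<in> Lp 2" for g :: "real^'n \<Rightarrow> real"
    using Lp2_bounded_mult[OF that c] by simp
  have "(\<lambda>n. nsq (\<lambda>x. c x * F n x - c x * f x)) \<longlonglongrightarrow> 0"
  proof (rule LIMSEQ_0_le[OF nsq_nonneg])
    show "nsq (\<lambda>x. c x * F n x - c x * f x) \<le> M\<^sup>2 * nsq (\<lambda>x. F n x - f x)" for n
    proof -
      have "nsq (\<lambda>x. c x * F n x - c x * f x) \<le> (LINT x|lborel. M\<^sup>2 * (norm (F n x - f x))\<^sup>2)"
      proof (rule nsq_bounded_square(2))
        show "(\<lambda>x. c x * F n x - c x * f x) \<in> borel_measurable borel"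
          using L[THEN Lp2_measurable] c(1) by simp
        fix x
        have "(c x)\<^sup>2 \<le> M\<^sup>2" using c(2)[of x] abs_le_square_iff[of "c x" M] by simp
        then show "(norm (c x * F n x - c x * f x))\<^sup>2 \<le> M\<^sup>2 * (norm (F n x - f x))\<^sup>2"
          by (simp add: power_mult_distrib mult_right_mono flip: right_diff_distrib)
      qed (use Lp2_integrable[OF Lp2_diff[OF L]] in simp)
      then show ?thesis by (simp add: nsq_def)
    qed
    have "(\<lambda>n. M\<^sup>2 * nsq (\<lambda>x. F n x - f x)) \<longlonglongrightarrow> M\<^sup>2 * 0"
      using F by (intro tendsto_intros) (simp add: L2lim_def)
    then show "(\<lambda>n. M\<^sup>2 * nsq (\<lambda>x. F n x - f x)) \<longlonglongrightarrow> 0" by simp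
  qed
  then show ?thesis using cL[OF L(1)] cL[OF L(2)] by (simp add: L2lim_def)
qed

text \<open>Testing the eigenvalue equation with \<open>\<psi>\<close> itself gives
  \<open>nsq G\<close> minus the integral of \<open>q \<psi>^2\<close> equal to
  \<open>\<mu> * nsq \<psi>\<close>, a negative number. The equation admits test functions only, so
  the identity is reached through approximants \<open>w n\<close>, one of which already has negative
  energy.\<close>

lemma negative_direction:
  fixes q :: "real^3 \<Rightarrow> real"
  assumes b: "bump b (x0 :: real^3)" and q: "q \<in> Cc_infinity" "\<And>x. 0 \<le> q x"
    and ev: "schrodinger_eigenvalue (\<lambda>x. - q x) \<mu>" "\<mu> < 0"
  obtains u where "u \<in> Cc_infinity" "nsq (grad u) < (LINT x|lborel. q x * (u x)\<^sup>2)"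
proof -
  interpret bump b x0 by fact
  obtain \<psi> where \<psi>: "nontrivial \<psi>" "schrodinger_op (\<lambda>x. - q x) \<psi> (\<lambda>x. \<mu> * \<psi> x)"
    using ev(1) by (auto simp: schrodinger_eigenvalue_def)
  then obtain G where \<psi>L: "\<psi> \<in> Lp 2" and G: "G \<in> Lp 2" "has_weak_gradient \<psi> G"
    and lap: "\<And>\<eta>. \<eta> \<in> Cc_infinity \<Longrightarrow>
      (LINT x|lborel. \<psi> x * laplacian \<eta> x) = (LINT x|lborel. (- q x * \<psi> x - \<mu> * \<psi> x) * \<eta> x)"
    by (auto simp: schrodinger_op_def H1_def has_distr_laplacian_def)
  have [measurable]: "\<psi> \<in> borel_measurable borel" by (rule Lp2_measurable[OF \<psi>L])
  have qm [measurable]: "q \<in> borel_measurable borel" using q by (auto intro: smooth_borel)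
  obtain M where M: "M > 0" "\<And>x. \<bar>q x\<bar> \<le> M" using Cc_bounded[OF q(1)] by auto
  have sq: "integrable lborel (\<lambda>x. indicator (cball 0 r) x * (\<psi> x)\<^sup>2)" for r
    using integrable_mult_indicator[OF _ Lp2_integrable[OF \<psi>L], of "cball 0 r"] by simp
  obtain w where w: "\<And>n. w n \<in> Cc_infinity" "L2lim (\<lambda>n. grad (w n)) G" "\<psi> \<in> Lp 2 \<Longrightarrow> L2lim w \<psi>"
    by (rule dense_weak_gradient[OF G(2,1) sq tail_Lp2[OF \<psi>L]]) (rule that)
  note w\<psi> = w(3)[OF \<psi>L]
  define q\<psi> where "q\<psi> x = q x * \<psi> x" for x
  have q\<psi>L: "q\<psi> \<in> Lp 2" using Lp2_bounded_mult[OF \<psi>L qm M(2)] by (simp add: q\<psi>_def[abs_def])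
  have EL: "ip (grad (w n)) G = ip (w n) q\<psi> + \<mu> * ip (w n) \<psi>" for n
  proof -
    have "- ip G (grad (w n)) = (LINT x|lborel. (- q x * \<psi> x - \<mu> * \<psi> x) * w n x)"
      using weak_gradient_laplacian[OF G(2) w(1)[of n]] lap[OF w(1)[of n]] by simp
    also have "\<dots> = (LINT x|lborel. - (w n x \<bullet> q\<psi> x) - \<mu> * (w n x \<bullet> \<psi> x))"
      by (intro Bochner_Integration.integral_cong refl) (simp add: q\<psi>_def algebra_simps)
    also have "\<dots> = - ip (w n) q\<psi> - \<mu> * ip (w n) \<psi>"
      using Lp2_inner_integrable[OF Cc_Lp2[OF w(1)[of n]] q\<psi>L] Lp2_inner_integrable[OF Cc_Lp2[OF w(1)[of n]] \<psi>L]
      by (simp add: ip_def)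
    finally show ?thesis by (simp add: ip_commute)
  qed
  have "(\<lambda>n. ip (w n) q\<psi> + \<mu> * ip (w n) \<psi>) \<longlonglongrightarrow> ip \<psi> q\<psi> + \<mu> * ip \<psi> \<psi>"
    by (intro tendsto_intros L2lim_ip[OF w\<psi> q\<psi>L] L2lim_ip[OF w\<psi> \<psi>L])
  from LIMSEQ_unique[OF L2lim_ip[OF w(2) G(1)] this[folded EL]]
  have energy: "nsq G = ip \<psi> q\<psi> + \<mu> * nsq \<psi>" by (simp add: nsq_ip)
  have "nsq \<psi> \<noteq> 0"
  proof
    assume "nsq \<psi> = 0"
    then have "AE x in lborel. (norm (\<psi> x))\<^sup>2 = 0"
      using integral_nonneg_eq_0_iff_AE[OF Lp2_integrable[OF \<psi>L]] by (simp add: nsq_def)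
    then show False using \<psi>(1) by (simp add: nontrivial_def)
  qed
  then have "\<mu> * nsq \<psi> < 0" using ev(2) nsq_nonneg[of \<psi>] by (intro mult_neg_pos) linarith+
  \<comment> \<open>The weighted integral is the squared L2 norm of \<open>sqrt q\<close> times
    \<open>w n\<close>; as \<open>q\<close> is bounded, it follows L2 convergence.\<close>
  have sqrt_q: "(norm (sqrt (q x) * y))\<^sup>2 = q x * y\<^sup>2" for x y using q(2) by (simp add: power_mult_distrib)
  have "\<bar>sqrt (q x)\<bar> \<le> sqrt M" for x using q(2)[of x] M(2)[of x] by simp
  then have "L2lim (\<lambda>n x. sqrt (q x) * w n x) (\<lambda>x. sqrt (q x) * \<psi> x)"
    by (intro L2lim_mult_bounded[OF w\<psi>]) auto
  from L2lim_nsq[OF this] have "(\<lambda>n. LINT x|lborel. q x * (w n x)\<^sup>2) \<longlonglongrightarrow> (LINT x|lborel. q x * (\<psi> x)\<^sup>2)"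
    unfolding nsq_def sqrt_q .
  also have "(LINT x|lborel. q x * (\<psi> x)\<^sup>2) = ip \<psi> q\<psi>"
    unfolding ip_def by (intro Bochner_Integration.integral_cong refl) (simp add: q\<psi>_def power2_eq_square)
  finally have "(\<lambda>n. nsq (grad (w n)) - (LINT x|lborel. q x * (w n x)\<^sup>2)) \<longlonglongrightarrow> nsq G - ip \<psi> q\<psi>"
    by (intro tendsto_diff L2lim_nsq[OF w(2)])
  from order_tendstoD(2)[OF this, of 0] energy \<open>\<mu> * nsq \<psi> < 0\<close>
  obtain n where "nsq (grad (w n)) - (LINT x|lborel. q x * (w n x)\<^sup>2) < 0"
    by (auto simp: eventually_sequentially)
  then show ?thesis using w(1)[of n] by (intro that[of "w n"]) auto
qed

subsection \<open>Truncated test functions\<close>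

text \<open>Multiplying a test function \<open>p\<close> by \<open>1 / (1 + k w\<^sup>2)\<close>, with \<open>w\<close> close to \<open>\<phi>\<close>, makes
  \<open>\<phi>\<^sup>4\<close> harmless on it without any bound on \<open>\<phi>\<close> beyond its gradient, since
  \<open>\<phi>\<^sup>2 / (1 + k \<phi>\<^sup>2) \<le> 1 / k\<close>.\<close>

definition trunc :: "real \<Rightarrow> (real^'n::finite \<Rightarrow> real) \<Rightarrow> real^'n \<Rightarrow> real" where
  "trunc k w x = inverse (1 + k * (w x * w x))"

text \<open>The last bound prices the damping: quadratic in \<open>w\<close>, so Hardy's inequality
  turns it into a multiple of \<open>nsq (grad w)\<close>.\<close>

lemma trunc_bounds:
  assumes "k > 0"
  shows "0 < trunc k w x" "trunc k w x \<le> 1" "1 - (trunc k w x)\<^sup>2 \<le> 2 * k * (w x)\<^sup>2"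
proof -
  have p: "1 + k * (w x * w x) \<ge> 1" using assms by simp
  then show 0: "0 < trunc k w x" and 1: "trunc k w x \<le> 1" by (auto simp: trunc_def inverse_le_1_iff)
  have "1 - trunc k w x = k * (w x * w x) * trunc k w x"
    using p by (simp add: trunc_def field_simps)
  also have "\<dots> \<le> k * (w x * w x) * 1" using 1 assms by (intro mult_left_mono) auto
  finally have *: "1 - trunc k w x \<le> k * (w x)\<^sup>2" by (simp add: power2_eq_square)
  have "1 - (trunc k w x)\<^sup>2 = (1 - trunc k w x) * (1 + trunc k w x)" by (simp add: power2_eq_square algebra_simps)
  also have "\<dots> \<le> (k * (w x)\<^sup>2) * 2" using * 0 1 by (intro mult_mono) auto
  finally show "1 - (trunc k w x)\<^sup>2 \<le> 2 * k * (w x)\<^sup>2" by (simp add: mult_ac)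
qed

lemma smooth_trunc: "smooth w \<Longrightarrow> k > 0 \<Longrightarrow> smooth (trunc k w)"
proof -
  assume w: "smooth w" and k: "k > 0"
  have "1 + k * (w x * w x) \<noteq> 0" for x using k add_pos_nonneg[of 1 "k * (w x * w x)"] by simp
  then show "smooth (trunc k w)"
    unfolding trunc_def[abs_def] by (intro smooth_inverse smooth_add smooth_mult smooth_const w)
qed

text \<open>The scalar function \<open>1 / (1 + k t^2)\<close> has a derivative bounded by
  \<open>sqrt k\<close> uniformly in \<open>t\<close>, so no bound on \<open>w\<close>
  enters.\<close>

lemma grad_trunc:
  assumes w: "smooth w" and k: "k > 0"
  shows "(norm (grad (trunc k w) x))\<^sup>2 \<le> k * (norm (grad w x))\<^sup>2"
proof -
  have nz: "1 + k * (w x * w x) \<noteq> 0" using k add_pos_nonneg[of 1 "k * (w x * w x)"] by simp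
  have s1: "smooth (\<lambda>x. w x * w x)" "smooth (\<lambda>x. k * (w x * w x))" "smooth (\<lambda>x. 1 + k * (w x * w x))"
    using w by (intro smooth_add smooth_mult smooth_const; assumption)+
  have "grad (trunc k w) x = - (trunc k w x)\<^sup>2 *\<^sub>R grad (\<lambda>x. 1 + k * (w x * w x)) x"
    unfolding trunc_def[abs_def] by (rule grad_inverse[OF s1(3) nz])
  also have "grad (\<lambda>x. 1 + k * (w x * w x)) x = (2 * k * w x) *\<^sub>R grad w x"
    by (simp add: grad_add[OF smooth_const s1(2)] grad_cmul[OF s1(1)] grad_mult[OF w w] scaleR_add_left[symmetric])
  finally have "(norm (grad (trunc k w) x))\<^sup>2 = ((trunc k w x)\<^sup>2 * (2 * k * w x))\<^sup>2 * (norm (grad w x))\<^sup>2"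
    by (simp add: power_mult_distrib)
  also have "\<dots> \<le> k * (norm (grad w x))\<^sup>2"
  proof (rule mult_right_mono)
    define c where "c = trunc k w x"
    have c: "0 < c" "c \<le> 1" using trunc_bounds(1,2)[OF k, of w x] by (simp_all add: c_def)
    have c1: "c * (1 + k * (w x)\<^sup>2) = 1" using nz by (simp add: c_def trunc_def power2_eq_square)
    \<comment> \<open>AM-GM for 1 and \<open>k w^2\<close>: the growth of the inner derivative is
      paid for by the squared denominator.\<close>
    have "0 \<le> (1 - k * (w x)\<^sup>2)\<^sup>2" by simp
    then have "4 * (k * (w x)\<^sup>2) \<le> (1 + k * (w x)\<^sup>2)\<^sup>2" by (simp add: power2_eq_square algebra_simps)
    then have "c\<^sup>2 * (4 * (k * (w x)\<^sup>2)) \<le> c\<^sup>2 * (1 + k * (w x)\<^sup>2)\<^sup>2" by (rule mult_left_mono) simp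
    also have "\<dots> = 1" using c1 by (simp flip: power_mult_distrib)
    finally have 1: "c\<^sup>2 * (4 * (k * (w x)\<^sup>2)) \<le> 1" .
    have c2: "c\<^sup>2 \<le> 1" using c power_le_one[of c 2] by simp
    have "(c\<^sup>2 * (2 * k * w x))\<^sup>2 = (k * c\<^sup>2) * (c\<^sup>2 * (4 * (k * (w x)\<^sup>2)))"
      by (simp add: power2_eq_square)
    also have "\<dots> \<le> (k * c\<^sup>2) * 1" using 1 k by (intro mult_left_mono) auto
    also have "\<dots> \<le> k" using c2 k by simp
    finally show "((trunc k w x)\<^sup>2 * (2 * k * w x))\<^sup>2 \<le> k" by (simp add: c_def)
  qed simp
  finally show ?thesis .
qed

text \<open>From the square of \<open>s a - b / s\<close> with \<open>s^2 = \<tau>\<close>. The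
  factor of the main term can be brought close to 1; the factor 2 of \<open>norm_add_sq_le\<close>
  could destroy the strict negativity of the form.\<close>

lemma norm_add_sq_weighted:
  fixes a b :: "'a::real_inner"
  assumes "\<tau> > 0"
  shows "(norm (a + b))\<^sup>2 \<le> (1 + \<tau>) * (norm a)\<^sup>2 + (1 + 1 / \<tau>) * (norm b)\<^sup>2"
proof -
  define s where "s = sqrt \<tau>"
  have s: "s > 0" "s * s = \<tau>" using assms by (auto simp: s_def)
  have "0 \<le> (norm (s *\<^sub>R a - (1 / s) *\<^sub>R b))\<^sup>2" by simp
  also have "\<dots> = \<tau> * (norm a)\<^sup>2 - 2 * (a \<bullet> b) + (1 / \<tau>) * (norm b)\<^sup>2"
    unfolding power2_norm_eq_inner inner_diff inner_scaleR_left inner_scaleR_right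
    using s(1) by (simp add: inner_commute[of b a] algebra_simps flip: s(2))
  finally show ?thesis
    unfolding power2_norm_eq_inner by (simp add: inner_add inner_commute[of b a] algebra_simps)
qed

lemma grad_truncated:
  assumes p: "p \<in> Cc_infinity" "\<And>x. \<bar>p x\<bar> \<le> M" and w: "w \<in> Cc_infinity" and k: "k > 0" and \<tau>: "\<tau> > 0"
  shows "nsq (grad (\<lambda>x. trunc k w x * p x)) \<le> (1 + \<tau>) * nsq (grad p) + (1 + 1 / \<tau>) * (M\<^sup>2 * k) * nsq (grad w)"
proof -
  note sp = Cc_smooth[OF p(1)] and sw = Cc_smooth[OF w] and st = smooth_trunc[OF Cc_smooth[OF w] k]
  have tp: "(\<lambda>x. trunc k w x * p x) \<in> Cc_infinity" by (rule Cc_mult_smooth[OF st p(1)])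
  have "nsq (grad (\<lambda>x. trunc k w x * p x))
      \<le> (LINT x|lborel. (1 + \<tau>) * (norm (grad p x))\<^sup>2 + ((1 + 1 / \<tau>) * (M\<^sup>2 * k)) * (norm (grad w x))\<^sup>2)"
    unfolding nsq_def
  proof (rule integral_mono[OF Lp2_integrable[OF Cc_grad_Lp2[OF tp]]])
    show "integrable lborel (\<lambda>x. (1 + \<tau>) * (norm (grad p x))\<^sup>2 + ((1 + 1 / \<tau>) * (M\<^sup>2 * k)) * (norm (grad w x))\<^sup>2)"
      by (intro Bochner_Integration.integrable_add integrable_mult_right Lp2_integrable Cc_grad_Lp2 p w)
    fix x
    have "(norm (grad (\<lambda>x. trunc k w x * p x) x))\<^sup>2 = (norm (trunc k w x *\<^sub>R grad p x + p x *\<^sub>R grad (trunc k w) x))\<^sup>2"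
      by (simp add: grad_mult[OF st sp])
    also have "\<dots> \<le> (1 + \<tau>) * (norm (trunc k w x *\<^sub>R grad p x))\<^sup>2 + (1 + 1 / \<tau>) * (norm (p x *\<^sub>R grad (trunc k w) x))\<^sup>2"
      by (rule norm_add_sq_weighted[OF \<tau>])
    also have "\<dots> \<le> (1 + \<tau>) * (norm (grad p x))\<^sup>2 + (1 + 1 / \<tau>) * (M\<^sup>2 * (k * (norm (grad w x))\<^sup>2))"
    proof (intro add_mono mult_left_mono)
      have "norm (trunc k w x *\<^sub>R grad p x) \<le> norm (grad p x)"
        using trunc_bounds(1,2)[OF k, of w x] by (simp add: mult_left_le_one_le)
      then show "(norm (trunc k w x *\<^sub>R grad p x))\<^sup>2 \<le> (norm (grad p x))\<^sup>2" by (rule power_mono) simp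
      have "(p x)\<^sup>2 \<le> M\<^sup>2" using p(2)[of x] abs_le_square_iff[of "p x" M] by simp
      then have "(p x)\<^sup>2 * (norm (grad (trunc k w) x))\<^sup>2 \<le> M\<^sup>2 * (k * (norm (grad w x))\<^sup>2)"
        by (intro mult_mono grad_trunc[OF sw k]) auto
      then show "(norm (p x *\<^sub>R grad (trunc k w) x))\<^sup>2 \<le> M\<^sup>2 * (k * (norm (grad w x))\<^sup>2)"
        by (simp add: power_mult_distrib)
    qed (use \<tau> in auto)
    also have "\<dots> = (1 + \<tau>) * (norm (grad p x))\<^sup>2 + ((1 + 1 / \<tau>) * (M\<^sup>2 * k)) * (norm (grad w x))\<^sup>2" by (simp only: mult.assoc)
    finally show "(norm (grad (\<lambda>x. trunc k w x * p x) x))\<^sup>2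
      \<le> (1 + \<tau>) * (norm (grad p x))\<^sup>2 + ((1 + 1 / \<tau>) * (M\<^sup>2 * k)) * (norm (grad w x))\<^sup>2" .
  qed
  also have "\<dots> = (1 + \<tau>) * nsq (grad p) + (1 + 1 / \<tau>) * (M\<^sup>2 * k) * nsq (grad w)"
    using Lp2_integrable[OF Cc_grad_Lp2[OF p(1)]] Lp2_integrable[OF Cc_grad_Lp2[OF w]] by (simp add: nsq_def)
  finally show ?thesis .
qed

text \<open>The loss in the potential term is concentrated where \<open>w\<close> is not small.
  \<open>V\<close> is replaced by the Hardy weight; the 8 is the 2 of \<open>trunc_bounds\<close>
  times Hardy's 4.\<close>

lemma potential_truncated:
  fixes V p w :: "real^3 \<Rightarrow> real"
  assumes V: "V \<in> Cc_infinity" "\<And>x. 0 \<le> V x" "\<And>x. V x \<le> C / (1 + (norm x)\<^sup>2)"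
    and p: "p \<in> Cc_infinity" "\<And>x. \<bar>p x\<bar> \<le> M" and w: "w \<in> Cc_infinity" and k: "k > 0"
  shows "(LINT x|lborel. V x * (p x)\<^sup>2) - 8 * k * M\<^sup>2 * C * nsq (grad w)
    \<le> (LINT x|lborel. V x * (trunc k w x * p x)\<^sup>2)"
proof -
  have Vl: "locally_integrable V" by (rule Lp2_locally_integrable[OF Cc_Lp2[OF V(1)]])
  have tp: "(\<lambda>x. trunc k w x * p x) \<in> Cc_infinity" by (rule Cc_mult_smooth[OF smooth_trunc[OF Cc_smooth[OF w] k] p(1)])
  have i1: "integrable lborel (\<lambda>x. V x * (p x)\<^sup>2)"
    using potential_integrable[OF Vl V(2) order_refl p(1) p(1)] by (simp add: power2_eq_square)
  have i2: "integrable lborel (\<lambda>x. V x * (trunc k w x * p x)\<^sup>2)"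
    using potential_integrable[OF Vl V(2) order_refl tp tp] by (simp add: power2_eq_square)
  have "0 \<le> C / (1 + (norm (0::real^3))\<^sup>2)" using V(2)[of 0] V(3)[of 0] by linarith
  then have C: "C \<ge> 0" by simp
  have "(LINT x|lborel. V x * (p x)\<^sup>2) - (LINT x|lborel. V x * (trunc k w x * p x)\<^sup>2)
      = (LINT x|lborel. V x * (p x)\<^sup>2 - V x * (trunc k w x * p x)\<^sup>2)"
    using i1 i2 by simp
  also have "\<dots> \<le> (LINT x|lborel. (2 * k * M\<^sup>2 * C) * ((w x)\<^sup>2 / (1 + (norm x)\<^sup>2)))"
  proof (rule integral_mono)
    fix x
    have pM: "(p x)\<^sup>2 \<le> M\<^sup>2" using p(2)[of x] abs_le_square_iff[of "p x" M] by simp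
    have "V x * (p x)\<^sup>2 - V x * (trunc k w x * p x)\<^sup>2 = (V x * (p x)\<^sup>2) * (1 - (trunc k w x)\<^sup>2)"
      by (simp add: power_mult_distrib algebra_simps)
    also have "\<dots> \<le> (V x * (p x)\<^sup>2) * (2 * k * (w x)\<^sup>2)"
      using V(2)[of x] by (intro mult_left_mono trunc_bounds k) simp
    also have "\<dots> \<le> (C / (1 + (norm x)\<^sup>2) * M\<^sup>2) * (2 * k * (w x)\<^sup>2)"
      using V(2)[of x] V(3)[of x] pM k C by (intro mult_right_mono mult_mono) auto
    also have "\<dots> = (2 * k * M\<^sup>2 * C) * ((w x)\<^sup>2 / (1 + (norm x)\<^sup>2))" by simp
    finally show "V x * (p x)\<^sup>2 - V x * (trunc k w x * p x)\<^sup>2 \<le> (2 * k * M\<^sup>2 * C) * ((w x)\<^sup>2 / (1 + (norm x)\<^sup>2))" .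
    show "integrable lborel (\<lambda>x. V x * (p x)\<^sup>2 - V x * (trunc k w x * p x)\<^sup>2)"
      by (rule Bochner_Integration.integrable_diff[OF i1 i2])
    show "integrable lborel (\<lambda>x. (2 * k * M\<^sup>2 * C) * ((w x)\<^sup>2 / (1 + (norm x)\<^sup>2)))"
      by (rule integrable_mult_right[OF Hardy_inequality(1)[OF w]])
  qed
  also have "\<dots> = (2 * k * M\<^sup>2 * C) * (LINT x|lborel. (w x)\<^sup>2 / (1 + (norm x)\<^sup>2))"
    by (rule integral_mult_right_zero)
  also have "\<dots> \<le> (2 * k * M\<^sup>2 * C) * (4 * nsq (grad w))"
    using k C by (intro mult_left_mono Hardy_inequality(2)[OF w]) auto
  finally show ?thesis by (simp add: mult.assoc)
qed

text \<open>The potential involves \<open>\<phi>\<close> but the damping involves the approximant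
  \<open>w n\<close>, so the cap \<open>1 / k^2\<close> takes effect only in the limit, which
  \<open>\<phi>^4 p^2\<close> dominates.\<close>

lemma quartic_truncated:
  fixes \<phi> p :: "real^'n::finite \<Rightarrow> real"
  assumes p: "p \<in> Cc_infinity" and w: "\<And>n. w n \<in> Cc_infinity" and k: "k > 0"
    and lim: "AE x in lborel. (\<lambda>n. w n x) \<longlonglongrightarrow> \<phi> x"
    and \<phi>: "locally_integrable (\<lambda>x. \<phi> x ^ 4)"
  obtains J where "(\<lambda>n. LINT x|lborel. \<phi> x ^ 4 * (trunc k (w n) x * p x)\<^sup>2) \<longlonglongrightarrow> J" "J \<le> nsq p / k\<^sup>2"
proof -
  have pm [measurable]: "p \<in> borel_measurable borel" using p by (auto intro: smooth_borel)
  have tm [measurable]: "trunc k (w n) \<in> borel_measurable borel" for n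
    by (rule smooth_borel[OF smooth_trunc[OF Cc_smooth[OF w] k]])
  have fm [measurable]: "(\<lambda>x. \<phi> x ^ 4) \<in> borel_measurable borel" by (rule locally_integrable_measurable[OF \<phi>])
  \<comment> \<open>The hypothesis gives measurability of \<open>\<phi>^4\<close>; the square root
    transfers it to \<open>\<phi>^2\<close>, and thereby to \<open>trunc k \<phi>\<close>.\<close>
  have e: "(\<phi> x)\<^sup>2 = sqrt (\<phi> x ^ 4)" for x
    using real_sqrt_abs[of "(\<phi> x)\<^sup>2"] by (simp flip: power_mult)
  have sm [measurable]: "(\<lambda>x. (\<phi> x)\<^sup>2) \<in> borel_measurable borel"
    unfolding e by measurable
  have "0 \<le> \<phi> x ^ 4" for x by simp
  have i: "integrable lborel (\<lambda>x. \<phi> x ^ 4 * (p x)\<^sup>2)"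
    using potential_integrable[OF \<phi> \<open>\<And>x. 0 \<le> \<phi> x ^ 4\<close> order_refl p p] by (simp add: power2_eq_square)
  have t\<phi>: "trunc k \<phi> = (\<lambda>x. inverse (1 + k * (\<phi> x)\<^sup>2))" by (simp add: trunc_def[abs_def] power2_eq_square)
  have t\<phi>m [measurable]: "trunc k \<phi> \<in> borel_measurable borel" unfolding t\<phi> by measurable
  have le0: "\<phi> x ^ 4 * (trunc k w x * p x)\<^sup>2 \<le> \<phi> x ^ 4 * (p x)\<^sup>2" for w x
  proof -
    have "(trunc k w x)\<^sup>2 \<le> 1" using trunc_bounds(1,2)[OF k, of w x] power_le_one[of "trunc k w x" 2] by simp
    then show ?thesis by (simp add: power_mult_distrib mult_left_mono mult_left_le_one_le)
  qed
  have lims: "(\<lambda>n. LINT x|lborel. \<phi> x ^ 4 * (trunc k (w n) x * p x)\<^sup>2) \<longlonglongrightarrow> (LINT x|lborel. \<phi> x ^ 4 * (trunc k \<phi> x * p x)\<^sup>2)"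
  proof (rule integral_dominated_convergence[OF _ _ i])
    show "AE x in lborel. (\<lambda>n. \<phi> x ^ 4 * (trunc k (w n) x * p x)\<^sup>2) \<longlonglongrightarrow> \<phi> x ^ 4 * (trunc k \<phi> x * p x)\<^sup>2"
      using lim
    proof eventually_elim
      case (elim x)
      have "1 + k * (\<phi> x * \<phi> x) \<noteq> 0" using k add_pos_nonneg[of 1 "k * (\<phi> x * \<phi> x)"] by simp
      then show ?case unfolding trunc_def by (intro tendsto_intros elim)
    qed
    show "AE x in lborel. norm (\<phi> x ^ 4 * (trunc k (w n) x * p x)\<^sup>2) \<le> \<phi> x ^ 4 * (p x)\<^sup>2" for n
      using le0 by (intro AE_I2) simp
  qed simp_all
  have le: "(LINT x|lborel. \<phi> x ^ 4 * (trunc k \<phi> x * p x)\<^sup>2) \<le> (LINT x|lborel. (1 / k\<^sup>2) * (norm (p x))\<^sup>2)"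
  proof (rule integral_mono)
    show "integrable lborel (\<lambda>x. \<phi> x ^ 4 * (trunc k \<phi> x * p x)\<^sup>2)"
      by (rule Bochner_Integration.integrable_bound[OF i]) (use le0 in \<open>auto intro!: AE_I2\<close>)
    show "integrable lborel (\<lambda>x. (1 / k\<^sup>2) * (norm (p x))\<^sup>2)"
      by (intro integrable_mult_right Lp2_integrable Cc_Lp2 p)
    fix x
    have pos: "1 + k * (\<phi> x)\<^sup>2 > 0" using k by (simp add: add_pos_nonneg)
    have "(\<phi> x)\<^sup>2 * trunc k \<phi> x \<le> 1 / k"
      using pos k by (simp add: t\<phi> field_simps)
    then have "((\<phi> x)\<^sup>2 * trunc k \<phi> x)\<^sup>2 \<le> (1 / k)\<^sup>2"
      using trunc_bounds(1)[OF k, of \<phi> x] by (intro power_mono) auto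
    from mult_right_mono[OF this, of "(p x)\<^sup>2"]
    show "\<phi> x ^ 4 * (trunc k \<phi> x * p x)\<^sup>2 \<le> (1 / k\<^sup>2) * (norm (p x))\<^sup>2"
      by (simp add: power_mult_distrib power_divide mult.assoc flip: power_mult)
  qed
  have eq: "(LINT x|lborel. (1 / k\<^sup>2) * (norm (p x))\<^sup>2) = nsq p / k\<^sup>2" by (simp add: nsq_def)
  show ?thesis by (rule that[OF lims le[unfolded eq]])
qed

section \<open>Smallness of the perturbation and instability\<close>

lemma Lp6_power_loc:
  fixes \<phi> :: "real^'n::finite \<Rightarrow> real"
  assumes "\<phi> \<in> Lp 6" "m \<le> 6"
  shows "locally_integrable (\<lambda>x. \<phi> x ^ m)"
proof (rule locally_integrableI)
  have [measurable]: "\<phi> \<in> borel_measurable borel" and i6: "integrable lborel (\<lambda>x. norm (\<phi> x) ^ 6)"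
    using assms(1) by (auto simp: Lp_def)
  show pm: "(\<lambda>x. \<phi> x ^ m) \<in> borel_measurable borel" by measurable
  fix r
  show "integrable lborel (\<lambda>x. indicator (cball 0 r) x *\<^sub>R \<phi> x ^ m)"
  proof (rule Bochner_Integration.integrable_bound)
    show "integrable lborel (\<lambda>x. norm (\<phi> x) ^ 6 + indicator (cball 0 r) x * 1)"
      by (intro Bochner_Integration.integrable_add i6 integrable_indicator_cball)
    show "AE x in lborel. norm (indicator (cball 0 r) x *\<^sub>R \<phi> x ^ m) \<le> norm (norm (\<phi> x) ^ 6 + indicator (cball 0 r) x * 1)"
    proof (rule AE_I2)
      fix x
      have "\<bar>\<phi> x\<bar> ^ m \<le> \<bar>\<phi> x\<bar> ^ 6 + 1"
      proof (cases "\<bar>\<phi> x\<bar> \<le> 1")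
        case True
        then show ?thesis using power_le_one[of "\<bar>\<phi> x\<bar>" m] zero_le_power[of "\<bar>\<phi> x\<bar>" 6] by linarith
      next
        case False
        then show ?thesis using power_increasing[OF assms(2), of "\<bar>\<phi> x\<bar>"] by linarith
      qed
      then show "norm (indicator (cball 0 r) x *\<^sub>R \<phi> x ^ m) \<le> norm (norm (\<phi> x) ^ 6 + indicator (cball 0 r) x * 1)"
        by (simp add: indicator_def power_abs)
    qed
    show "(\<lambda>x. indicator (cball 0 r) x *\<^sub>R \<phi> x ^ m) \<in> borel_measurable lborel"
      using pm unfolding measurable_lborel1
      by (intro borel_measurable_scaleR borel_measurable_indicator) simp_all
  qed
qed

lemma Cc_decay:
  fixes V :: "real^'n::finite \<Rightarrow> real"
  assumes "V \<in> Cc_infinity"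
  obtains C where "\<And>x. V x \<le> C / (1 + (norm x)\<^sup>2)"
proof -
  obtain L where L: "L > 0" "\<And>x. \<bar>V x\<bar> \<le> L" using Cc_bounded[OF assms] by auto
  obtain r where r: "r > 0" "\<And>x. norm x \<ge> r \<Longrightarrow> V x = 0" using Cc_support[OF assms] by blast
  show ?thesis
  proof (rule that)
    fix x :: "real^'n"
    have p: "1 + (norm x)\<^sup>2 > 0" by (simp add: add_pos_nonneg)
    have "V x * (1 + (norm x)\<^sup>2) \<le> L * (1 + r\<^sup>2)"
    proof (cases "norm x \<ge> r")
      case True
      then show ?thesis using r(2)[of x] L(1) by simp
    next
      case False
      then have "(norm x)\<^sup>2 \<le> r\<^sup>2" by (intro power_mono) auto
      have "V x * (1 + (norm x)\<^sup>2) \<le> L * (1 + (norm x)\<^sup>2)"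
        using L(2)[of x] p by (intro mult_right_mono) auto
      also have "\<dots> \<le> L * (1 + r\<^sup>2)" using L(1) \<open>(norm x)\<^sup>2 \<le> r\<^sup>2\<close> by simp
      finally show ?thesis .
    qed
    then show "V x \<le> (L * (1 + r\<^sup>2)) / (1 + (norm x)\<^sup>2)" using p by (simp add: le_divide_eq)
  qed
qed

text \<open>With \<open>g\<close> the gap \<open>\<beta> I - A\<close>, four errors are held below
  \<open>g / 5\<close> each: the weight \<open>\<tau>\<close> on the gradient, the quartic term, the
  damping cost and the shift of the parameter. The first two are settled by \<open>\<tau>\<close>
  and \<open>k\<close>; \<open>e\<close> comes last, since the damping constant \<open>D\<close>
  depends on both.\<close>

theorem small_perturbation_unstable:
  fixes V u :: "real^3 \<Rightarrow> real"
  assumes V: "V \<in> Cc_infinity" "\<And>x. 0 \<le> V x" "V x0 \<noteq> 0" and \<beta>: "0 \<le> \<beta>"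
    and u: "u \<in> Cc_infinity" "nsq (grad u) < (LINT x|lborel. \<beta> * V x * (u x)\<^sup>2)"
  obtains e where "e > 0"
    "\<And>\<alpha> \<phi>. 0 \<le> \<alpha> \<Longrightarrow> \<phi> \<in> H1_dot \<Longrightarrow> \<bar>\<alpha> - \<beta>\<bar> \<le> e \<Longrightarrow> H1_dot_norm \<phi> \<le> e \<Longrightarrow> unstable V \<alpha> \<phi>"
proof -
  have b: "bump V x0" using V by unfold_locales auto
  interpret bump V x0 by fact
  obtain C where C: "\<And>x. V x \<le> C / (1 + (norm x)\<^sup>2)" using Cc_decay[OF V(1)] by blast
  have "0 \<le> C / (1 + (norm (0::real^3))\<^sup>2)" using V(2)[of 0] C[of 0] by linarith
  then have C0: "C \<ge> 0" by simp
  obtain M where M: "M > 0" "\<And>x. \<bar>u x\<bar> \<le> M" using Cc_bounded[OF u(1)] by auto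
  define A where "A = nsq (grad u)"
  define I where "I = (LINT x|lborel. V x * (u x)\<^sup>2)"
  define N where "N = nsq u"
  have pos: "A \<ge> 0" "I \<ge> 0" "N \<ge> 0"
    unfolding A_def I_def N_def using V(2) by (auto intro: integral_nonneg_AE)
  define g where "g = \<beta> * I - A"
  have g: "g > 0" using u(2) by (simp add: g_def A_def I_def mult.assoc)
  define \<tau> where "\<tau> = g / (5 * (A + 1))"
  have \<tau>: "\<tau> > 0" "\<tau> * A \<le> g / 5" using g pos by (auto simp: \<tau>_def field_simps)
  \<comment> \<open>The 25 combines the 5 in front of \<open>\<phi>^4\<close> with the share
    \<open>g / 5\<close>; the \<open>1 +\<close> gives \<open>k \<ge> 1\<close>, so that
    \<open>k\<close> may be replaced by \<open>k^2\<close>.\<close>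
  define k where "k = 1 + 25 * N / g"
  have k: "k \<ge> 1" "k > 0" using g pos by (auto simp: k_def add_pos_nonneg)
  have kN: "5 * (N / k\<^sup>2) \<le> g / 5"
  proof -
    have "25 * N \<le> g * k" using g by (simp add: k_def field_simps)
    also have "\<dots> \<le> g * k\<^sup>2" using k g by (intro mult_left_mono) (auto simp: power2_eq_square)
    finally show ?thesis using k by (simp add: field_simps)
  qed
  \<comment> \<open>The coefficients of the squared gradient norm in both damping estimates, with
    \<open>\<alpha>\<close> replaced by its bound \<open>\<beta> + 1\<close>.\<close>
  define D where "D = (1 + 1 / \<tau>) * (M\<^sup>2 * k) + (\<beta> + 1) * (8 * k * M\<^sup>2 * C)"
  have D: "D \<ge> 0" using \<tau> k C0 \<beta> by (simp add: D_def)
  \<comment> \<open>\<open>e \<le> 1\<close> serves twice: for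
    \<open>\<alpha> \<le> \<beta> + 1\<close> and for replacing \<open>e^2\<close> by
    \<open>e\<close>.\<close>
  define e where "e = min 1 (g / (5 * (I + D + 1)))"
  have e: "e > 0" "e \<le> 1" using g pos D by (auto simp: e_def)
  have "e * (I + D + 1) \<le> g / 5"
  proof -
    have "e * (I + D + 1) \<le> (g / (5 * (I + D + 1))) * (I + D + 1)"
      using pos D by (intro mult_right_mono) (auto simp: e_def)
    also have "\<dots> = g / 5"
    proof -
      have "g / (5 * s) * s = g / 5" if "s > 0" for s using that by simp
      moreover have "I + D + 1 > 0" using pos D by linarith
      ultimately show ?thesis by blast
    qed
    finally show ?thesis .
  qed
  moreover have "e * (I + D + 1) = e * I + e * D + e" by (simp add: algebra_simps)
  moreover have "e * I \<ge> 0" "e * D \<ge> 0" using e pos D by simp_all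
  ultimately have eI: "e * I \<le> g / 5" and eD: "e * D \<le> g / 5" using e by linarith+
  show ?thesis
  proof (rule that[OF e(1)])
    fix \<alpha> \<phi> assume \<alpha>: "0 \<le> \<alpha>" "\<bar>\<alpha> - \<beta>\<bar> \<le> e" and \<phi>: "\<phi> \<in> H1_dot" "H1_dot_norm \<phi> \<le> e"
    obtain G where \<phi>6: "\<phi> \<in> Lp 6" and G: "G \<in> Lp 2" "has_weak_gradient \<phi> G"
      using \<phi>(1) by (auto simp: H1_dot_def)
    have "nsq G = (H1_dot_norm \<phi>)\<^sup>2" using H1_dot_norm_eq[OF mollifier_exists G(2)] by simp
    also have "\<dots> \<le> e\<^sup>2" using \<phi>(2) by (intro power_mono) (auto simp: H1_dot_norm_def)
    also have "\<dots> \<le> e" using e by (simp add: power2_eq_square mult_left_le)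
    finally have Ge: "nsq G \<le> e" .
    have sq: "integrable lborel (\<lambda>x. indicator (cball 0 r) x * (\<phi> x)\<^sup>2)" for r
      using locally_integrable_cball[OF Lp6_power_loc[OF \<phi>6, of 2], of r] by simp
    obtain w where w: "\<And>n. w n \<in> Cc_infinity" "L2lim (\<lambda>n. grad (w n)) G"
      "AE x in lborel. (\<lambda>n. w n x) \<longlonglongrightarrow> \<phi> x"
      by (rule dense_weak_gradient[OF G(2,1) sq tail_Lp6[OF b \<phi>6]]) (rule that)
    have \<phi>4: "locally_integrable (\<lambda>x. \<phi> x ^ 4)" by (rule Lp6_power_loc[OF \<phi>6]) simp
    obtain J where J: "(\<lambda>n. LINT x|lborel. \<phi> x ^ 4 * (trunc k (w n) x * u x)\<^sup>2) \<longlonglongrightarrow> J" "J \<le> nsq u / k\<^sup>2"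
      by (rule quartic_truncated[OF u(1) w(1) k(2) w(3) \<phi>4]) (rule that)
    \<comment> \<open>An upper bound for the energy of the test function damped with
      \<open>w n\<close>. Its terms converge, so a negative limit yields an index with negative
      energy.\<close>
    define U where "U n = (1 + \<tau>) * A + (1 + 1 / \<tau>) * (M\<^sup>2 * k) * nsq (grad (w n))
      + 5 * (LINT x|lborel. \<phi> x ^ 4 * (trunc k (w n) x * u x)\<^sup>2)
      - \<alpha> * (I - 8 * k * M\<^sup>2 * C * nsq (grad (w n)))" for n
    have Ulim: "U \<longlonglongrightarrow> (1 + \<tau>) * A + (1 + 1 / \<tau>) * (M\<^sup>2 * k) * nsq G + 5 * J - \<alpha> * (I - 8 * k * M\<^sup>2 * C * nsq G)"
      unfolding U_def by (intro tendsto_intros J(1) L2lim_nsq[OF w(2)])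
    have "(1 + \<tau>) * A + (1 + 1 / \<tau>) * (M\<^sup>2 * k) * nsq G + 5 * J - \<alpha> * (I - 8 * k * M\<^sup>2 * C * nsq G) < 0"
    proof -
      have ab: "\<alpha> \<le> \<beta> + 1" "\<beta> - e \<le> \<alpha>" using \<alpha> e by auto
      have 1: "\<alpha> * (8 * k * M\<^sup>2 * C) \<le> (\<beta> + 1) * (8 * k * M\<^sup>2 * C)"
        using ab k C0 by (intro mult_right_mono) auto
      then have "((1 + 1 / \<tau>) * (M\<^sup>2 * k) + \<alpha> * (8 * k * M\<^sup>2 * C)) * nsq G \<le> D * nsq G"
        by (intro mult_right_mono) (auto simp: D_def)
      also have "\<dots> \<le> D * e" by (rule mult_left_mono[OF Ge D])
      finally have 2: "((1 + 1 / \<tau>) * (M\<^sup>2 * k) + \<alpha> * (8 * k * M\<^sup>2 * C)) * nsq G \<le> g / 5"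
        using eD by (simp add: mult.commute)
      have 3: "(\<beta> - e) * I \<le> \<alpha> * I" by (rule mult_right_mono[OF ab(2) pos(2)])
      have 4: "5 * J \<le> g / 5" using J(2) kN by (simp add: N_def)
      have "(1 + \<tau>) * A + (1 + 1 / \<tau>) * (M\<^sup>2 * k) * nsq G + 5 * J - \<alpha> * (I - 8 * k * M\<^sup>2 * C * nsq G)
        = A + \<tau> * A + ((1 + 1 / \<tau>) * (M\<^sup>2 * k) + \<alpha> * (8 * k * M\<^sup>2 * C)) * nsq G + 5 * J - \<alpha> * I"
        by (simp add: algebra_simps)
      also have "\<dots> \<le> A + g / 5 + g / 5 + g / 5 - (\<beta> - e) * I"
        using \<tau>(2) 2 3 4 by (intro diff_mono add_mono) auto
      also have "(\<beta> - e) * I = g + A - e * I" by (simp add: g_def algebra_simps)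
      also have "A + g / 5 + g / 5 + g / 5 - (g + A - e * I) < 0" using eI g by simp
      finally show ?thesis .
    qed
    from order_tendstoD(2)[OF Ulim this] obtain n where n: "U n < 0" by (auto simp: eventually_sequentially)
    define v where "v x = trunc k (w n) x * u x" for x
    have v: "v \<in> Cc_infinity"
      unfolding v_def[abs_def] by (rule Cc_mult_smooth[OF smooth_trunc[OF Cc_smooth[OF w(1)] k(2)] u(1)])
    have g1: "nsq (grad v) \<le> (1 + \<tau>) * A + (1 + 1 / \<tau>) * (M\<^sup>2 * k) * nsq (grad (w n))"
      unfolding v_def[abs_def] A_def by (rule grad_truncated[OF u(1) M(2) w(1) k(2) \<tau>(1)])
    have g2: "I - 8 * k * M\<^sup>2 * C * nsq (grad (w n)) \<le> (LINT x|lborel. V x * (v x)\<^sup>2)"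
      unfolding v_def I_def by (rule potential_truncated[OF V(1,2) C u(1) M(2) w(1) k(2)])
    have "\<alpha> * (I - 8 * k * M\<^sup>2 * C * nsq (grad (w n))) \<le> \<alpha> * (LINT x|lborel. V x * (v x)\<^sup>2)"
      by (rule mult_left_mono[OF g2 \<alpha>(1)])
    then have "nsq (grad v) + 5 * (LINT x|lborel. \<phi> x ^ 4 * (v x)\<^sup>2) < \<alpha> * (LINT x|lborel. V x * (v x)\<^sup>2)"
      using n g1 unfolding U_def v_def by linarith
    then have neg: "nsq (grad v) + (LINT x|lborel. (5 * \<phi> x ^ 4) * (v x)\<^sup>2) < (LINT x|lborel. (\<alpha> * V x) * (v x)\<^sup>2)"
      by (simp add: mult.assoc)
    have P: "locally_integrable (\<lambda>x. 5 * \<phi> x ^ 4)"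
    proof (rule locally_integrableI)
      show "(\<lambda>x. 5 * \<phi> x ^ 4) \<in> borel_measurable borel" using locally_integrable_measurable[OF \<phi>4] by simp
      show "integrable lborel (\<lambda>x. indicator (cball 0 r) x *\<^sub>R (5 * \<phi> x ^ 4))" for r
        using integrable_mult_right[OF locally_integrable_cball[OF \<phi>4, of r], of 5] by (simp add: mult.left_commute)
    qed
    have "0 \<le> 5 * \<phi> x ^ 4" "0 \<le> \<alpha> * V x" for x using V(2) \<alpha>(1) by simp_all
    \<comment> \<open>\<open>V\<close> doubles as the bump function; \<open>\<alpha> V\<close> is
      the compact part of the form and \<open>5 \<phi>^4\<close> the nonnegative potential.\<close>
    from negative_eigenvalue_exists[OF b P this(1) Cc_cmul[OF V(1)] this(2) v neg]
    show "unstable V \<alpha> \<phi>" by (simp add: unstable_def)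
  qed
qed

theorem lemma2p3:
  fixes V :: "real^3 \<Rightarrow> real"
    and \<alpha>\<^sub>1 \<alpha>\<^sub>2 :: real
    and lambda1 :: "real \<Rightarrow> real"
  assumes V_smooth: "V \<in> Cc_infinity"
    and V_nonneg: "\<forall>x. 0 \<le> V x"
    and V_nonzero: "\<exists>x. V x \<noteq> 0"
    and alpha1_nonneg: "0 \<le> \<alpha>\<^sub>1"
    and principal: "\<forall>\<alpha>\<ge>\<alpha>\<^sub>1. principal_eigenvalue (\<lambda>x. - \<alpha> * V x) (lambda1 \<alpha>) \<and> lambda1 \<alpha> < 0"
    and alpha2: "\<alpha>\<^sub>1 < \<alpha>\<^sub>2"
    and bifurcation: "\<forall>\<epsilon>>0. \<exists>\<alpha>\<ge>0. \<exists>\<phi>. steady_state V \<alpha> \<phi> \<and> nontrivial \<phi> \<and> radial \<phi> \<and>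
                        \<bar>\<alpha> - \<alpha>\<^sub>2\<bar> + H1_dot_norm \<phi> \<le> \<epsilon>"
  shows "\<exists>\<epsilon>\<^sub>0>0. \<forall>\<epsilon>. 0 < \<epsilon> \<and> \<epsilon> \<le> \<epsilon>\<^sub>0 \<longrightarrow>
           (\<forall>\<alpha>\<ge>0. \<forall>\<phi>. steady_state V \<alpha> \<phi> \<and> nontrivial \<phi> \<and> radial \<phi> \<and>
              \<bar>\<alpha> - \<alpha>\<^sub>2\<bar> + H1_dot_norm \<phi> \<le> \<epsilon> \<longrightarrow> unstable V \<alpha> \<phi>)"
proof -
  obtain x0 where x0: "V x0 \<noteq> 0" using V_nonzero by blast
  have V0: "0 \<le> V x" for x using V_nonneg by blast
  have b: "bump V x0" using V_smooth V0 x0 by unfold_locales auto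
  have \<alpha>2: "0 \<le> \<alpha>\<^sub>2" using alpha1_nonneg alpha2 by linarith
  have "principal_eigenvalue (\<lambda>x. - \<alpha>\<^sub>2 * V x) (lambda1 \<alpha>\<^sub>2)" and neg: "lambda1 \<alpha>\<^sub>2 < 0"
    using principal alpha2 by auto
  then have "schrodinger_eigenvalue (\<lambda>x. - (\<alpha>\<^sub>2 * V x)) (lambda1 \<alpha>\<^sub>2)"
    by (simp add: principal_eigenvalue_def)
  \<comment> \<open>Strict negativity at \<open>\<alpha>\<^sub>2\<close> on one test function leaves
    a gap that absorbs both the change of parameter and the quartic term.\<close>
  from negative_direction[OF b Cc_cmul[OF V_smooth] _ this neg] \<alpha>2 V0
  obtain u where u: "u \<in> Cc_infinity" "nsq (grad u) < (LINT x|lborel. \<alpha>\<^sub>2 * V x * (u x)\<^sup>2)" by auto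
  obtain e where e: "e > 0"
    "\<And>\<alpha> \<phi>. 0 \<le> \<alpha> \<Longrightarrow> \<phi> \<in> H1_dot \<Longrightarrow> \<bar>\<alpha> - \<alpha>\<^sub>2\<bar> \<le> e \<Longrightarrow> H1_dot_norm \<phi> \<le> e \<Longrightarrow> unstable V \<alpha> \<phi>"
    by (rule small_perturbation_unstable[OF V_smooth V0 x0 \<alpha>2 u]) (rule that)
  have "unstable V \<alpha> \<phi>"
    if "\<epsilon> \<le> e" "0 \<le> \<alpha>" "steady_state V \<alpha> \<phi>" "\<bar>\<alpha> - \<alpha>\<^sub>2\<bar> + H1_dot_norm \<phi> \<le> \<epsilon>" for \<epsilon> \<alpha> \<phi>
  proof (rule e(2)[OF that(2)])
    show "\<phi> \<in> H1_dot" using that(3) by (simp add: steady_state_def)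
    have "0 \<le> H1_dot_norm \<phi>" by (simp add: H1_dot_norm_def)
    then show "\<bar>\<alpha> - \<alpha>\<^sub>2\<bar> \<le> e" "H1_dot_norm \<phi> \<le> e" using that(1,4) abs_ge_zero[of "\<alpha> - \<alpha>\<^sub>2"] by linarith+
  qed
  then show ?thesis using e(1) by (intro exI[of _ e]) blast
qed

end
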